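(* Let $\alpha>-1$ and $\alpha+\beta>-1/2$. Then, for each $t>0$, $C_c^\infty(0,\infty)\subset \operatorname{Dom} M_t^{\alpha,\beta}$ and $$\mathcal{M}_t^{\alpha,\beta}f = M_t^{\alpha,\beta}f,\qquad f\in C_c^\infty(0,\infty).$$
   Context: $J_\nu$ is the Bessel function of the first kind of order $\nu$, and $d\mu_\alpha(y)=y^{2\alpha+1}dy$ on $\mathbb{R}_+=(0,\infty)$. For $\alpha>-1$ the (modified) Hankel transform is $\mathcal{H}_\alpha f(x)=\int_0^\infty f(y)\frac{J_\alpha(xy)}{(xy)^\alpha}\,d\mu_\alpha(y)$, $x>0$, for suitable $f$; it extends to an isometry of $L^2(\mathbb{R}_+,d\mu_\alpha)$ with $\mathcal{H}_\alpha^{-1}=\mathcal{H}_\alpha$. For $\alpha>-1$, $\alpha+\beta\ge -1/2$ and $t>0$, the operator $\mathcal{M}_t^{\alpha,\beta}$, bounded on $L^2(\mathbb{R}_+,d\mu_\alpha)$, is defined by $\mathcal{M}_t^{\alpha,\beta}f=\mathcal{H}_\alpha\big(m_{\alpha,\beta}(t\,\cdot)\mathcal{H}_\alpha f\big)$, where $m_{\alpha,\beta}(s)=2^{\alpha+\beta}\Gamma(\alpha+\beta+1)\frac{J_{\alpha+\beta}(s)}{s^{\alpha+\beta}}$, $s>0$ (a bounded function). For $\alpha>-1$, $\alpha+\beta>-1/2$, $t,x,z>0$ with $t\ne|x-z|$, $t\neq x+z$, the kernel is $$K_t^{\alpha,\beta}(x,z)=2^{\alpha+\beta}\Gamma(\alpha+\beta+1)\int_0^\infty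 \frac{J_{\alpha+\beta}(ty)}{(ty)^{\alpha+\beta}}\frac{J_\alpha(xy)}{(xy)^\alpha}\frac{J_\alpha(zy)}{(zy)^\alpha}\,d\mu_\alpha(y),$$ the integral converging absolutely if $\alpha+\beta>1/2$ and otherwise, at $\infty$, being understood as an improper Riemann integral. The integral operator is $M_t^{\alpha,\beta}f(x)=\int_0^\infty K_t^{\alpha,\beta}(x,z)f(z)\,d\mu_\alpha(z)$, and $\operatorname{Dom}M_t^{\alpha,\beta}$ is the set of all $f$ for which this integral converges absolutely for a.a. $x>0$. *)

theory Defs
  imports "HOL-Analysis.Analysis"
begin

text \<open>Functions on the half-line are total functions on the reals whose values
  outside \<open>{0<..}\<close> play no role: the measure below has \<open>{0<..}\<close> as its space.\<close>

definition mu :: "real \<Rightarrow> real measure" where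
  "mu \<alpha> = density (restrict_space lborel {0<..}) (\<lambda>y. ennreal (y powr (2 * \<alpha> + 1)))"

text \<open>The power series with \<open>rGamma = 1 / Gamma\<close> (zero at the poles of \<open>Gamma\<close>);
  meaningful for \<open>s > 0\<close> because of \<open>powr\<close>.\<close>

definition bessel_J :: "real \<Rightarrow> real \<Rightarrow> real" where
  "bessel_J \<nu> s =
    (\<Sum>k. (- 1) ^ k / fact k * rGamma (\<nu> + real k + 1) * (s / 2) powr (2 * real k + \<nu>))"

definition bessel_quot :: "real \<Rightarrow> real \<Rightarrow> real" where
  "bessel_quot \<nu> s = bessel_J \<nu> s / s powr \<nu>"

definition hankel :: "real \<Rightarrow> (real \<Rightarrow> complex) \<Rightarrow> real \<Rightarrow> complex" where
  "hankel \<alpha> f x = (LINT y|mu \<alpha>. of_real (bessel_quot \<alpha> (x * y)) * f y)"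

definition L2 :: "real \<Rightarrow> (real \<Rightarrow> complex) set" where
  "L2 \<alpha> = {f \<in> borel_measurable (mu \<alpha>). integrable (mu \<alpha>) (\<lambda>x. (norm (f x))\<^sup>2)}"

definition L2_tendsto :: "real \<Rightarrow> (nat \<Rightarrow> real \<Rightarrow> complex) \<Rightarrow> (real \<Rightarrow> complex) \<Rightarrow> bool" where
  "L2_tendsto \<alpha> u g \<longleftrightarrow> (\<lambda>n. LINT x|mu \<alpha>. (norm (u n x - g x))\<^sup>2) \<longlonglongrightarrow> 0"

text \<open>The square-integrable functions on which the Hankel transform is given by an
  absolutely convergent integral. The subspace contains all smooth functions with compact
  support in \<open>{0<..}\<close>, hence is dense; the requirement that the transform be square-integrable
  is automatic, by Plancherel applied to the truncations of \<open>f\<close> to compact intervals.\<close>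

definition hankel_core :: "real \<Rightarrow> (real \<Rightarrow> complex) set" where
  "hankel_core \<alpha> = {f \<in> L2 \<alpha>.
     (\<forall>x>0. integrable (mu \<alpha>) (\<lambda>y. of_real (bessel_quot \<alpha> (x * y)) * f y)) \<and>
     hankel \<alpha> f \<in> L2 \<alpha>}"

text \<open>The continuous extension of the Hankel transform to the whole of \<open>L2 \<alpha>\<close>. As an element of
  \<open>L2 \<alpha>\<close> the value is determined only almost everywhere; \<open>hankel_L2\<close> picks a representative.\<close>

definition hankel_L2_graph :: "real \<Rightarrow> (real \<Rightarrow> complex) \<Rightarrow> (real \<Rightarrow> complex) \<Rightarrow> bool" where
  "hankel_L2_graph \<alpha> f g \<longleftrightarrow> f \<in> L2 \<alpha> \<and> g \<in> L2 \<alpha> \<and>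
     (\<exists>u. (\<forall>n. u n \<in> hankel_core \<alpha>) \<and> L2_tendsto \<alpha> u f \<and> L2_tendsto \<alpha> (\<lambda>n. hankel \<alpha> (u n)) g)"

definition hankel_L2 :: "real \<Rightarrow> (real \<Rightarrow> complex) \<Rightarrow> real \<Rightarrow> complex" where
  "hankel_L2 \<alpha> f = (SOME g. hankel_L2_graph \<alpha> f g)"

definition multiplier :: "real \<Rightarrow> real \<Rightarrow> real \<Rightarrow> real" where
  "multiplier \<alpha> \<beta> s = 2 powr (\<alpha> + \<beta>) * Gamma (\<alpha> + \<beta> + 1) * bessel_quot (\<alpha> + \<beta>) s"

definition multiplier_op ::
    "real \<Rightarrow> real \<Rightarrow> real \<Rightarrow> (real \<Rightarrow> complex) \<Rightarrow> real \<Rightarrow> complex" where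
  "multiplier_op \<alpha> \<beta> t f =
     hankel_L2 \<alpha> (\<lambda>y. of_real (multiplier \<alpha> \<beta> (t * y)) * hankel_L2 \<alpha> f y)"

text \<open>The integral is improper at infinity; when it converges absolutely
  (\<open>\<alpha> + \<beta> > 1/2\<close>) the limit is the Lebesgue integral over \<open>{0<..}\<close>. The value is not meaningful
  for \<open>t = \<bar>x - z\<bar>\<close> and \<open>t = x + z\<close>, which for given \<open>t\<close> and \<open>x\<close> is a null set of \<open>z\<close>.\<close>

definition kernel :: "real \<Rightarrow> real \<Rightarrow> real \<Rightarrow> real \<Rightarrow> real \<Rightarrow> real" where
  "kernel \<alpha> \<beta> t x z = 2 powr (\<alpha> + \<beta>) * Gamma (\<alpha> + \<beta> + 1) *
     Lim at_top (\<lambda>R. LINT y:{0<..R}|mu \<alpha>.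
       bessel_quot (\<alpha> + \<beta>) (t * y) * bessel_quot \<alpha> (x * y) * bessel_quot \<alpha> (z * y))"

definition kernel_op ::
    "real \<Rightarrow> real \<Rightarrow> real \<Rightarrow> (real \<Rightarrow> complex) \<Rightarrow> real \<Rightarrow> complex" where
  "kernel_op \<alpha> \<beta> t f x = (LINT z|mu \<alpha>. of_real (kernel \<alpha> \<beta> t x z) * f z)"

definition kernel_dom :: "real \<Rightarrow> real \<Rightarrow> real \<Rightarrow> (real \<Rightarrow> complex) set" where
  "kernel_dom \<alpha> \<beta> t =
     {f. AE x in mu \<alpha>. integrable (mu \<alpha>) (\<lambda>z. of_real (kernel \<alpha> \<beta> t x z) * f z)}"

definition Cc_infinity :: "(real \<Rightarrow> complex) set" where
  "Cc_infinity = {f.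
     (\<forall>n. \<forall>x>0. ((\<lambda>g y. vector_derivative g (at y)) ^^ n) f differentiable (at x)) \<and>
     (\<exists>K. compact K \<and> K \<subseteq> {0<..} \<and> (\<forall>x>0. x \<notin> K \<longrightarrow> f x = 0))}"

end

theory Submission
  imports Defs
begin

text \<open>Write \<open>q\<^sub>\<nu> s = J\<^sub>\<nu> s / s powr \<nu>\<close> for \<open>bessel_quot\<close>, put \<open>\<gamma> = \<alpha> + \<beta>\<close>, and let
  \<open>h y = m (t y) (H\<^sub>\<alpha> f) y\<close> be the filtered transform of a test function \<open>f\<close>. Formally
  \<open>H\<^sub>\<alpha> h x\<close> is the iterated integral of \<open>m (t y) q\<^sub>\<alpha> (x y) q\<^sub>\<alpha> (z y) f z\<close> over \<open>z\<close> and then \<open>y\<close>, and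
  interchanging the integrations produces \<open>\<integral> K(x, z) f z d\<mu>(z)\<close>. The proof justifies this for
  every \<open>x > 0\<close>, and shows that the \<open>L\<^sup>2\<close> extension of the Hankel transform, chosen by
  \<open>hankel_L2\<close>, is the integral transform on \<open>f\<close> and on \<open>h\<close>.

  The interchange. After truncation to \<open>y \<le> R\<close> Fubini's theorem applies, because everything is
  bounded with bounded support. On the side of \<open>y\<close> the limit \<open>R \<rightarrow> \<infinity>\<close> is taken by
  the rapid decay of \<open>h\<close>. On the side of \<open>z\<close> the truncated kernels have to converge under a
  locally integrable majorant. The asymptotics \<open>s powr (\<nu> + 1/2) * q\<^sub>\<nu> s = A cos (s - \<phi>) + O(1/s)\<close>
  turn the integrand of the kernel into \<open>y powr -(\<gamma> + 1/2)\<close> times a sum of four cosines with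
  frequencies \<open>t \<plusminus> x \<plusminus> z\<close>, up to an absolutely integrable error; such an integral converges if the
  frequency \<open>\<omega>\<close> does not vanish, and it is bounded by \<open>C (1 + \<bar>\<omega>\<bar> powr -p)\<close> with some \<open>p < 1\<close>,
  uniformly in \<open>R\<close> (\<open>kernel_truncation\<close>, \<open>kernel_op_eq_hankel\<close>).

  The extension. Two limits of the same sequence are identified by pairing them with indicators of
  intervals \<open>{a..b}\<close>: the Hankel transform of such an indicator is the difference of two explicit
  boundary terms, hence square integrable, and Fubini moves the transform across
  (\<open>hankel_L2_graph_unique\<close>). This makes \<open>hankel_L2\<close> agree with \<open>hankel\<close> on \<open>hankel_core\<close>. That
  \<open>f\<close> and \<open>h\<close> belong to \<open>hankel_core\<close> follows from the integration by parts
  \<open>H\<^sub>\<alpha> F = - H\<^bsub>\<alpha>+1\<^esub> (F' / y)\<close>: the transform of order \<open>\<nu>\<close> of a rapidly decreasing function is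
  \<open>O(x powr -(\<nu> + 1/2))\<close>, so each step gains one power. Iterating it shows that \<open>H\<^sub>\<alpha> f\<close> is
  rapidly decreasing, and a single step applied to \<open>h\<close> makes \<open>H\<^sub>\<alpha> h\<close> square integrable.

  The facts on Bessel functions are derived from the power series: two first-order relations
  between \<open>q\<^sub>\<nu>\<close> and \<open>q\<^bsub>\<nu>+1\<^esub>\<close>, and from them the asymptotics by an energy argument for the
  differential equation.\<close>

abbreviation q :: "real \<Rightarrow> real \<Rightarrow> real" where "q \<equiv> bessel_quot"

section \<open>The entire function behind the Bessel quotient\<close>

text \<open>The coefficient of \<open>s ^ (2 k)\<close> in the Taylor series of \<open>bessel_quot \<nu> s\<close>.\<close>

definition bessel_coeff :: "real \<Rightarrow> nat \<Rightarrow> real" where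
  "bessel_coeff \<nu> k = (- 1) ^ k / fact k * rGamma (\<nu> + real k + 1) / 4 ^ k * 2 powr (- \<nu>)"

text \<open>In the variable \<open>X = s\<^sup>2\<close> the quotient is an entire function, also at \<open>X = 0\<close>, where
  \<open>bessel_quot\<close> itself is meaningless because of \<open>powr\<close>.\<close>

definition bessel_entire :: "real \<Rightarrow> real \<Rightarrow> real" where
  "bessel_entire \<nu> X = (\<Sum>k. bessel_coeff \<nu> k * X ^ k)"

lemma bessel_coeff_shift:
  "2 * (\<nu> + 1 + real k) * bessel_coeff (\<nu> + 1) k = bessel_coeff \<nu> k"
proof -
  have a: "rGamma (\<nu> + real k + 1) = (\<nu> + real k + 1) * rGamma (\<nu> + 1 + real k + 1)"
    using rGamma_plus1[of "\<nu> + real k + 1"] by (simp add: add_ac)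
  have b: "2 powr - (\<nu> + 1) = 2 powr (- \<nu>) / (2::real)"
    by (simp add: powr_diff powr_minus field_simps)
  show ?thesis
    unfolding bessel_coeff_def a b by (simp add: divide_simps)
qed

lemma bessel_coeff_Suc:
  "real (Suc k) * bessel_coeff \<nu> (Suc k) = - (1 / 2) * bessel_coeff (\<nu> + 1) k"
proof -
  have a: "\<nu> + real (Suc k) + 1 = \<nu> + 1 + real k + 1" by simp
  have b: "2 powr - (\<nu> + 1) = 2 powr (- \<nu>) / (2::real)"
    by (simp add: powr_diff powr_minus field_simps)
  show ?thesis
    unfolding bessel_coeff_def a b by (simp add: divide_simps del: of_nat_Suc)
qed

lemma summable_bessel_entire: "summable (\<lambda>k. bessel_coeff \<nu> k * X ^ k)"
proof (rule summable_ratio_test[where c = "1/2" and N = "nat \<lceil>\<bar>\<nu>\<bar> + \<bar>X\<bar>\<rceil>"])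
  \<comment> \<open>From \<open>n \<ge> \<bar>\<nu>\<bar> + \<bar>X\<bar>\<close> on, the ratio of consecutive terms is at most \<open>1/2\<close>.\<close>
  show "norm (bessel_coeff \<nu> (Suc n) * X ^ Suc n) \<le> 1 / 2 * norm (bessel_coeff \<nu> n * X ^ n)"
    if "n \<ge> nat \<lceil>\<bar>\<nu>\<bar> + \<bar>X\<bar>\<rceil>" for n
  proof -
    have n: "real n \<ge> \<bar>\<nu>\<bar> + \<bar>X\<bar>" using that by linarith
    define d where "d = 4 * real (Suc n) * (\<nu> + 1 + real n)"
    have d1: "d \<ge> 4 * real (Suc n) * 1"
      unfolding d_def using n by (intro mult_left_mono) auto
    have d2: "d \<ge> 2 * \<bar>X\<bar>" "d > 0" using d1 n by auto
    have eq: "bessel_coeff \<nu> n = - d * bessel_coeff \<nu> (Suc n)"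
    proof -
      have "bessel_coeff (\<nu> + 1) n = - 2 * (real (Suc n) * bessel_coeff \<nu> (Suc n))"
        using bessel_coeff_Suc[of n \<nu>] by simp
      then show ?thesis
        unfolding bessel_coeff_shift[of \<nu> n, symmetric] d_def by (simp only:) (simp add: algebra_simps)
    qed
    have "2 * \<bar>X\<bar> * (\<bar>bessel_coeff \<nu> (Suc n)\<bar> * \<bar>X\<bar> ^ n) \<le> d * (\<bar>bessel_coeff \<nu> (Suc n)\<bar> * \<bar>X\<bar> ^ n)"
      using d2 by (intro mult_right_mono) auto
    then show ?thesis using d2 by (simp add: eq abs_mult power_abs algebra_simps)
  qed
qed simp

lemma has_real_derivative_bessel_entire:
  "(bessel_entire \<nu> has_real_derivative - (1 / 2) * bessel_entire (\<nu> + 1) X) (at X)"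
proof -
  have "(bessel_entire \<nu> has_real_derivative (\<Sum>k. diffs (bessel_coeff \<nu>) k * X ^ k)) (at X)"
    unfolding bessel_entire_def[abs_def]
    by (rule termdiffs_strong_converges_everywhere) (rule summable_bessel_entire)
  moreover have "(\<Sum>k. diffs (bessel_coeff \<nu>) k * X ^ k) = - (1 / 2) * bessel_entire (\<nu> + 1) X"
    unfolding diffs_def bessel_coeff_Suc mult.assoc bessel_entire_def
    by (subst suminf_mult[symmetric]) (simp_all add: summable_bessel_entire)
  ultimately show ?thesis by simp
qed

lemma bessel_quot_eq_entire:
  assumes "s > 0" shows "q \<nu> s = bessel_entire \<nu> (s\<^sup>2)"
proof -
  have "(- 1) ^ k / fact k * rGamma (\<nu> + real k + 1) * (s / 2) powr (2 * real k + \<nu>)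
      = bessel_coeff \<nu> k * (s\<^sup>2) ^ k * s powr \<nu>" for k
  proof -
    have "(s / 2) powr (2 * real k + \<nu>) = (s / 2) powr real (2 * k) * (s / 2) powr \<nu>"
      by (simp add: powr_add)
    also have "(s / 2) powr real (2 * k) = (s\<^sup>2) ^ k / 4 ^ k"
      using assms by (subst powr_realpow) (auto simp: power_mult power_divide)
    also have "(s / 2) powr \<nu> = s powr \<nu> * 2 powr (- \<nu>)"
      using assms by (simp add: powr_divide powr_minus field_simps)
    finally show ?thesis by (simp add: bessel_coeff_def)
  qed
  then have "bessel_J \<nu> s = (\<Sum>k. bessel_coeff \<nu> k * (s\<^sup>2) ^ k * s powr \<nu>)"
    by (simp add: bessel_J_def)
  also have "\<dots> = bessel_entire \<nu> (s\<^sup>2) * s powr \<nu>"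
    unfolding bessel_entire_def by (rule suminf_mult2[symmetric]) (rule summable_bessel_entire)
  finally show ?thesis using assms by (simp add: bessel_quot_def)
qed

text \<open>The classical relation \<open>(J\<^sub>\<nu> / s powr \<nu>)' = - J\<^bsub>\<nu>+1\<^esub> / s powr \<nu>\<close>.\<close>

lemma has_real_derivative_bessel_quot:
  assumes "s > 0"
  shows "(q \<nu> has_real_derivative - s * q (\<nu> + 1) s) (at s)"
proof -
  have "((\<lambda>s. bessel_entire \<nu> (s\<^sup>2)) has_real_derivative - s * q (\<nu> + 1) s) (at s)"
  proof (rule DERIV_cong)
    show "((\<lambda>s. bessel_entire \<nu> (s\<^sup>2)) has_real_derivative
        (- (1 / 2) * bessel_entire (\<nu> + 1) (s\<^sup>2)) * (2 * s)) (at s)"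
      by (rule DERIV_chain2[OF has_real_derivative_bessel_entire]) (auto intro!: derivative_eq_intros)
  qed (use assms in \<open>simp add: bessel_quot_eq_entire\<close>)
  then show ?thesis
    by (rule has_field_derivative_transform_within_open[where S = "{0<..}"])
      (use assms in \<open>auto simp: bessel_quot_eq_entire\<close>)
qed

text \<open>The three-term recurrence \<open>J\<^sub>\<nu> + J\<^bsub>\<nu>+2\<^esub> = 2 (\<nu> + 1) / s * J\<^bsub>\<nu>+1\<^esub>\<close>, compared coefficient by
  coefficient.\<close>

lemma bessel_quot_recurrence:
  assumes "s > 0"
  shows "q \<nu> s = (2 * \<nu> + 2) * q (\<nu> + 1) s - s\<^sup>2 * q (\<nu> + 2) s"
proof -
  define X where "X = s\<^sup>2"
  have *: "(\<lambda>k. bessel_coeff \<mu> k * X ^ k) sums bessel_entire \<mu> X" for \<mu>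
    unfolding bessel_entire_def by (rule summable_sums) (rule summable_bessel_entire)
  have "(\<lambda>k. - (1/2) * X * (bessel_coeff (\<nu> + 2) k * X ^ k)) sums (- (1/2) * X * bessel_entire (\<nu> + 2) X)"
    by (intro sums_mult *)
  then have "(\<lambda>k. real (Suc k) * bessel_coeff (\<nu> + 1) (Suc k) * X ^ Suc k) sums
      (- (1/2) * X * bessel_entire (\<nu> + 2) X)"
    unfolding bessel_coeff_Suc by (simp add: algebra_simps)
  then have "(\<lambda>k. real k * bessel_coeff (\<nu> + 1) k * X ^ k) sums
      (- (1/2) * X * bessel_entire (\<nu> + 2) X)"
    by (subst (asm) sums_Suc_iff) simp
  then have "(\<lambda>k. (2 * \<nu> + 2) * (bessel_coeff (\<nu> + 1) k * X ^ k) +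
       2 * (real k * bessel_coeff (\<nu> + 1) k * X ^ k)) sums
      ((2 * \<nu> + 2) * bessel_entire (\<nu> + 1) X + 2 * (- (1/2) * X * bessel_entire (\<nu> + 2) X))"
    by (intro sums_add sums_mult *)
  moreover have "(2 * \<nu> + 2) * (bessel_coeff (\<nu> + 1) k * X ^ k) +
       2 * (real k * bessel_coeff (\<nu> + 1) k * X ^ k) = bessel_coeff \<nu> k * X ^ k" for k
    unfolding bessel_coeff_shift[of \<nu> k, symmetric] by (simp add: algebra_simps)
  ultimately have "(\<lambda>k. bessel_coeff \<nu> k * X ^ k) sums
    ((2 * \<nu> + 2) * bessel_entire (\<nu> + 1) X + 2 * (- (1/2) * X * bessel_entire (\<nu> + 2) X))"
    by simp
  from sums_unique2[OF this *[of \<nu>]] show ?thesis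
    using assms by (simp add: bessel_quot_eq_entire X_def)
qed

text \<open>The classical relation \<open>(s powr (\<nu> + 1) * J\<^bsub>\<nu>+1\<^esub>)' = s powr (\<nu> + 1) * J\<^sub>\<nu>\<close>. It exhibits the density
  \<open>s powr (2 \<nu> + 1)\<close> times the quotient as a derivative, which drives every integration by parts
  below.\<close>

lemma has_real_derivative_powr_bessel_quot:
  assumes "s > 0"
  shows "((\<lambda>s. s powr (2 * \<nu> + 2) * q (\<nu> + 1) s) has_real_derivative
    s powr (2 * \<nu> + 1) * q \<nu> s) (at s)"
proof -
  have p: "s powr (2 * \<nu> + 2) = s powr (2 * \<nu> + 1) * s"
    using powr_add[of s "2 * \<nu> + 1" 1] assms by (simp add: add.commute add.left_commute)
  have "((\<lambda>s. s powr (2 * \<nu> + 2) * q (\<nu> + 1) s) has_real_derivative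
      (2 * \<nu> + 2) * s powr (2 * \<nu> + 2 - 1) * q (\<nu> + 1) s
      + s powr (2 * \<nu> + 2) * (- s * q (\<nu> + 1 + 1) s)) (at s)"
    using DERIV_mult[OF has_real_derivative_powr has_real_derivative_bessel_quot, OF assms assms,
        of "2 * \<nu> + 2" "\<nu> + 1"]
    by (simp only: mult.commute)
  also have "(2 * \<nu> + 2) * s powr (2 * \<nu> + 2 - 1) * q (\<nu> + 1) s
      + s powr (2 * \<nu> + 2) * (- s * q (\<nu> + 1 + 1) s)
      = s powr (2 * \<nu> + 1) * ((2 * \<nu> + 2) * q (\<nu> + 1) s - s\<^sup>2 * q (\<nu> + 2) s)"
    unfolding p by (simp add: algebra_simps power2_eq_square)
  also have "\<dots> = s powr (2 * \<nu> + 1) * q \<nu> s"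
    using bessel_quot_recurrence[OF assms, of \<nu>] by simp
  finally show ?thesis .
qed

lemma continuous_on_bessel_quot [continuous_intros]:
  assumes "continuous_on A g" and "\<And>x. x \<in> A \<Longrightarrow> g x > 0"
  shows "continuous_on A (\<lambda>x. q \<nu> (g x))"
proof -
  have "continuous_on {0<..} (q \<nu>)"
    using has_real_derivative_bessel_quot
    by (auto simp: continuous_on_eq_continuous_at intro: DERIV_isCont)
  from continuous_on_compose2[OF this assms(1)] show ?thesis using assms(2) by auto
qed

lemma borel_measurable_bessel_quot [measurable]: "q \<nu> \<in> borel_measurable borel"
  unfolding bessel_quot_def[abs_def] bessel_J_def[abs_def] by measurable

lemma bessel_entire_0: "bessel_entire \<nu> 0 = rGamma (\<nu> + 1) * 2 powr (- \<nu>)"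
  unfolding bessel_entire_def powser_zero by (simp add: bessel_coeff_def)

lemma bessel_quot_bounded_near_0: "\<exists>C>0. \<forall>s. 0 < s \<and> s \<le> b \<longrightarrow> \<bar>q \<nu> s\<bar> \<le> C"
proof -
  have "continuous_on {0..b\<^sup>2} (bessel_entire \<nu>)"
    using has_real_derivative_bessel_entire by (meson DERIV_isCont continuous_at_imp_continuous_on)
  then have "bounded (bessel_entire \<nu> ` {0..b\<^sup>2})"
    by (intro compact_imp_bounded compact_continuous_image) auto
  then obtain C where C: "C > 0" "\<And>X. X \<in> {0..b\<^sup>2} \<Longrightarrow> \<bar>bessel_entire \<nu> X\<bar> \<le> C"
    unfolding bounded_pos by auto
  show ?thesis using C by (intro exI[of _ C]) (auto simp: bessel_quot_eq_entire power_mono)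
qed

text \<open>The asymptotics need a point where the function does not vanish; near \<open>0\<close> the sign is that of
  \<open>1 / Gamma (\<nu> + 1)\<close>.\<close>

lemma bessel_quot_pos_near_0:
  assumes "\<nu> > -1"
  shows "\<exists>e>0. \<forall>s. 0 < s \<and> s \<le> e \<longrightarrow> q \<nu> s > 0"
proof -
  have "bessel_entire \<nu> 0 > 0"
    unfolding bessel_entire_0 using assms by (auto simp: rGamma_inverse_Gamma Gamma_real_pos)
  moreover have "isCont (bessel_entire \<nu>) 0"
    using has_real_derivative_bessel_entire DERIV_isCont by blast
  ultimately have "eventually (\<lambda>X. bessel_entire \<nu> X > 0) (nhds 0)"
    by (metis continuous_at eventually_at_filter order_tendstoD(1) tendsto_at_iff_tendsto_nhds)
  then obtain d where d: "d > 0" "\<And>X. \<bar>X\<bar> < d \<Longrightarrow> bessel_entire \<nu> X > 0"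
    by (auto simp: eventually_nhds_metric dist_real_def)
  define e where "e = min 1 (d/2)"
  have "s\<^sup>2 < d" if "0 < s" "s \<le> e" for s
  proof -
    have "s\<^sup>2 \<le> s * 1" unfolding power2_eq_square using that by (intro mult_left_mono) (auto simp: e_def)
    then show ?thesis using that d by (auto simp: e_def)
  qed
  then show ?thesis using d by (intro exI[of _ e]) (auto simp: e_def bessel_quot_eq_entire)
qed

section \<open>Asymptotics of Bessel functions\<close>

text \<open>With \<open>\<bar>a'\<bar> \<le> K / s\<^sup>2\<close> the function \<open>a - K / s\<close> increases and \<open>a + K / s\<close> decreases, so that the
  supremum of the former serves as the limit.\<close>

lemma limit_of_inverse_square_derivative:
  fixes a :: "real \<Rightarrow> real"
  assumes "\<And>s. s \<ge> 1 \<Longrightarrow> (a has_real_derivative a' s) (at s)"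
    and "\<And>s. s \<ge> 1 \<Longrightarrow> \<bar>a' s\<bar> \<le> K / s\<^sup>2"
  shows "\<exists>L. \<forall>s\<ge>1. \<bar>a s - L\<bar> \<le> K / s"
proof -
  have inc: "a r - K / r \<le> a s - K / s" if "1 \<le> r" "r \<le> s" for r s
  proof (rule DERIV_nonneg_imp_nondecreasing[OF that(2)])
    fix x assume x: "r \<le> x" "x \<le> s"
    have "((\<lambda>x. a x - K / x) has_real_derivative a' x + K / x\<^sup>2) (at x)"
      using x that by (auto intro!: derivative_eq_intros assms simp: power2_eq_square)
    moreover have "a' x + K / x\<^sup>2 \<ge> 0" using assms(2)[of x] x that by (auto simp: abs_le_iff)
    ultimately show "\<exists>y. ((\<lambda>x. a x - K / x) has_real_derivative y) (at x) \<and> 0 \<le> y" by blast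
  qed
  have dec: "a s + K / s \<le> a r + K / r" if "1 \<le> r" "r \<le> s" for r s
  proof (rule DERIV_nonpos_imp_nonincreasing[OF that(2)])
    fix x assume x: "r \<le> x" "x \<le> s"
    have "((\<lambda>x. a x + K / x) has_real_derivative a' x - K / x\<^sup>2) (at x)"
      using x that by (auto intro!: derivative_eq_intros assms simp: power2_eq_square)
    moreover have "a' x - K / x\<^sup>2 \<le> 0" using assms(2)[of x] x that by (auto simp: abs_le_iff)
    ultimately show "\<exists>y. ((\<lambda>x. a x + K / x) has_real_derivative y) (at x) \<and> y \<le> 0" by blast
  qed
  have K: "K \<ge> 0" using assms(2)[of 1] by auto
  have le: "a r - K / r \<le> a s + K / s" if "1 \<le> r" "1 \<le> s" for r s
  proof -
    have "a r - K / r \<le> a (max r s) - K / max r s" using that by (intro inc) auto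
    also have "\<dots> \<le> a (max r s) + K / max r s" using K that by (auto intro: order_trans[of _ 0])
    also have "\<dots> \<le> a s + K / s" using that by (intro dec) auto
    finally show ?thesis .
  qed
  define L where "L = (SUP r\<in>{1..}. a r - K / r)"
  have "a s - K / s \<le> L" "L \<le> a s + K / s" if "s \<ge> 1" for s
    unfolding L_def using that le
    by (auto intro!: cSUP_upper cSUP_least bdd_aboveI2[where M = "a 1 + K / 1"])
  then show ?thesis by (intro exI[of _ L]) (force simp: abs_le_iff)
qed

text \<open>The function \<open>u = s powr (\<nu> + 1/2) * q\<^sub>\<nu>\<close>, that is \<open>sqrt s * J\<^sub>\<nu>\<close>, solves
  \<open>u'' + u = c / s\<^sup>2 * u\<close>. Its energy \<open>E = u'\<^sup>2 + u\<^sup>2\<close> satisfies \<open>\<bar>E'\<bar> \<le> \<bar>c\<bar> / s\<^sup>2 * E\<close>; hence \<open>E\<close> is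
  bounded above and bounded away from \<open>0\<close> at infinity. In the rotating frame
  \<open>a = u cos s - u' sin s\<close>, \<open>b = u sin s + u' cos s\<close> both coordinates have derivatives of size
  \<open>1 / s\<^sup>2\<close>, so they converge with error \<open>O(1/s)\<close>, and the limits are not both zero because
  \<open>a\<^sup>2 + b\<^sup>2 = E\<close>. The positivity of the amplitude is what the averaging argument for
  \<open>hankel_core\<close> rests on.\<close>

lemma bessel_quot_asymptotics:
  assumes "\<nu> > -1"
  shows "\<exists>A \<phi> C. A > 0 \<and> C > 0 \<and>
    (\<forall>s\<ge>1. \<bar>s powr (\<nu> + 1 / 2) * q \<nu> s - A * cos (s - \<phi>)\<bar> \<le> C / s)"
proof -
  define u where "u = (\<lambda>s. s powr (\<nu> + 1 / 2) * q \<nu> s)"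
  define u1 where "u1 = (\<lambda>s. (\<nu> + 1 / 2) * s powr (\<nu> - 1 / 2) * q \<nu> s
                              - s powr (\<nu> + 3 / 2) * q (\<nu> + 1) s)"
  define c where "c = \<nu>\<^sup>2 - 1 / 4"
  define k where "k = \<bar>c\<bar>"
  have p: "s powr (\<nu> + 1 / 2) = s powr (\<nu> - 3 / 2) * s\<^sup>2" "s powr (\<nu> - 1 / 2) = s powr (\<nu> - 3 / 2) * s"
    "s powr (\<nu> + 3 / 2) = s powr (\<nu> - 3 / 2) * s ^ 3" if "s > 0" for s
    using that powr_add[of s "\<nu> - 3 / 2" 1] powr_add[of s "\<nu> - 3 / 2" "real 2"] powr_add[of s "\<nu> - 3 / 2" "real 3"]
      powr_realpow[of s 2] powr_realpow[of s 3]
    by (simp_all add: algebra_simps)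
  have du: "(u has_real_derivative u1 s) (at s)" if "s > 0" for s
  proof (rule DERIV_cong)
    show "(u has_real_derivative s powr (\<nu> + 1 / 2) * (- s * q (\<nu> + 1) s)
        + (\<nu> + 1 / 2) * s powr (\<nu> + 1 / 2 - 1) * q \<nu> s) (at s)"
      unfolding u_def by (rule DERIV_mult'[OF has_real_derivative_powr has_real_derivative_bessel_quot, OF that that])
    have e: "\<nu> + 1 / 2 - 1 = \<nu> - 1 / 2" by simp
    show "s powr (\<nu> + 1 / 2) * (- s * q (\<nu> + 1) s)
        + (\<nu> + 1 / 2) * s powr (\<nu> + 1 / 2 - 1) * q \<nu> s = u1 s"
      unfolding u1_def e p[OF that] by (simp add: algebra_simps power2_eq_square power3_eq_cube)
  qed
  have du1: "(u1 has_real_derivative (c / s\<^sup>2 - 1) * u s) (at s)" if "s > 0" for s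
  proof (rule DERIV_cong)
    show "(u1 has_real_derivative
        ((\<nu> + 1 / 2) * s powr (\<nu> - 1 / 2) * (- s * q (\<nu> + 1) s)
        + (\<nu> + 1 / 2) * ((\<nu> - 1 / 2) * s powr (\<nu> - 1 / 2 - 1)) * q \<nu> s)
        - (s powr (\<nu> + 3 / 2) * (- s * q (\<nu> + 1 + 1) s)
          + (\<nu> + 3 / 2) * s powr (\<nu> + 3 / 2 - 1) * q (\<nu> + 1) s)) (at s)"
      unfolding u1_def
      by (intro DERIV_diff DERIV_mult' DERIV_cmult has_real_derivative_powr has_real_derivative_bessel_quot that)
    have e: "\<nu> - 1 / 2 - 1 = \<nu> - 3 / 2" "\<nu> + 3 / 2 - 1 = \<nu> + 1 / 2" "\<nu> + 1 + 1 = \<nu> + 2" by simp_all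
    define w where "w = q (\<nu> + 1) s"
    define x where "x = q (\<nu> + 2) s"
    have v: "q \<nu> s = (2 * \<nu> + 2) * w - s\<^sup>2 * x"
      unfolding w_def x_def by (rule bessel_quot_recurrence[OF that])
    have s2: "(c / s\<^sup>2 - 1) * (s powr (\<nu> - 3 / 2) * s\<^sup>2 * q \<nu> s)
       = s powr (\<nu> - 3 / 2) * (c - s\<^sup>2) * q \<nu> s"
      using that by (simp add: field_simps)
    show "((\<nu> + 1 / 2) * s powr (\<nu> - 1 / 2) * (- s * q (\<nu> + 1) s)
        + (\<nu> + 1 / 2) * ((\<nu> - 1 / 2) * s powr (\<nu> - 1 / 2 - 1)) * q \<nu> s)
        - (s powr (\<nu> + 3 / 2) * (- s * q (\<nu> + 1 + 1) s)
          + (\<nu> + 3 / 2) * s powr (\<nu> + 3 / 2 - 1) * q (\<nu> + 1) s) = (c / s\<^sup>2 - 1) * u s"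
      unfolding u_def e p[OF that] s2 unfolding v w_def[symmetric] x_def[symmetric] c_def
      by (simp add: field_simps power2_eq_square power3_eq_cube)
  qed
  define E where "E = (\<lambda>s. (u1 s)\<^sup>2 + (u s)\<^sup>2)"
  have dE: "(E has_real_derivative 2 * c / s\<^sup>2 * (u s * u1 s)) (at s)" if "s > 0" for s
    unfolding E_def using that
    by (auto intro!: derivative_eq_intros du du1 simp: algebra_simps)
  have uu: "\<bar>2 * c * (u s * u1 s)\<bar> \<le> k * E s" for s
  proof -
    have "2 * \<bar>u s * u1 s\<bar> \<le> E s"
      unfolding E_def abs_mult using sum_squares_bound[of "\<bar>u s\<bar>" "\<bar>u1 s\<bar>"] by simp
    then have "k * (2 * \<bar>u s * u1 s\<bar>) \<le> k * E s" by (rule mult_left_mono) (simp add: k_def)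
    then show ?thesis by (simp add: k_def abs_mult mult_ac)
  qed
  \<comment> \<open>Gronwall's inequality in both directions; the exponent is the primitive of \<open>k / s\<^sup>2\<close>.\<close>
  have lower: "E r * exp (- k / r) \<le> E s * exp (- k / s)" if "0 < r" "r \<le> s" for r s
  proof (rule DERIV_nonneg_imp_nondecreasing[OF that(2)])
    fix x assume x: "r \<le> x" "x \<le> s"
    have "((\<lambda>x. E x * exp (- k / x)) has_real_derivative
      (2 * c * (u x * u1 x) + k * E x) / x\<^sup>2 * exp (- k / x)) (at x)"
      using x that by (auto intro!: derivative_eq_intros dE simp: power2_eq_square field_simps)
    moreover have "(2 * c * (u x * u1 x) + k * E x) / x\<^sup>2 * exp (- k / x) \<ge> 0"
      using uu[of x] by (intro mult_nonneg_nonneg divide_nonneg_nonneg) (auto simp: abs_le_iff)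
    ultimately show "\<exists>y. ((\<lambda>x. E x * exp (- k / x)) has_real_derivative y) (at x) \<and> 0 \<le> y" by blast
  qed
  have upper: "E s * exp (k / s) \<le> E r * exp (k / r)" if "0 < r" "r \<le> s" for r s
  proof (rule DERIV_nonpos_imp_nonincreasing[OF that(2)])
    fix x assume x: "r \<le> x" "x \<le> s"
    have "((\<lambda>x. E x * exp (k / x)) has_real_derivative
      (2 * c * (u x * u1 x) - k * E x) / x\<^sup>2 * exp (k / x)) (at x)"
      using x that by (auto intro!: derivative_eq_intros dE simp: power2_eq_square field_simps)
    moreover have "(2 * c * (u x * u1 x) - k * E x) / x\<^sup>2 * exp (k / x) \<le> 0"
      using uu[of x] by (intro mult_nonpos_nonneg divide_nonpos_nonneg) (auto simp: abs_le_iff)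
    ultimately show "\<exists>y. ((\<lambda>x. E x * exp (k / x)) has_real_derivative y) (at x) \<and> y \<le> 0" by blast
  qed
  have E0: "E s \<ge> 0" for s by (simp add: E_def)
  have k0: "k \<ge> 0" by (simp add: k_def)
  define M where "M = E 1 * exp k"
  have EM: "E s \<le> M" if "s \<ge> 1" for s
  proof -
    have "E s * 1 \<le> E s * exp (k / s)" using k0 that by (intro mult_left_mono E0) auto
    also have "\<dots> \<le> M" using upper[of 1 s] that by (simp add: M_def)
    finally show ?thesis by simp
  qed
  obtain e where e: "e > 0" "\<And>s. 0 < s \<Longrightarrow> s \<le> e \<Longrightarrow> q \<nu> s > 0"
    using bessel_quot_pos_near_0[OF assms] by blast
  define m where "m = E e * exp (- k / e)"
  have "u e > 0" unfolding u_def using e by auto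
  then have m0: "m > 0" unfolding m_def E_def by (simp add: add_nonneg_pos)
  have Em: "m \<le> E s" if "s \<ge> e" for s
  proof -
    have "m \<le> E s * exp (- k / s)" unfolding m_def using lower[of e s] that e by simp
    also have "\<dots> \<le> E s * 1" using k0 that e by (intro mult_left_mono E0) auto
    finally show ?thesis by simp
  qed
  define K where "K = k * sqrt M"
  have K0: "K \<ge> 0" unfolding K_def using EM[of 1] E0[of 1] k0 by simp
  have uM: "\<bar>u s\<bar> \<le> sqrt M" if "s \<ge> 1" for s
  proof -
    have "(u s)\<^sup>2 \<le> M" using EM[OF that] unfolding E_def by (smt (verit) zero_le_power2)
    then show ?thesis using real_le_rsqrt[of "\<bar>u s\<bar>" M] by simp
  qed
  define a where "a = (\<lambda>s. u s * cos s - u1 s * sin s)"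
  define b where "b = (\<lambda>s. u s * sin s + u1 s * cos s)"
  have bnd: "\<bar>c / s\<^sup>2 * (u s * r)\<bar> \<le> K / s\<^sup>2" if "s \<ge> 1" "\<bar>r\<bar> \<le> 1" for s r
  proof -
    have "\<bar>u s\<bar> * \<bar>r\<bar> \<le> sqrt M * 1" using that uM[of s] EM[of 1] E0[of 1] by (intro mult_mono) auto
    then have "k * (\<bar>u s\<bar> * \<bar>r\<bar>) \<le> k * sqrt M" using k0 by (simp add: mult_left_mono)
    then show ?thesis by (simp add: K_def k_def abs_mult divide_right_mono)
  qed
  have "\<exists>L. \<forall>s\<ge>1. \<bar>a s - L\<bar> \<le> K / s"
  proof (rule limit_of_inverse_square_derivative)
    show "(a has_real_derivative c / s\<^sup>2 * (u s * - sin s)) (at s)" if "s \<ge> 1" for s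
      unfolding a_def using that
      by (auto intro!: derivative_eq_intros du du1 simp: field_simps)
    show "\<bar>c / s\<^sup>2 * (u s * - sin s)\<bar> \<le> K / s\<^sup>2" if "s \<ge> 1" for s
      using bnd[OF that, of "- sin s"] by simp
  qed
  then obtain La where La: "\<And>s. s \<ge> 1 \<Longrightarrow> \<bar>a s - La\<bar> \<le> K / s" by blast
  have "\<exists>L. \<forall>s\<ge>1. \<bar>b s - L\<bar> \<le> K / s"
  proof (rule limit_of_inverse_square_derivative)
    show "(b has_real_derivative c / s\<^sup>2 * (u s * cos s)) (at s)" if "s \<ge> 1" for s
      unfolding b_def using that
      by (auto intro!: derivative_eq_intros du du1 simp: field_simps)
    show "\<bar>c / s\<^sup>2 * (u s * cos s)\<bar> \<le> K / s\<^sup>2" if "s \<ge> 1" for s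
      using bnd[OF that, of "cos s"] by simp
  qed
  then obtain Lb where Lb: "\<And>s. s \<ge> 1 \<Longrightarrow> \<bar>b s - Lb\<bar> \<le> K / s" by blast
  have ab: "(a s)\<^sup>2 + (b s)\<^sup>2 = E s" for s
  proof -
    have "(a s)\<^sup>2 + (b s)\<^sup>2 = ((u s)\<^sup>2 + (u1 s)\<^sup>2) * ((sin s)\<^sup>2 + (cos s)\<^sup>2)"
      unfolding a_def b_def by algebra
    then show ?thesis by (simp add: E_def)
  qed
  \<comment> \<open>If both limits vanished, \<open>E = a\<^sup>2 + b\<^sup>2\<close> would be at most \<open>2 K\<^sup>2 / s\<^sup>2\<close>, against \<open>E \<ge> m\<close>.\<close>
  define A where "A = sqrt (La\<^sup>2 + Lb\<^sup>2)"
  have "La\<^sup>2 + Lb\<^sup>2 \<noteq> 0"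
  proof
    assume "La\<^sup>2 + Lb\<^sup>2 = 0"
    then have [simp]: "La = 0" "Lb = 0" by (simp_all add: sum_power2_eq_zero_iff)
    define s where "s = max e (2 * K\<^sup>2 / m + 1)"
    have "2 * K\<^sup>2 / m \<ge> 0" using m0 by simp
    then have s: "s \<ge> 1" "s \<ge> e" "s > 2 * K\<^sup>2 / m" unfolding s_def by linarith+
    have "m \<le> (a s)\<^sup>2 + (b s)\<^sup>2" using ab Em s by simp
    also have "\<dots> \<le> (K / s)\<^sup>2 + (K / s)\<^sup>2"
    proof -
      have "\<bar>a s\<bar> \<le> K / s" "\<bar>b s\<bar> \<le> K / s"
        using La[OF s(1)] Lb[OF s(1)] by simp_all
      then have "\<bar>a s\<bar> \<le> \<bar>K / s\<bar>" "\<bar>b s\<bar> \<le> \<bar>K / s\<bar>" by linarith+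
      then show ?thesis unfolding abs_le_square_iff by (rule add_mono)
    qed
    also have "\<dots> = 2 * K\<^sup>2 / s / s" by (simp add: power2_eq_square)
    also have "\<dots> \<le> 2 * K\<^sup>2 / s / 1" using s by (intro divide_left_mono) auto
    also have "\<dots> < m" using s m0 by (simp add: field_simps)
    finally show False by simp
  qed
  then have A: "A > 0" unfolding A_def by (smt (verit) real_sqrt_gt_zero zero_le_power2)
  have A2: "A\<^sup>2 = La\<^sup>2 + Lb\<^sup>2" unfolding A_def by simp
  have "(La / A)\<^sup>2 + (Lb / A)\<^sup>2 = (La\<^sup>2 + Lb\<^sup>2) / A\<^sup>2"
    by (simp only: power_divide add_divide_distrib)
  then have "(La / A)\<^sup>2 + (Lb / A)\<^sup>2 = 1" unfolding A2[symmetric] using A by simp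
  then obtain \<phi> where \<phi>: "La / A = cos \<phi>" "Lb / A = sin \<phi>"
    using sincos_total_2pi by metis
  have "\<bar>u s - A * cos (s - \<phi>)\<bar> \<le> (2 * K + 1) / s" if "s \<ge> 1" for s
  proof -
    have l: "La = A * cos \<phi>" "Lb = A * sin \<phi>" using \<phi> A by (simp_all add: field_simps)
    have "u s = a s * cos s + b s * sin s"
    proof -
      have "a s * cos s + b s * sin s = u s * ((sin s)\<^sup>2 + (cos s)\<^sup>2)"
        unfolding a_def b_def by algebra
      then show ?thesis by simp
    qed
    then have "u s - A * cos (s - \<phi>) = (a s - La) * cos s + (b s - Lb) * sin s"
      by (simp add: l cos_diff algebra_simps)
    also have "\<bar>\<dots>\<bar> \<le> \<bar>a s - La\<bar> * \<bar>cos s\<bar> + \<bar>b s - Lb\<bar> * \<bar>sin s\<bar>"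
      by (metis abs_triangle_ineq abs_mult)
    also have "\<dots> \<le> K / s * 1 + K / s * 1"
      using that K0 by (intro add_mono mult_mono La Lb) auto
    also have "\<dots> \<le> (2 * K + 1) / s" using that by (simp add: field_simps)
    finally show ?thesis .
  qed
  then show ?thesis
    using A K0 unfolding u_def by (intro exI[of _ A] exI[of _ \<phi>] exI[of _ "2 * K + 1"]) auto
qed

lemma bessel_quot_decay:
  assumes "\<nu> > -1" "r > 0"
  shows "\<exists>C>0. \<forall>s\<ge>r. \<bar>q \<nu> s\<bar> \<le> C * s powr (- \<nu> - 1 / 2)"
proof -
  obtain A \<phi> C where C: "A > 0" "C > 0"
    "\<And>s. s \<ge> 1 \<Longrightarrow> \<bar>s powr (\<nu> + 1 / 2) * q \<nu> s - A * cos (s - \<phi>)\<bar> \<le> C / s"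
    using bessel_quot_asymptotics[OF assms(1)] by blast
  have "continuous_on {r..1} (\<lambda>s. s powr (\<nu> + 1 / 2) * q \<nu> s)"
    using assms by (intro continuous_intros) auto
  then have "bounded ((\<lambda>s. s powr (\<nu> + 1 / 2) * q \<nu> s) ` {r..1})"
    by (intro compact_imp_bounded compact_continuous_image) auto
  then obtain B where B: "B > 0" "\<And>s. s \<in> {r..1} \<Longrightarrow> \<bar>s powr (\<nu> + 1 / 2) * q \<nu> s\<bar> \<le> B"
    unfolding bounded_pos by auto
  have "\<bar>q \<nu> s\<bar> \<le> (A + B + C) * s powr (- \<nu> - 1 / 2)" if "s \<ge> r" for s
  proof -
    have *: "\<bar>s powr (\<nu> + 1 / 2) * q \<nu> s\<bar> \<le> A + B + C"
    proof (cases "s \<le> 1")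
      case True
      then show ?thesis using B(2)[of s] that C by auto
    next
      case False
      have "\<bar>A * cos (s - \<phi>)\<bar> \<le> A * 1" unfolding abs_mult using C by (intro mult_mono) auto
      moreover have "C / s \<le> C" using False C by (simp add: field_simps)
      ultimately show ?thesis using C(3)[of s] False B by auto
    qed
    have "q \<nu> s = (s powr (\<nu> + 1 / 2) * q \<nu> s) * s powr (- \<nu> - 1 / 2)"
    proof -
      have "s powr (\<nu> + 1 / 2) * s powr (- \<nu> - 1 / 2) = 1"
        using that assms by (subst powr_add[symmetric]) simp
      then show ?thesis by (metis mult.assoc mult.commute mult.right_neutral)
    qed
    then have "\<bar>q \<nu> s\<bar> = \<bar>s powr (\<nu> + 1 / 2) * q \<nu> s\<bar> * s powr (- \<nu> - 1 / 2)"
      by (metis abs_mult abs_of_nonneg powr_ge_zero)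
    then show ?thesis using * by (simp add: mult_right_mono)
  qed
  then show ?thesis using B C by (intro exI[of _ "A + B + C"]) auto
qed

lemma bessel_quot_bound:
  assumes "\<nu> \<ge> - 1 / 2"
  shows "\<exists>C>0. \<forall>s>0. \<bar>q \<nu> s\<bar> \<le> C \<and> \<bar>q \<nu> s\<bar> \<le> C * s powr (- \<nu> - 1 / 2)"
proof -
  obtain C where C: "C > 0" "\<And>s. s \<ge> 1 \<Longrightarrow> \<bar>q \<nu> s\<bar> \<le> C * s powr (- \<nu> - 1 / 2)"
    using bessel_quot_decay[of \<nu> 1] assms by auto
  obtain B where B: "B > 0" "\<And>s. 0 < s \<Longrightarrow> s \<le> 1 \<Longrightarrow> \<bar>q \<nu> s\<bar> \<le> B"
    using bessel_quot_bounded_near_0[of 1 \<nu>] by blast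
  have "\<bar>q \<nu> s\<bar> \<le> B + C \<and> \<bar>q \<nu> s\<bar> \<le> (B + C) * s powr (- \<nu> - 1 / 2)" if "s > 0" for s
  proof (cases "s \<le> 1")
    case True
    have "1 \<le> s powr (- \<nu> - 1 / 2)" using True that assms by (intro powr_mono2'[of _ s 1, simplified]) auto
    then have "(B + C) * 1 \<le> (B + C) * s powr (- \<nu> - 1 / 2)" using B C by (intro mult_left_mono) auto
    then show ?thesis using B(2)[OF that True] C by auto
  next
    case False
    then have "s powr (- \<nu> - 1 / 2) \<le> 1" using assms powr_mono[of "- \<nu> - 1 / 2" 0 s] by auto
    then have "C * s powr (- \<nu> - 1 / 2) \<le> C * 1" using C by (intro mult_left_mono) auto
    then have "\<bar>q \<nu> s\<bar> \<le> B + C" using C(2)[of s] B False by linarith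
    moreover have "C * s powr (- \<nu> - 1 / 2) \<le> (B + C) * s powr (- \<nu> - 1 / 2)"
      using B by (intro mult_right_mono) auto
    then have "\<bar>q \<nu> s\<bar> \<le> (B + C) * s powr (- \<nu> - 1 / 2)" using C(2)[of s] False by linarith
    ultimately show ?thesis by blast
  qed
  then show ?thesis using B C by (intro exI[of _ "B + C"]) auto
qed

text \<open>For \<open>-1 < \<nu> < -1/2\<close> the quotient grows at infinity, but slower than linearly. Against rapidly
  decreasing functions this crude bound is enough.\<close>

lemma bessel_quot_linear_bound:
  assumes "\<nu> > - 1"
  shows "\<exists>C>0. \<forall>s>0. \<bar>q \<nu> s\<bar> \<le> C * (1 + s)"
proof -
  obtain C where C: "C > 0" "\<And>s. s \<ge> 1 \<Longrightarrow> \<bar>q \<nu> s\<bar> \<le> C * s powr (- \<nu> - 1 / 2)"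
    using bessel_quot_decay[of \<nu> 1] assms by auto
  obtain B where B: "B > 0" "\<And>s. 0 < s \<Longrightarrow> s \<le> 1 \<Longrightarrow> \<bar>q \<nu> s\<bar> \<le> B"
    using bessel_quot_bounded_near_0[of 1 \<nu>] by blast
  have "\<bar>q \<nu> s\<bar> \<le> (B + C) * (1 + s)" if "s > 0" for s
  proof (cases "s \<le> 1")
    case True
    have "B * 1 \<le> (B + C) * (1 + s)" using B C that by (intro mult_mono) auto
    then show ?thesis using B(2)[OF that True] by auto
  next
    case False
    then have "s powr (- \<nu> - 1 / 2) \<le> s powr 1" using assms by (intro powr_mono) auto
    then have "C * s powr (- \<nu> - 1 / 2) \<le> (B + C) * (1 + s)"
      using B C that by (intro mult_mono) auto
    then show ?thesis using C(2)[of s] False by auto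
  qed
  then show ?thesis using B C by (intro exI[of _ "B + C"]) auto
qed

section \<open>Integration with respect to the power weight\<close>

lemma space_mu [simp]: "space (mu \<alpha>) = {0<..}"
  by (simp add: mu_def space_restrict_space)

lemma sets_mu: "sets (mu \<alpha>) = sets (restrict_space borel {0<..})"
  by (simp add: mu_def sets_restrict_space)

lemma borel_measurable_mu: "borel_measurable (mu \<alpha>) = borel_measurable (restrict_space lborel {0<..})"
  by (rule measurable_cong_sets) (simp_all add: sets_mu sets_restrict_space)

lemma borel_measurable_muI: "f \<in> borel_measurable borel \<Longrightarrow> f \<in> borel_measurable (mu \<alpha>)"
  unfolding borel_measurable_mu by (rule measurable_restrict_space1) simp

lemma borel_measurable_mu_ident [measurable]: "(\<lambda>x. x) \<in> borel_measurable (mu \<alpha>)"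
  by (rule borel_measurable_muI) simp

lemma borel_measurable_mu_continuous:
  fixes f :: "real \<Rightarrow> 'b::topological_space"
  assumes "continuous_on {0<..} f" shows "f \<in> borel_measurable (mu \<alpha>)"
proof -
  have "f \<in> borel_measurable (restrict_space borel {0<..})"
    by (rule borel_measurable_continuous_on_restrict[OF assms])
  then show ?thesis
    by (simp add: measurable_cong_sets[OF sets_mu refl])
qed

lemma integrable_mu_iff:
  fixes f :: "real \<Rightarrow> 'b::{banach, second_countable_topology}"
  assumes "f \<in> borel_measurable (mu \<alpha>)"
  shows "integrable (mu \<alpha>) f \<longleftrightarrow> set_integrable lborel {0<..} (\<lambda>y. y powr (2 * \<alpha> + 1) *\<^sub>R f y)"
  using assms unfolding borel_measurable_mu unfolding mu_def
  by (subst integrable_density) (auto simp: integrable_restrict_space set_integrable_def intro!: measurable_restrict_space1)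

lemma integral_mu:
  fixes f :: "real \<Rightarrow> 'b::{banach, second_countable_topology}"
  assumes "f \<in> borel_measurable (mu \<alpha>)"
  shows "(LINT y|mu \<alpha>. f y) = (LINT y:{0<..}|lborel. y powr (2 * \<alpha> + 1) *\<^sub>R f y)"
  using assms unfolding borel_measurable_mu unfolding mu_def
  by (subst integral_density) (auto simp: integral_restrict_space set_lebesgue_integral_def intro!: measurable_restrict_space1)

lemma AE_mu: "(AE x in mu \<alpha>. P x) \<longleftrightarrow> (AE x in lborel. x > 0 \<longrightarrow> P x)"
proof -
  have "(AE x in mu \<alpha>. P x) \<longleftrightarrow> (AE x in restrict_space lborel {0<..}. 0 < ennreal (x powr (2 * \<alpha> + 1)) \<longrightarrow> P x)"
    unfolding mu_def by (rule AE_density) (auto intro!: measurable_restrict_space1)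
  also have "\<dots> \<longleftrightarrow> (AE x in lborel. x > 0 \<longrightarrow> P x)"
    by (subst AE_restrict_space_iff) (auto intro!: AE_cong)
  finally show ?thesis .
qed

lemma sigma_finite_mu: "sigma_finite_measure (mu \<alpha>)"
proof -
  interpret sigma_finite_measure "restrict_space lborel {0::real<..}"
    by (rule sigma_finite_measure_restrict_space) (auto intro: lborel.sigma_finite_measure_axioms)
  show ?thesis unfolding mu_def
    by (subst sigma_finite_iff_density_finite) (auto intro!: measurable_restrict_space1)
qed

lemma pair_sigma_finite_mu: "pair_sigma_finite (mu \<alpha>) (mu \<beta>)"
  by (intro pair_sigma_finite.intro sigma_finite_mu)

lemma set_integrable_lborel_iff_lebesgue:
  fixes f :: "real \<Rightarrow> real"
  assumes "f \<in> borel_measurable borel" "S \<in> sets borel"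
  shows "set_integrable lborel S f \<longleftrightarrow> f absolutely_integrable_on S"
  unfolding set_integrable_def using assms
  by (subst integrable_completion) auto

lemma set_integrable_powr_near_0:
  assumes "p > -1" shows "set_integrable lborel {0<..1} (\<lambda>y::real. y powr p)"
proof -
  have "set_integrable lborel {0..1} (\<lambda>y::real. y powr p)"
    using has_integral_powr_from_0[OF assms, of 1]
    by (subst set_integrable_lborel_iff_lebesgue) (auto intro!: nonnegative_absolutely_integrable_1)
  then show ?thesis by (rule set_integrable_subset) auto
qed

text \<open>The weight is integrable at \<open>0\<close> since \<open>2 \<alpha> + 1 > -1\<close>, and the bound at infinity leaves
  \<open>y powr -2\<close>.\<close>

lemma integrable_mu_comparison:
  fixes f :: "real \<Rightarrow> 'b::{banach, second_countable_topology}"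
  assumes "\<alpha> > -1" and [measurable]: "f \<in> borel_measurable (mu \<alpha>)"
    and "\<And>y. 0 < y \<Longrightarrow> y \<le> 1 \<Longrightarrow> norm (f y) \<le> C"
    and "\<And>y. 1 < y \<Longrightarrow> norm (f y) \<le> C * y powr (- 2 * \<alpha> - 3)"
  shows "integrable (mu \<alpha>) f"
proof -
  define W where "W = (\<lambda>y::real. if y \<le> 1 then C else C * y powr (- 2 * \<alpha> - 3))"
  have W [measurable]: "W \<in> borel_measurable (mu \<alpha>)"
    unfolding W_def by (rule borel_measurable_muI) measurable
  have "set_integrable lborel ({0<..1} \<union> {1<..}) (\<lambda>y. y powr (2 * \<alpha> + 1) *\<^sub>R W y)"
  proof (rule set_integrable_Un)
    have "set_integrable lborel {0<..1} (\<lambda>y. C * y powr (2 * \<alpha> + 1))"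
      using assms(1) by (intro set_integrable_mult_right set_integrable_powr_near_0) auto
    then show "set_integrable lborel {0<..1} (\<lambda>y. y powr (2 * \<alpha> + 1) *\<^sub>R W y)"
      by (rule set_integrable_cong[THEN iffD1, rotated -1]) (auto simp: W_def)
    have "set_integrable lborel {1..} (\<lambda>y::real. y powr (-2))"
      using has_integral_powr_to_inf[of "-2" 1]
      by (subst set_integrable_lborel_iff_lebesgue) (auto intro!: nonnegative_absolutely_integrable_1)
    then have "set_integrable lborel {1<..} (\<lambda>y::real. C * y powr (-2))"
      by (intro set_integrable_mult_right) (erule set_integrable_subset, auto)
    then show "set_integrable lborel {1<..} (\<lambda>y. y powr (2 * \<alpha> + 1) *\<^sub>R W y)"
    proof (rule set_integrable_cong[THEN iffD1, rotated -1])
      fix y :: real assume "y \<in> {1<..}"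
      then show "C * y powr (-2) = y powr (2 * \<alpha> + 1) *\<^sub>R W y"
        by (simp add: W_def powr_add[symmetric] mult.left_commute)
    qed auto
  qed auto
  also have "{0<..1} \<union> {1<..} = {0::real<..}" by auto
  finally have "integrable (mu \<alpha>) W" by (subst integrable_mu_iff) auto
  then show ?thesis
  proof (rule Bochner_Integration.integrable_bound)
    show "AE y in mu \<alpha>. norm (f y) \<le> norm (W y)"
      using assms(3,4) by (intro AE_I2) (force simp: W_def intro: order.trans[OF _ abs_ge_self])
  qed measurable
qed

lemma integrable_mu_shift:
  fixes f :: "real \<Rightarrow> 'b::{banach, second_countable_topology}"
  assumes [measurable]: "f \<in> borel_measurable (mu \<alpha>)"
  shows "integrable (mu \<alpha>) (\<lambda>y. y powr (2 * c) *\<^sub>R f y) \<longleftrightarrow> integrable (mu (\<alpha> + c)) f"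
proof -
  have f': "f \<in> borel_measurable (mu (\<alpha> + c))"
    using assms unfolding borel_measurable_mu .
  have m: "(\<lambda>y. y powr (2 * c) *\<^sub>R f y) \<in> borel_measurable (mu \<alpha>)" by measurable
  have e: "2 * (\<alpha> + c) + 1 = (2 * \<alpha> + 1) + 2 * c" by simp
  have *: "y powr (2 * \<alpha> + 1) *\<^sub>R y powr (2 * c) *\<^sub>R f y = y powr (2 * (\<alpha> + c) + 1) *\<^sub>R f y" for y
    unfolding e powr_add by simp
  show ?thesis
    unfolding integrable_mu_iff[OF m] integrable_mu_iff[OF f'] * ..
qed

section \<open>The Hankel transform of rapidly decreasing functions\<close>

text \<open>Decay is measured by \<open>1 + y\<close>, so that boundedness near \<open>0\<close> is included; smoothness is
  treated separately.\<close>

definition rapid_decay :: "(real \<Rightarrow> complex) \<Rightarrow> bool" where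
  "rapid_decay g \<longleftrightarrow> (\<forall>N::nat. \<exists>C. \<forall>y>0. (1 + y) ^ N * norm (g y) \<le> C)"

lemma rapid_mult:
  assumes "rapid_decay g" and "\<And>y. y > 0 \<Longrightarrow> norm (w y) \<le> B * (1 + y) ^ M"
  shows "rapid_decay (\<lambda>y. w y * g y)"
  unfolding rapid_decay_def
proof
  fix N
  obtain C where C: "\<And>y. y > 0 \<Longrightarrow> (1 + y) ^ (N + M) * norm (g y) \<le> C"
    using assms(1) unfolding rapid_decay_def by blast
  have "0 \<le> B * 2 ^ M" using order.trans[OF norm_ge_zero assms(2)[of 1]] by simp
  then have B: "B \<ge> 0" by (metis not_le mult_neg_pos zero_less_numeral zero_less_power)
  have "(1 + y) ^ N * norm (w y * g y) \<le> B * C" if "y > 0" for y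
  proof -
    have "(1 + y) ^ N * norm (w y * g y) \<le> (1 + y) ^ N * ((B * (1 + y) ^ M) * norm (g y))"
      unfolding norm_mult using that assms(2) by (intro mult_left_mono mult_right_mono) auto
    also have "\<dots> = B * ((1 + y) ^ (N + M) * norm (g y))" by (simp add: power_add)
    also have "\<dots> \<le> B * C" using C[OF that] B by (rule mult_left_mono)
    finally show ?thesis .
  qed
  then show "\<exists>C. \<forall>y>0. (1 + y) ^ N * norm (w y * g y) \<le> C" by blast
qed

lemma rapid_add:
  assumes "rapid_decay f" "rapid_decay g" shows "rapid_decay (\<lambda>y. f y + g y)"
  unfolding rapid_decay_def
proof
  fix N
  obtain C D where CD: "\<And>y. y > 0 \<Longrightarrow> (1 + y) ^ N * norm (f y) \<le> C" "\<And>y. y > 0 \<Longrightarrow> (1 + y) ^ N * norm (g y) \<le> D"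
    using assms unfolding rapid_decay_def by metis
  have "(1 + y) ^ N * norm (f y + g y) \<le> C + D" if "y > 0" for y
  proof -
    have "(1 + y) ^ N * norm (f y + g y) \<le> (1 + y) ^ N * (norm (f y) + norm (g y))"
      using that by (intro mult_left_mono norm_triangle_ineq) auto
    then show ?thesis using CD[OF that] by (simp add: distrib_left)
  qed
  then show "\<exists>C. \<forall>y>0. (1 + y) ^ N * norm (f y + g y) \<le> C" by blast
qed

lemma rapid_bounded:
  assumes "rapid_decay g" shows "\<exists>C>0. \<forall>y>0. norm (g y) \<le> C"
proof -
  obtain C where "\<And>y. y > 0 \<Longrightarrow> (1 + y) ^ 0 * norm (g y) \<le> C"
    using assms unfolding rapid_decay_def by blast
  then show ?thesis by (intro exI[of _ "max C 1"]) force
qed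

lemma rapid_powr:
  assumes "rapid_decay g" shows "\<exists>C>0. \<forall>y\<ge>1. norm (g y) \<le> C * y powr p"
proof -
  define N where "N = nat \<lceil>- p\<rceil>"
  obtain C where C: "\<And>y. y > 0 \<Longrightarrow> (1 + y) ^ N * norm (g y) \<le> C"
    using assms unfolding rapid_decay_def by blast
  have "norm (g y) \<le> max C 1 * y powr p" if "y \<ge> 1" for y
  proof -
    have "y powr (- p) \<le> y powr real N" using that real_nat_ceiling_ge[of "- p"] by (intro powr_mono) (auto simp: N_def)
    also have "\<dots> \<le> (1 + y) ^ N" using that by (subst powr_realpow) (auto intro!: power_mono)
    finally have "y powr (- p) * norm (g y) \<le> (1 + y) ^ N * norm (g y)" by (rule mult_right_mono) auto
    also have "\<dots> \<le> max C 1" using C[of y] that by auto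
    finally have "y powr p * (y powr (- p) * norm (g y)) \<le> y powr p * max C 1"
      by (rule mult_left_mono) auto
    then show ?thesis using that by (simp add: powr_minus field_simps)
  qed
  then show ?thesis by (intro exI[of _ "max C 1"]) auto
qed

lemma rapid_integrable:
  assumes "\<alpha> > -1" "rapid_decay g" "g \<in> borel_measurable (mu \<alpha>)"
  shows "integrable (mu \<alpha>) g"
proof -
  obtain C where C: "C > 0" "\<And>y. y > 0 \<Longrightarrow> norm (g y) \<le> C" using rapid_bounded[OF assms(2)] by blast
  obtain D where D: "D > 0" "\<And>y. y \<ge> 1 \<Longrightarrow> norm (g y) \<le> D * y powr (- 2 * \<alpha> - 3)" using rapid_powr[OF assms(2)] by blast
  show ?thesis
  proof (rule integrable_mu_comparison[OF assms(1,3), of "C + D"])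
    show "norm (g y) \<le> C + D" if "0 < y" for y using C(2)[OF that] D by auto
    show "norm (g y) \<le> (C + D) * y powr (- 2 * \<alpha> - 3)" if "1 < y" for y
    proof -
      have "D * y powr (- 2 * \<alpha> - 3) \<le> (C + D) * y powr (- 2 * \<alpha> - 3)" using C by (intro mult_right_mono) auto
      with D(2)[of y] that show ?thesis by linarith
    qed
  qed
qed

lemma rapid_L2:
  assumes "\<alpha> > -1" "rapid_decay g" "g \<in> borel_measurable (mu \<alpha>)"
  shows "g \<in> L2 \<alpha>"
proof -
  obtain C where C: "C > 0" "\<And>y. y > 0 \<Longrightarrow> norm (g y) \<le> C" using rapid_bounded[OF assms(2)] by blast
  have [measurable]: "g \<in> borel_measurable (mu \<alpha>)" by fact
  have "integrable (mu \<alpha>) (\<lambda>y. C * norm (g y))"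
    using rapid_integrable[OF assms] by (intro integrable_mult_right integrable_norm)
  then have "integrable (mu \<alpha>) (\<lambda>y. (norm (g y))\<^sup>2)"
  proof (rule Bochner_Integration.integrable_bound)
    show "AE y in mu \<alpha>. norm ((norm (g y))\<^sup>2) \<le> norm (C * norm (g y))"
      using C by (intro AE_I2) (auto simp: power2_eq_square abs_mult intro!: mult_right_mono)
  qed measurable
  then show ?thesis by (simp add: L2_def assms)
qed

lemma rapid_bessel_quot_mult:
  assumes "\<alpha> > -1" "rapid_decay g" "x > 0"
  shows "rapid_decay (\<lambda>y. of_real (q \<alpha> (x * y)) * g y)"
proof -
  obtain C where C: "C > 0" "\<And>s. s > 0 \<Longrightarrow> \<bar>q \<alpha> s\<bar> \<le> C * (1 + s)"
    using bessel_quot_linear_bound[OF assms(1)] by blast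
  show ?thesis
  proof (rule rapid_mult[OF assms(2), of _ "C * (1 + x)" 1])
    fix y :: real assume y: "y > 0"
    have "\<bar>q \<alpha> (x * y)\<bar> \<le> C * (1 + x * y)" using C y assms by simp
    also have "\<dots> \<le> C * ((1 + x) * (1 + y))"
      using C y assms by (intro mult_left_mono) (auto simp: algebra_simps)
    finally show "norm (of_real (q \<alpha> (x * y)) :: complex) \<le> C * (1 + x) * (1 + y) ^ 1"
      by (simp add: mult.assoc)
  qed
qed

lemma borel_measurable_bessel_quot_mult [measurable]:
  assumes [measurable]: "(g :: real \<Rightarrow> complex) \<in> borel_measurable (mu \<alpha>)"
  shows "(\<lambda>y. of_real (q \<nu> (x * y)) * g y) \<in> borel_measurable (mu \<alpha>)"
  by measurable

lemma rapid_hankel_integrable: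
  assumes "\<alpha> > -1" "rapid_decay g" "g \<in> borel_measurable (mu \<alpha>)" "x > 0"
  shows "integrable (mu \<alpha>) (\<lambda>y. of_real (q \<alpha> (x * y)) * g y)"
  using assms by (intro rapid_integrable rapid_bessel_quot_mult borel_measurable_bessel_quot_mult)

lemma rapid_hankel_bounded_near_0:
  assumes "\<alpha> > -1" "rapid_decay g" "g \<in> borel_measurable (mu \<alpha>)"
  shows "\<exists>C. \<forall>x. 0 < x \<and> x \<le> 1 \<longrightarrow> norm (hankel \<alpha> g x) \<le> C"
proof -
  obtain C where C: "C > 0" "\<And>s. s > 0 \<Longrightarrow> \<bar>q \<alpha> s\<bar> \<le> C * (1 + s)"
    using bessel_quot_linear_bound[OF assms(1)] by blast
  have [measurable]: "g \<in> borel_measurable (mu \<alpha>)" by fact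
  define h where "h = (\<lambda>y. of_real (C * (1 + y)) * g y)"
  have "rapid_decay h"
    unfolding h_def using C by (intro rapid_mult[OF assms(2), of _ C 1]) (simp add: norm_of_real del: of_real_mult of_real_add)
  moreover have "h \<in> borel_measurable (mu \<alpha>)" unfolding h_def by measurable
  ultimately have h: "integrable (mu \<alpha>) h" using rapid_integrable assms(1) by blast
  have "norm (hankel \<alpha> g x) \<le> (LINT y|mu \<alpha>. norm (h y))" if "0 < x" "x \<le> 1" for x
    unfolding hankel_def
  proof (rule Bochner_Integration.integral_norm_bound_integral)
    show "integrable (mu \<alpha>) (\<lambda>y. of_real (q \<alpha> (x * y)) * g y)"
      using rapid_hankel_integrable[OF assms that(1)] .
    show "integrable (mu \<alpha>) (\<lambda>y. norm (h y))" using h by (rule integrable_norm)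
    fix y assume "y \<in> space (mu \<alpha>)"
    then have y: "y > 0" by simp
    have "\<bar>q \<alpha> (x * y)\<bar> \<le> C * (1 + x * y)" using C y that by simp
    also have "\<dots> \<le> C * (1 + y)"
      using C y that by (intro mult_left_mono) (auto simp: mult_left_le_one_le)
    finally have "\<bar>q \<alpha> (x * y)\<bar> \<le> C * (1 + y)" .
    moreover have "norm (h y) = C * (1 + y) * norm (g y)"
      unfolding h_def norm_mult norm_of_real using C y by simp
    ultimately show "norm (of_real (q \<alpha> (x * y)) * g y) \<le> norm (h y)"
      by (simp add: norm_mult mult_right_mono)
  qed
  then show ?thesis by blast
qed

text \<open>From \<open>\<bar>q\<^sub>\<alpha> s\<bar> \<le> C * s powr (- \<alpha> - 1/2)\<close> for all \<open>s > 0\<close>. The remaining integral of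
  \<open>y powr (- \<alpha> - 1/2) * \<bar>g y\<bar>\<close> is one with respect to the measure of order \<open>\<alpha>/2 - 1/4 > -1\<close>.\<close>

lemma rapid_hankel_decay:
  assumes "\<alpha> \<ge> - 1 / 2" "rapid_decay g" "g \<in> borel_measurable (mu \<alpha>)"
  shows "\<exists>C. \<forall>x>0. norm (hankel \<alpha> g x) \<le> C * x powr (- \<alpha> - 1 / 2)"
proof -
  obtain C where C: "C > 0" "\<And>s. s > 0 \<Longrightarrow> \<bar>q \<alpha> s\<bar> \<le> C * s powr (- \<alpha> - 1 / 2)"
    using bessel_quot_bound[OF assms(1)] by blast
  have [measurable]: "g \<in> borel_measurable (mu \<alpha>)" by fact
  define h where "h = (\<lambda>y. y powr (2 * (- \<alpha> / 2 - 1 / 4)) *\<^sub>R g y)"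
  have "integrable (mu (\<alpha> + (- \<alpha> / 2 - 1 / 4))) g"
    using assms by (intro rapid_integrable) (auto simp: borel_measurable_mu)
  then have h: "integrable (mu \<alpha>) h"
    unfolding h_def using integrable_mu_shift[OF assms(3)] by blast
  have "norm (hankel \<alpha> g x) \<le> C * (LINT y|mu \<alpha>. norm (h y)) * x powr (- \<alpha> - 1 / 2)" if "0 < x" for x
  proof -
    have "norm (hankel \<alpha> g x) \<le> (LINT y|mu \<alpha>. C * x powr (- \<alpha> - 1 / 2) * norm (h y))"
      unfolding hankel_def
    proof (rule Bochner_Integration.integral_norm_bound_integral)
      show "integrable (mu \<alpha>) (\<lambda>y. of_real (q \<alpha> (x * y)) * g y)"
        using assms by (intro rapid_hankel_integrable that) auto
      show "integrable (mu \<alpha>) (\<lambda>y. C * x powr (- \<alpha> - 1 / 2) * norm (h y))"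
        using h by (intro integrable_mult_right integrable_norm)
      fix y assume "y \<in> space (mu \<alpha>)"
      then have y: "y > 0" by simp
      have "\<bar>q \<alpha> (x * y)\<bar> \<le> C * (x * y) powr (- \<alpha> - 1 / 2)" using C y that by simp
      then have "\<bar>q \<alpha> (x * y)\<bar> * norm (g y) \<le> C * (x * y) powr (- \<alpha> - 1 / 2) * norm (g y)"
        by (rule mult_right_mono) auto
      then show "norm (of_real (q \<alpha> (x * y)) * g y) \<le> C * x powr (- \<alpha> - 1 / 2) * norm (h y)"
        using C y that by (simp add: h_def norm_mult powr_mult mult_ac)
    qed
    then show ?thesis by (simp add: mult_ac)
  qed
  then show ?thesis by blast
qed

lemma has_real_derivative_powr_bessel_quot_scaled:
  assumes "x > 0" "y > 0"
  shows "((\<lambda>y. y powr (2 * \<alpha> + 2) * q (\<alpha> + 1) (x * y)) has_real_derivative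
    y powr (2 * \<alpha> + 1) * q \<alpha> (x * y)) (at y)"
proof -
  have "((\<lambda>y. (x * y) powr (2 * \<alpha> + 2) * q (\<alpha> + 1) (x * y)) has_real_derivative
      ((x * y) powr (2 * \<alpha> + 1) * q \<alpha> (x * y)) * x) (at y)"
    using assms by (intro DERIV_chain2[OF has_real_derivative_powr_bessel_quot]) (auto intro!: derivative_eq_intros)
  from DERIV_cmult[OF this, of "x powr (- 2 * \<alpha> - 2)"]
  have "((\<lambda>y. x powr (- 2 * \<alpha> - 2) * ((x * y) powr (2 * \<alpha> + 2) * q (\<alpha> + 1) (x * y)))
    has_real_derivative x powr (- 2 * \<alpha> - 2) * ((x * y) powr (2 * \<alpha> + 1) * q \<alpha> (x * y) * x)) (at y)" .
  moreover have "x powr (- 2 * \<alpha> - 2) * ((x * y) powr (2 * \<alpha> + 1) * q \<alpha> (x * y) * x)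
      = y powr (2 * \<alpha> + 1) * q \<alpha> (x * y)"
  proof -
    have "x powr (- 2 * \<alpha> - 2) * x powr (2 * \<alpha> + 1) * x powr 1 = 1"
      unfolding powr_add[symmetric] using assms by simp
    then show ?thesis using assms by (simp add: powr_mult mult_ac)
  qed
  ultimately have "((\<lambda>y. x powr (- 2 * \<alpha> - 2) * ((x * y) powr (2 * \<alpha> + 2) * q (\<alpha> + 1) (x * y)))
    has_real_derivative y powr (2 * \<alpha> + 1) * q \<alpha> (x * y)) (at y)" by (simp only:)
  then show ?thesis
  proof (rule has_field_derivative_transform_within_open[where S = "{0<..}"])
    fix z :: real assume "z \<in> {0<..}"
    moreover have "x powr (- 2 * \<alpha> - 2) * x powr (2 * \<alpha> + 2) = 1"
      unfolding powr_add[symmetric] using assms by simp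
    ultimately show "x powr (- 2 * \<alpha> - 2) * ((x * z) powr (2 * \<alpha> + 2) * q (\<alpha> + 1) (x * z))
       = z powr (2 * \<alpha> + 2) * q (\<alpha> + 1) (x * z)"
      using assms by (simp add: powr_mult mult.assoc[symmetric])
  qed (use assms in auto)
qed

text \<open>Since \<open>y powr (2 \<alpha> + 1) * q\<^sub>\<alpha> (x y)\<close> is the derivative of
  \<open>y powr (2 \<alpha> + 2) * q\<^bsub>\<alpha>+1\<^esub> (x y)\<close>, whose product with \<open>F\<close> vanishes at both ends, the transform
  of order \<open>\<alpha>\<close> of \<open>F\<close> becomes one of order \<open>\<alpha> + 1\<close> of \<open>F' / y\<close>.\<close>

lemma hankel_by_parts:
  assumes \<alpha>: "\<alpha> > -1" and x: "x > 0"
    and dF: "\<And>y. y > 0 \<Longrightarrow> (F has_vector_derivative F' y) (at y)"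
    and cF': "continuous_on {0<..} F'" and rF: "rapid_decay F" and rF': "rapid_decay (\<lambda>y. F' y / of_real y)"
  shows "hankel \<alpha> F x = - hankel (\<alpha> + 1) (\<lambda>y. F' y / of_real y) x"
proof -
  define p where "p = (\<lambda>y. y powr (2 * \<alpha> + 2) * q (\<alpha> + 1) (x * y))"
  define p' where "p' = (\<lambda>y. y powr (2 * \<alpha> + 1) * q \<alpha> (x * y))"
  have dp: "(p has_real_derivative p' y) (at y)" if "y > 0" for y
    unfolding p_def p'_def by (rule has_real_derivative_powr_bessel_quot_scaled[OF x that])
  have cF: "continuous_on {0<..} F"
    using dF by (auto simp: continuous_on_eq_continuous_at intro: has_vector_derivative_continuous)
  have mF [measurable]: "F \<in> borel_measurable (mu \<nu>)" "F' \<in> borel_measurable (mu \<nu>)" for \<nu>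
    by (intro borel_measurable_mu_continuous cF cF')+
  have mF' [measurable]: "(\<lambda>y. F' y / of_real y) \<in> borel_measurable (mu \<nu>)" for \<nu> by measurable
  have cp: "continuous_on {0<..} p"
    using dp by (auto simp: continuous_on_eq_continuous_at intro: DERIV_isCont)
  have cp': "continuous_on {0<..} p'"
    unfolding p'_def using x by (intro continuous_intros) auto
  have i1: "set_integrable lborel {0<..} (\<lambda>y. p' y *\<^sub>R F y)"
    and h1: "hankel \<alpha> F x = (LINT y:{0<..}|lborel. p' y *\<^sub>R F y)"
  proof -
    have e: "y powr (2 * \<alpha> + 1) *\<^sub>R (of_real (q \<alpha> (x * y)) * F y) = p' y *\<^sub>R F y" for y
      by (simp add: p'_def scaleR_conv_of_real)
    show "set_integrable lborel {0<..} (\<lambda>y. p' y *\<^sub>R F y)"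
      using rapid_hankel_integrable[OF \<alpha> rF mF(1) x] by (subst (asm) integrable_mu_iff) (auto simp: e)
    show "hankel \<alpha> F x = (LINT y:{0<..}|lborel. p' y *\<^sub>R F y)"
      unfolding hankel_def by (subst integral_mu) (auto simp: e)
  qed
  have i2: "set_integrable lborel {0<..} (\<lambda>y. p y *\<^sub>R F' y)"
    and h2: "hankel (\<alpha> + 1) (\<lambda>y. F' y / of_real y) x = (LINT y:{0<..}|lborel. p y *\<^sub>R F' y)"
  proof -
    have e: "y powr (2 * (\<alpha> + 1) + 1) *\<^sub>R (of_real (q (\<alpha> + 1) (x * y)) * (F' y / of_real y)) = p y *\<^sub>R F' y"
      if "y \<in> {0<..}" for y
    proof -
      have "y powr (2 * (\<alpha> + 1) + 1) = y powr (2 * \<alpha> + 2) * y"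
        using powr_add[of y "2 * \<alpha> + 2" 1] that by (simp add: add_ac)
      then show ?thesis using that by (simp add: p_def scaleR_conv_of_real)
    qed
    have "integrable (mu (\<alpha> + 1)) (\<lambda>y. of_real (q (\<alpha> + 1) (x * y)) * (F' y / of_real y))"
      using \<alpha> by (intro rapid_hankel_integrable rF' mF' x) auto
    then have "set_integrable lborel {0<..} (\<lambda>y. y powr (2 * (\<alpha> + 1) + 1) *\<^sub>R (of_real (q (\<alpha> + 1) (x * y)) * (F' y / of_real y)))"
      by (subst (asm) integrable_mu_iff) auto
    then show "set_integrable lborel {0<..} (\<lambda>y. p y *\<^sub>R F' y)"
      by (subst (asm) set_integrable_cong[OF refl refl e]) auto
    show "hankel (\<alpha> + 1) (\<lambda>y. F' y / of_real y) x = (LINT y:{0<..}|lborel. p y *\<^sub>R F' y)"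
    proof -
      have "hankel (\<alpha> + 1) (\<lambda>y. F' y / of_real y) x = (LINT y:{0<..}|lborel. y powr (2 * (\<alpha> + 1) + 1) *\<^sub>R
          (of_real (q (\<alpha> + 1) (x * y)) * (F' y / of_real y)))"
        unfolding hankel_def by (rule integral_mu) measurable
      also have "\<dots> = (LINT y:{0<..}|lborel. p y *\<^sub>R F' y)"
        by (rule set_lebesgue_integral_cong) (simp, use e in blast)
      finally show ?thesis .
    qed
  qed
  have ei: "einterval 0 \<infinity> = {0<..}" by (auto simp: einterval_def zero_ereal_def)
  obtain Q where Q: "Q > 0" "\<And>s. s > 0 \<Longrightarrow> \<bar>q (\<alpha> + 1) s\<bar> \<le> Q"
    using bessel_quot_bound[of "\<alpha> + 1"] \<alpha> by auto
  have pb: "norm (p y *\<^sub>R F y) \<le> Q * y powr (2 * \<alpha> + 2) * norm (F y)" if "y > 0" for y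
  proof -
    have "y powr (2 * \<alpha> + 2) * \<bar>q (\<alpha> + 1) (x * y)\<bar> * norm (F y) \<le> y powr (2 * \<alpha> + 2) * Q * norm (F y)"
      using that Q x by (intro mult_right_mono mult_left_mono) auto
    then show ?thesis by (simp add: p_def abs_mult mult_ac)
  qed
  have "(LBINT y=0..\<infinity>. p' y *\<^sub>R F y + p y *\<^sub>R F' y) = 0 - 0"
  proof (rule interval_integral_FTC_integrable[where F = "\<lambda>y. p y *\<^sub>R F y"])
    fix y assume "0 < ereal y"
    then have y: "y > 0" by (simp add: zero_ereal_def)
    show "((\<lambda>y. p y *\<^sub>R F y) has_vector_derivative p' y *\<^sub>R F y + p y *\<^sub>R F' y) (at y)"
      using has_vector_derivative_scaleR[OF dp[OF y] dF[OF y]] by (simp add: add.commute)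
    have "continuous_on {0<..} (\<lambda>y. p' y *\<^sub>R F y + p y *\<^sub>R F' y)"
      by (intro continuous_intros cp cp' cF cF')
    then show "isCont (\<lambda>y. p' y *\<^sub>R F y + p y *\<^sub>R F' y) y"
      using y by (auto simp: continuous_on_eq_continuous_at)
  next
    show "set_integrable lborel (einterval 0 \<infinity>) (\<lambda>y. p' y *\<^sub>R F y + p y *\<^sub>R F' y)"
      unfolding ei by (rule set_integral_add[OF i1 i2])
    obtain B where B: "B > 0" "\<And>y. y > 0 \<Longrightarrow> norm (F y) \<le> B" using rapid_bounded[OF rF] by blast
    have "((\<lambda>y. p y *\<^sub>R F y) \<longlongrightarrow> 0) (at_right 0)"
    proof (rule Lim_null_comparison)
      show "\<forall>\<^sub>F y in at_right 0. norm (p y *\<^sub>R F y) \<le> Q * y powr (2 * \<alpha> + 2) * B"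
        unfolding eventually_at_right_field
      proof (intro exI[of _ 1] conjI allI impI)
        fix y :: real assume y: "0 < y" "y < 1"
        show "norm (p y *\<^sub>R F y) \<le> Q * y powr (2 * \<alpha> + 2) * B"
          using Q B(2)[OF y(1)] by (intro order.trans[OF pb[OF y(1)]] mult_left_mono) auto
      qed simp
      have "((\<lambda>y. y powr (2 * \<alpha> + 2)) \<longlongrightarrow> 0) (at_right (0::real))"
        using \<alpha> by (intro tendsto_eq_intros(1) tendsto_zero_powrI[OF tendsto_ident_at tendsto_const]) (auto intro: eventually_mono[OF eventually_at_right_less])
      from tendsto_mult[OF tendsto_mult[OF tendsto_const this] tendsto_const, of Q B]
      show "((\<lambda>y. Q * y powr (2 * \<alpha> + 2) * B) \<longlongrightarrow> 0) (at_right 0)" by simp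
    qed
    then show "(((\<lambda>y. p y *\<^sub>R F y) \<circ> real_of_ereal) \<longlongrightarrow> 0) (at_right 0)"
      unfolding zero_ereal_def by (simp add: ereal_tendsto_simps)
    obtain D where D: "D > 0" "\<And>y. y \<ge> 1 \<Longrightarrow> norm (F y) \<le> D * y powr (- 2 * \<alpha> - 3)"
      using rapid_powr[OF rF] by blast
    have "((\<lambda>y. p y *\<^sub>R F y) \<longlongrightarrow> 0) at_top"
    proof (rule Lim_null_comparison)
      show "\<forall>\<^sub>F y in at_top. norm (p y *\<^sub>R F y) \<le> Q * D * (1 / y)"
        unfolding eventually_at_top_linorder
      proof (intro exI[of _ 1] allI impI)
        fix y :: real assume y: "1 \<le> y"
        have "norm (p y *\<^sub>R F y) \<le> Q * y powr (2 * \<alpha> + 2) * (D * y powr (- 2 * \<alpha> - 3))"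
          using Q D(2)[OF y] y by (intro order.trans[OF pb] mult_left_mono) auto
        also have "\<dots> = Q * D * (y powr (2 * \<alpha> + 2) * y powr (- 2 * \<alpha> - 3))" by simp
        also have "y powr (2 * \<alpha> + 2) * y powr (- 2 * \<alpha> - 3) = y powr (-1)"
          by (simp add: powr_add[symmetric])
        also have "\<dots> = 1 / y" using y by (simp add: powr_minus_divide)
        finally show "norm (p y *\<^sub>R F y) \<le> Q * D * (1 / y)" .
      qed
      show "((\<lambda>y. Q * D * (1 / y)) \<longlongrightarrow> 0) at_top"
        by (intro tendsto_mult_right_zero tendsto_divide_0[OF tendsto_const] filterlim_at_top_imp_at_infinity filterlim_ident)
    qed
    then show "(((\<lambda>y. p y *\<^sub>R F y) \<circ> real_of_ereal) \<longlongrightarrow> 0) (at_left \<infinity>)"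
      by (simp add: ereal_tendsto_simps)
  qed auto
  then have "(LINT y:{0<..}|lborel. p' y *\<^sub>R F y + p y *\<^sub>R F' y) = 0"
    by (simp add: interval_lebesgue_integral_def ei)
  then show ?thesis
    unfolding h1 h2 using set_integral_add(2)[OF i1 i2] by (simp add: add_eq_0_iff2)
qed

section \<open>Integrals over products and over intervals\<close>

lemma integrable_pair_times:
  fixes f :: "'a \<Rightarrow> real" and g :: "'b \<Rightarrow> real"
  assumes "pair_sigma_finite M1 M2" "integrable M1 f" "integrable M2 g"
  shows "integrable (M1 \<Otimes>\<^sub>M M2) (\<lambda>p. f (fst p) * g (snd p))"
proof -
  interpret pair_sigma_finite M1 M2 by fact
  have [measurable]: "f \<in> borel_measurable M1" "g \<in> borel_measurable M2" using assms by auto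
  show ?thesis
  proof (rule Fubini_integrable)
    show "integrable M1 (\<lambda>x. LINT y|M2. norm (f (fst (x, y)) * g (snd (x, y))))"
      using assms by (simp add: abs_mult)
    show "AE x in M1. integrable M2 (\<lambda>y. f (fst (x, y)) * g (snd (x, y)))"
      using assms by simp
  qed measurable
qed

text \<open>The positive and the negative part of \<open>h\<close> are densities of finite measures that agree on all
  half-lines; so the measures agree, and then the densities.\<close>

lemma AE_eq_0_if_integrals_Ioi_eq_0:
  fixes h :: "real \<Rightarrow> real"
  assumes h: "integrable lborel h" and 0: "\<And>x. (LINT y:{x<..}|lborel. h y) = 0"
  shows "AE y in lborel. h y = 0"
proof -
  have [measurable]: "h \<in> borel_measurable borel" using h by auto
  define f where "f = (\<lambda>y. max 0 (h y))"
  define g where "g = (\<lambda>y. max 0 (- h y))"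
  have [measurable]: "f \<in> borel_measurable borel" "g \<in> borel_measurable borel"
    unfolding f_def g_def by measurable
  have fg: "integrable lborel f" "integrable lborel g"
    unfolding f_def g_def using h by auto
  have em: "emeasure (density lborel (\<lambda>y. ennreal (k y))) A = ennreal (LINT y:A|lborel. k y)"
    if "integrable lborel k" "\<And>y. k y \<ge> 0" "A \<in> sets borel" for k :: "real \<Rightarrow> real" and A
  proof -
    have [measurable]: "k \<in> borel_measurable borel" using that by auto
    have "emeasure (density lborel (\<lambda>y. ennreal (k y))) A = (\<integral>\<^sup>+ y. ennreal (indicator A y *\<^sub>R k y) \<partial>lborel)"
      using that by (subst emeasure_density) (auto intro!: nn_integral_cong simp: indicator_def)
    also have "\<dots> = ennreal (LINT y|lborel. indicator A y *\<^sub>R k y)"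
      using that by (intro nn_integral_eq_integral integrable_mult_indicator) auto
    finally show ?thesis by (simp add: set_lebesgue_integral_def)
  qed
  have eq: "(LINT y:{x<..}|lborel. f y) = (LINT y:{x<..}|lborel. g y)" for x
  proof -
    have "set_integrable lborel {x<..} f" "set_integrable lborel {x<..} g"
      unfolding set_integrable_def by (rule integrable_mult_indicator, simp, rule fg)+
    from set_integral_diff(2)[OF this]
    have "(LINT y:{x<..}|lborel. f y) - (LINT y:{x<..}|lborel. g y) = (LINT y:{x<..}|lborel. f y - g y)" by simp
    also have "(\<lambda>y. f y - g y) = h" by (auto simp: f_def g_def)
    finally show ?thesis using 0 by simp
  qed
  have "density lborel (\<lambda>y. ennreal (f y)) = density lborel (\<lambda>y. ennreal (g y))"
  proof (rule measure_eqI_lessThan)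
    fix x :: real
    have "f y \<ge> 0" "g y \<ge> 0" for y by (auto simp: f_def g_def)
    then show "emeasure (density lborel (\<lambda>y. ennreal (f y))) {x<..} < \<infinity>"
      "emeasure (density lborel (\<lambda>y. ennreal (f y))) {x<..} = emeasure (density lborel (\<lambda>y. ennreal (g y))) {x<..}"
      using em[OF fg(1)] em[OF fg(2)] eq[of x] by auto
  qed auto
  moreover have "(\<integral>\<^sup>+ y. ennreal (f y) \<partial>lborel) \<noteq> \<infinity>"
    using fg(1) by (subst nn_integral_eq_integral) (auto simp: f_def)
  ultimately have "AE y in lborel. ennreal (f y) = ennreal (g y)"
    by (subst (asm) finite_density_unique) auto
  then show ?thesis
    by (rule AE_mp) (auto intro!: AE_I2 simp: f_def g_def max_def split: if_splits)
qed

lemma AE_mu_eq_0_if_interval_integrals_eq_0: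
  fixes g :: "real \<Rightarrow> real"
  assumes gm: "g \<in> borel_measurable (mu \<alpha>)"
    and int: "\<And>a b. 0 < a \<Longrightarrow> a < b \<Longrightarrow> integrable (mu \<alpha>) (\<lambda>x. indicator {a..b} x * g x)"
    and 0: "\<And>a b. 0 < a \<Longrightarrow> a < b \<Longrightarrow> (LINT x|mu \<alpha>. indicator {a..b} x * g x) = 0"
  shows "AE x in mu \<alpha>. g x = 0"
proof -
  note [measurable] = gm
  have ind [measurable]: "(indicator S :: real \<Rightarrow> real) \<in> borel_measurable (mu \<alpha>)" if "S \<in> sets borel" for S
    using that by (intro borel_measurable_muI) auto
  have "AE x in lborel. indicator {0<..} x * (x powr (2 * \<alpha> + 1) * (indicator {1 / (real n + 2)..real n + 2} x * g x)) = 0" for n :: nat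
  proof (rule AE_eq_0_if_integrals_Ioi_eq_0)
    define a where "a = 1 / (real n + 2)"
    define b where "b = real n + 2"
    have ab: "0 < a" "a < b"
    proof -
      have "a \<le> 1" "b > 1" "a > 0" by (auto simp: a_def b_def field_simps)
      then show "0 < a" "a < b" by auto
    qed
    show "integrable lborel (\<lambda>x. indicator {0<..} x * (x powr (2 * \<alpha> + 1) * (indicator {1 / (real n + 2)..real n + 2} x * g x)))"
      using int[OF ab] by (subst (asm) integrable_mu_iff) (auto simp: set_integrable_def a_def b_def add.commute)
    show "(LINT y:{x<..}|lborel. indicator {0<..} y * (y powr (2 * \<alpha> + 1) * (indicator {1 / (real n + 2)..real n + 2} y * g y))) = 0" for x
    proof (cases "x < b")
      case False
      then show ?thesis unfolding set_lebesgue_integral_def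
        by (intro integral_eq_zero_AE AE_I2) (auto simp: indicator_def b_def)
    next
      case True
      define c where "c = max a x"
      have c: "0 < c" "c < b" using True ab by (auto simp: c_def)
      have "(LINT y:{x<..}|lborel. indicator {0<..} y * (y powr (2 * \<alpha> + 1) * (indicator {1 / (real n + 2)..real n + 2} y * g y)))
         = (LINT y|lborel. indicator {0<..} y *\<^sub>R (y powr (2 * \<alpha> + 1) * (indicator {a..b} y * (indicator {x<..} y * g y))))"
        unfolding set_lebesgue_integral_def by (intro Bochner_Integration.integral_cong) (auto simp: indicator_def a_def b_def add.commute)
      also have "\<dots> = (LINT y|mu \<alpha>. indicator {a..b} y * (indicator {x<..} y * g y))"
        by (subst integral_mu) (auto simp: set_lebesgue_integral_def intro!: borel_measurable_times)
      also have "\<dots> = (LINT y|mu \<alpha>. indicator {c..b} y * g y)"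
      proof (rule integral_cong_AE)
        have "AE y in lborel. y \<noteq> x" by (rule AE_lborel_singleton)
        then show "AE y in mu \<alpha>. indicator {a..b} y * (indicator {x<..} y * g y) = indicator {c..b} y * g y"
          unfolding AE_mu by (rule AE_mp) (auto intro!: AE_I2 simp: indicator_def c_def)
      qed (auto intro!: borel_measurable_times)
      also have "\<dots> = 0" by (rule 0[OF c])
      finally show ?thesis .
    qed
  qed
  then have "AE x in lborel. \<forall>n::nat. indicator {0<..} x * (x powr (2 * \<alpha> + 1) * (indicator {1 / (real n + 2)..real n + 2} x * g x)) = 0"
    unfolding AE_all_countable by blast
  then show ?thesis unfolding AE_mu
  proof (rule AE_mp, intro AE_I2 impI)
    fix x :: real
    assume *: "\<forall>n::nat. indicator {0<..} x * (x powr (2 * \<alpha> + 1) * (indicator {1 / (real n + 2)..real n + 2} x * g x)) = 0" and x: "0 < x"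
    obtain n where n: "max x (1 / x) < real n" using reals_Archimedean2 by blast
    then have "x \<le> real n + 2" "1 / (real n + 2) \<le> x" using x by (auto simp: field_simps)
    then show "g x = 0" using *[rule_format, of n] x by (auto simp: add.commute)
  qed
qed

section \<open>Uniqueness of the extension of the Hankel transform\<close>

text \<open>For a fixed \<open>x\<close> the quotient \<open>q\<^sub>\<nu> (x y)\<close> has zeros at arbitrarily large \<open>y\<close>, but its average over a set of
  \<open>x\<close> of measure at least \<open>3/4\<close> in \<open>{1..2}\<close> stays comparable with its amplitude: the average of
  \<open>cos\<^sup>2\<close> over \<open>{1..2}\<close> tends to \<open>1/2\<close>, and the missing set takes away at most \<open>1/4\<close>.\<close>

lemma bessel_quot_average_lower:
  assumes "\<nu> > -1"
  shows "\<exists>Y c. Y \<ge> 1 \<and> c > 0 \<and> (\<forall>E y. E \<in> sets borel \<and> E \<subseteq> {1..2} \<and> measure lborel E \<ge> 3 / 4 \<and> y \<ge> Y \<longrightarrow>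
     c * y powr (- \<nu> - 1 / 2) \<le> (LINT x:E|lborel. \<bar>q \<nu> (x * y)\<bar>))"
proof -
  obtain A \<phi> C where C: "A > 0" "C > 0"
    "\<And>s. s \<ge> 1 \<Longrightarrow> \<bar>s powr (\<nu> + 1 / 2) * q \<nu> s - A * cos (s - \<phi>)\<bar> \<le> C / s"
    using bessel_quot_asymptotics[OF assms(1)] by blast
  define B :: real where "B = 2 powr (\<bar>\<nu>\<bar> + 1 / 2)"
  have B: "B > 0" by (simp add: B_def)
  define Y where "Y = (A / 2 + C) * 8 / A + 1"
  have Y: "Y \<ge> 1" using C by (simp add: Y_def)
  have main: "A / (8 * B) * y powr (- \<nu> - 1 / 2) \<le> (LINT x:E|lborel. \<bar>q \<nu> (x * y)\<bar>)"
    if E [measurable]: "E \<in> sets borel" and sub: "E \<subseteq> {1..2}" and mE: "measure lborel E \<ge> 3 / 4" and y: "y \<ge> Y" for E y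
  proof -
    have y1: "y \<ge> 1" using y Y by simp
    \<comment> \<open>The square of the cosine is below its absolute value and has an elementary primitive.\<close>
    define k where "k = (\<lambda>x. A * (cos (x * y - \<phi>))\<^sup>2 - C / y)"
    define W where "W = y powr (- \<nu> - 1 / 2)"
    have pt: "k x * (W / B) \<le> \<bar>q \<nu> (x * y)\<bar>" if x: "x \<in> {1..2}" for x
    proof -
      have s: "x * y \<ge> y" "x * y \<ge> 1" using x y1 by (auto simp: mult_le_cancel_right1 intro: order.trans[OF y1])
      define v where "v = \<bar>q \<nu> (x * y)\<bar>"
      have "(cos (x * y - \<phi>))\<^sup>2 \<le> \<bar>cos (x * y - \<phi>)\<bar>"
        using abs_cos_le_one[of "x * y - \<phi>"] mult_left_le_one_le[of "\<bar>cos (x * y - \<phi>)\<bar>" "\<bar>cos (x * y - \<phi>)\<bar>"]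
        by (simp add: power2_eq_square)
      then have "A * (cos (x * y - \<phi>))\<^sup>2 \<le> A * \<bar>cos (x * y - \<phi>)\<bar>" using C by simp
      also have "\<dots> = \<bar>A * cos (x * y - \<phi>)\<bar>" using C by (simp add: abs_mult)
      finally have 1: "A * (cos (x * y - \<phi>))\<^sup>2 \<le> \<bar>A * cos (x * y - \<phi>)\<bar>" .
      have 2: "C / (x * y) \<le> C / y" using s y1 C by (intro divide_left_mono) auto
      have 3: "\<bar>(x * y) powr (\<nu> + 1 / 2) * q \<nu> (x * y)\<bar> = (x * y) powr (\<nu> + 1 / 2) * v"
        by (simp add: abs_mult v_def)
      have 4: "k x \<le> (x * y) powr (\<nu> + 1 / 2) * v"
        using 1 2 3 C(3)[OF s(2)] unfolding k_def by linarith
      have "x powr (\<nu> + 1 / 2) \<le> x powr (\<bar>\<nu>\<bar> + 1 / 2)" using x by (intro powr_mono) auto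
      also have "\<dots> \<le> B" unfolding B_def using x by (intro powr_mono2) auto
      finally have "(x * y) powr (\<nu> + 1 / 2) * v \<le> B * y powr (\<nu> + 1 / 2) * v"
        using x y1 by (auto simp: powr_mult v_def intro!: mult_right_mono)
      with 4 have "k x * (W / B) \<le> B * y powr (\<nu> + 1 / 2) * v * (W / B)"
        using B by (intro mult_right_mono) (auto simp: W_def)
      also have "\<dots> = y powr (\<nu> + 1 / 2) * W * v" using B by simp
      also have "y powr (\<nu> + 1 / 2) * W = 1" unfolding W_def powr_add[symmetric] using y1 by simp
      finally show ?thesis by (simp add: v_def)
    qed
    have ck: "continuous_on {1..2} k" unfolding k_def using y1 by (intro continuous_intros) auto
    have ik: "set_integrable lborel {1..2} k"
      by (rule borel_integrable_atLeastAtMost'[OF ck])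
    have ikE: "set_integrable lborel E k" "set_integrable lborel ({1..2} - E) k"
      by (rule set_integrable_subset[OF ik]; use sub in auto)+
    have fin: "emeasure lborel S < \<infinity>" "emeasure lborel S \<noteq> \<infinity>" if "S \<subseteq> {1..2::real}" for S
      using emeasure_mono[of S "{1..2}" lborel] that by (auto simp: top_unique intro: le_less_trans[OF _ ennreal_one_less_top])
    have "(LINT x:{1..2} - E|lborel. k x) \<le> (LINT x:{1..2} - E|lborel. A)"
    proof (rule set_integral_mono)
      show "set_integrable lborel ({1..2} - E) (\<lambda>x. A)"
        unfolding set_integrable_def using integrable_real_indicator[of "{1..2} - E" lborel] fin
        by (intro integrable_scaleR_left) auto
      fix x assume "x \<in> {1..2} - E"
      have "A * (cos (x * y - \<phi>))\<^sup>2 \<le> A * 1" using C by (intro mult_left_mono) (auto simp: abs_square_le_1)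
      moreover have "C / y \<ge> 0" using C y1 by simp
      ultimately show "k x \<le> A" unfolding k_def by linarith
    qed (rule ikE)
    also have "\<dots> = measure lborel ({1..2} - E) * A"
      using fin by (simp add: set_integral_const)
    also have "\<dots> \<le> 1 / 4 * A"
    proof (rule mult_right_mono)
      have "measure lborel ({1..2} - E) = measure lborel {1..2::real} - measure lborel E"
        using sub fin by (intro measure_Diff) auto
      then show "measure lborel ({1..2} - E) \<le> 1 / 4" using mE by simp
    qed (use C in simp)
    finally have d: "(LINT x:{1..2} - E|lborel. k x) \<le> 1 / 4 * A" .
    have "has_bochner_integral lborel (\<lambda>x. k x * indicator {1..2} x)
      ((A * (2 / 2 + sin (2 * (2 * y - \<phi>)) / (4 * y)) - C / y * 2) - (A * (1 / 2 + sin (2 * (1 * y - \<phi>)) / (4 * y)) - C / y * 1))"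
    proof (rule has_bochner_integral_FTC_Icc_real)
      fix x :: real
      show "((\<lambda>x. A * (x / 2 + sin (2 * (x * y - \<phi>)) / (4 * y)) - C / y * x) has_real_derivative k x) (at x)"
      proof (rule DERIV_cong)
        show "((\<lambda>x. A * (x / 2 + sin (2 * (x * y - \<phi>)) / (4 * y)) - C / y * x) has_real_derivative
            A * (1 / 2 + cos (2 * (x * y - \<phi>)) * (2 * y) / (4 * y)) - C / y) (at x)"
          using y1 by (auto intro!: derivative_eq_intros)
        show "A * (1 / 2 + cos (2 * (x * y - \<phi>)) * (2 * y) / (4 * y)) - C / y = k x"
          unfolding k_def cos_double_cos using y1 by (simp add: field_simps)
      qed
      show "isCont k x" unfolding k_def using y1 by (intro continuous_intros) auto
    qed simp
    then have "(LINT x:{1..2}|lborel. k x) = A / 2 - C / y + A * ((sin (2 * (2 * y - \<phi>)) - sin (2 * (1 * y - \<phi>))) / (4 * y))"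
      unfolding set_lebesgue_integral_def using y1
      by (subst (asm) has_bochner_integral_iff) (simp add: mult.commute[of _ "k _"] algebra_simps diff_divide_distrib)
    moreover have "A * ((sin (2 * (2 * y - \<phi>)) - sin (2 * (1 * y - \<phi>))) / (4 * y)) \<ge> A * (- 2 / (4 * y))"
    proof -
      have "sin (2 * (2 * y - \<phi>)) - sin (2 * (1 * y - \<phi>)) \<ge> - 2"
        using sin_ge_minus_one[of "2 * (2 * y - \<phi>)"] sin_le_one[of "2 * (1 * y - \<phi>)"] by linarith
      then show ?thesis using C y1 by (intro mult_left_mono divide_right_mono) auto
    qed
    moreover have "(LINT x:{1..2}|lborel. k x) = (LINT x:E|lborel. k x) + (LINT x:{1..2} - E|lborel. k x)"
    proof -
      have "E \<union> ({1..2} - E) = {1..2}" using sub by auto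
      then show ?thesis using set_integral_Un[OF _ ikE] by auto
    qed
    ultimately have "(LINT x:E|lborel. k x) \<ge> A / 4 - (A / 2 + C) / y"
      using d by (simp add: add_divide_distrib)
    moreover have "(A / 2 + C) / y \<le> A / 8"
    proof -
      have "(A / 2 + C) * 8 / A \<le> y" using y by (simp add: Y_def)
      then show ?thesis using C y1 by (simp add: field_simps)
    qed
    ultimately have "A / 8 \<le> (LINT x:E|lborel. k x)" by linarith
    then have "A / 8 * (W / B) \<le> (LINT x:E|lborel. k x) * (W / B)"
      using B by (intro mult_right_mono) (auto simp: W_def)
    also have "\<dots> = (LINT x:E|lborel. k x * (W / B))" by simp
    also have "\<dots> \<le> (LINT x:E|lborel. \<bar>q \<nu> (x * y)\<bar>)"
    proof (rule set_integral_mono)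
      have "continuous_on {1..2} (\<lambda>x. \<bar>q \<nu> (x * y)\<bar>)"
        using y1 by (intro continuous_intros) auto
      then have "set_integrable lborel {1..2} (\<lambda>x. \<bar>q \<nu> (x * y)\<bar>)"
        by (rule borel_integrable_atLeastAtMost')
      then show "set_integrable lborel E (\<lambda>x. \<bar>q \<nu> (x * y)\<bar>)"
        by (rule set_integrable_subset) (use sub in auto)
      show "set_integrable lborel E (\<lambda>x. k x * (W / B))" using ikE by (intro set_integrable_mult_left)
      show "k x * (W / B) \<le> \<bar>q \<nu> (x * y)\<bar>" if "x \<in> E" for x using pt sub that by auto
    qed
    finally show ?thesis using B by (simp add: W_def)
  qed
  show ?thesis
    by (intro exI[of _ Y] exI[of _ "A / (8 * B)"] conjI allI impI Y main) (use C B in auto)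
qed

lemma borel_measurable_mu_indicator [measurable]:
  "S \<in> sets borel \<Longrightarrow> (indicator S :: real \<Rightarrow> real) \<in> borel_measurable (mu \<alpha>)"
  by (intro borel_measurable_muI) auto

lemma integrable_mu_indicator:
  assumes "0 < a" shows "integrable (mu \<alpha>) (indicator {a..b} :: real \<Rightarrow> real)"
proof -
  have "continuous_on {a..b} (\<lambda>x::real. x powr (2 * \<alpha> + 1))" using assms by (intro continuous_intros) auto
  then have "set_integrable lborel {a..b} (\<lambda>x::real. x powr (2 * \<alpha> + 1))" by (rule borel_integrable_atLeastAtMost')
  then have "set_integrable lborel {0<..} (\<lambda>x. x powr (2 * \<alpha> + 1) *\<^sub>R (indicator {a..b} x :: real))"
    unfolding set_integrable_def
    by (rule Bochner_Integration.integrable_cong[THEN iffD1, rotated -1]) (use assms in \<open>auto simp: indicator_def\<close>)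
  then show ?thesis by (subst integrable_mu_iff) auto
qed

text \<open>Membership in \<open>hankel_core\<close> only says that \<open>q\<^sub>\<alpha> (x y) * u y\<close> is integrable for each single \<open>x\<close>.
  The integral \<open>F x\<close> of its absolute value is therefore finite on \<open>{1..2}\<close>, and it is bounded on a subset of
  measure more than \<open>3/4\<close>. Integrating \<open>F\<close> over this subset and exchanging the integrals
  replaces \<open>\<bar>q\<^sub>\<alpha> (x y)\<bar>\<close> by its average, that is by its amplitude.\<close>

lemma hankel_core_tail_integrable:
  assumes \<alpha>: "\<alpha> > -1" and u: "u \<in> hankel_core \<alpha>"
  shows "\<exists>Y\<ge>1. integrable (mu \<alpha>) (\<lambda>y. indicator {Y..} y * (y powr (- \<alpha> - 1 / 2) * norm (u y)))"
proof -
  have um [measurable]: "u \<in> borel_measurable (mu \<alpha>)"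
    and ui: "\<And>x. x > 0 \<Longrightarrow> integrable (mu \<alpha>) (\<lambda>y. of_real (q \<alpha> (x * y)) * u y)"
    using u by (auto simp: hankel_core_def L2_def)
  obtain Y c where Y: "Y \<ge> 1" "c > 0" and av: "\<And>E y. E \<in> sets borel \<Longrightarrow> E \<subseteq> {1..2} \<Longrightarrow> measure lborel E \<ge> 3 / 4 \<Longrightarrow> y \<ge> Y \<Longrightarrow>
     c * y powr (- \<alpha> - 1 / 2) \<le> (LINT x:E|lborel. \<bar>q \<alpha> (x * y)\<bar>)"
    using bessel_quot_average_lower[OF \<alpha>] by blast
  interpret pair_sigma_finite "lborel :: real measure" "mu \<alpha>"
    by (intro pair_sigma_finite.intro sigma_finite_mu lborel.sigma_finite_measure_axioms)
  define k where "k = (\<lambda>x y. ennreal (\<bar>q \<alpha> (x * y)\<bar> * norm (u y)))"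
  have k [measurable]: "(\<lambda>(x, y). k x y) \<in> borel_measurable (lborel \<Otimes>\<^sub>M mu \<alpha>)"
    unfolding k_def by measurable
  define F where "F = (\<lambda>x. \<integral>\<^sup>+y. k x y \<partial>mu \<alpha>)"
  have F [measurable]: "F \<in> borel_measurable borel"
    using M2.borel_measurable_nn_integral[OF k] by (simp add: F_def)
  have Ffin: "F x < \<infinity>" if "x > 0" for x
  proof -
    have "(\<integral>\<^sup>+y. norm (of_real (q \<alpha> (x * y)) * u y) \<partial>mu \<alpha>) < \<infinity>"
      using ui[OF that] by (simp add: integrable_iff_bounded)
    then show ?thesis by (simp add: F_def k_def norm_mult)
  qed
  \<comment> \<open>Finiteness of \<open>F\<close> makes these sets exhaust \<open>{1..2}\<close>.\<close>
  define E where "E = (\<lambda>n::nat. {x \<in> {1..2::real}. F x \<le> of_nat n})"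
  have E [measurable]: "E n \<in> sets borel" for n unfolding E_def by measurable
  have incE: "incseq E"
    unfolding E_def incseq_def by (auto intro: order.trans)
  have "(\<Union>n. E n) = {1..2}"
  proof -
    have "\<exists>n::nat. F x \<le> of_nat n" if "x \<in> {1..2}" for x
    proof -
      have "F x < top" using Ffin[of x] that by auto
      then obtain n where "F x < of_nat n" by (metis ennreal_Ex_less_of_nat)
      then show ?thesis by (auto intro: less_imp_le)
    qed
    then show ?thesis by (auto simp: E_def)
  qed
  moreover have "(\<lambda>n. measure lborel (E n)) \<longlonglongrightarrow> measure lborel (\<Union>n. E n)"
    by (rule Lim_measure_incseq) (use incE calculation in auto)
  ultimately have "(\<lambda>n. measure lborel (E n)) \<longlonglongrightarrow> 1" by simp
  then have "eventually (\<lambda>n. measure lborel (E n) > 3 / 4) sequentially"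
    by (rule order_tendstoD) simp
  then obtain n where n: "measure lborel (E n) > 3 / 4"
    by (metis eventually_sequentially order_refl)
  have En: "E n \<subseteq> {1..2}" by (auto simp: E_def)
  have "emeasure lborel (E n) < \<infinity>"
    using emeasure_mono[OF En, of lborel] by (auto intro: le_less_trans[OF _ ennreal_one_less_top])
  have "(\<integral>\<^sup>+y. (\<integral>\<^sup>+x. indicator (E n) x * k x y \<partial>lborel) \<partial>mu \<alpha>) = (\<integral>\<^sup>+x. (\<integral>\<^sup>+y. indicator (E n) x * k x y \<partial>mu \<alpha>) \<partial>lborel)"
    by (rule Fubini') measurable
  also have "\<dots> = (\<integral>\<^sup>+x. indicator (E n) x * F x \<partial>lborel)"
    unfolding F_def by (intro nn_integral_cong nn_integral_cmult) (measurable)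
  also have "\<dots> \<le> (\<integral>\<^sup>+x. of_nat n * indicator (E n) x \<partial>lborel)"
    by (intro nn_integral_mono) (auto simp: indicator_def E_def)
  also have "\<dots> = of_nat n * emeasure lborel (E n)" by (rule nn_integral_cmult_indicator) simp
  also have "\<dots> < \<infinity>" using \<open>emeasure lborel (E n) < \<infinity>\<close>
    by (auto simp: ennreal_mult_less_top of_nat_less_top)
  finally have fin: "(\<integral>\<^sup>+y. (\<integral>\<^sup>+x. indicator (E n) x * k x y \<partial>lborel) \<partial>mu \<alpha>) < \<infinity>" .
  have "(\<integral>\<^sup>+y. ennreal (norm (c * (indicator {Y..} y * (y powr (- \<alpha> - 1 / 2) * norm (u y))))) \<partial>mu \<alpha>)
     \<le> (\<integral>\<^sup>+y. (\<integral>\<^sup>+x. indicator (E n) x * k x y \<partial>lborel) \<partial>mu \<alpha>)"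
  proof (rule nn_integral_mono)
    fix y assume "y \<in> space (mu \<alpha>)"
    then have y: "y > 0" by simp
    show "ennreal (norm (c * (indicator {Y..} y * (y powr (- \<alpha> - 1 / 2) * norm (u y)))))
        \<le> (\<integral>\<^sup>+x. indicator (E n) x * k x y \<partial>lborel)"
    proof (cases "y \<ge> Y")
      case False
      then show ?thesis by simp
    next
      case True
      have si: "set_integrable lborel (E n) (\<lambda>x. \<bar>q \<alpha> (x * y)\<bar>)"
      proof -
        have "continuous_on {1..2} (\<lambda>x. \<bar>q \<alpha> (x * y)\<bar>)"
          using y by (intro continuous_intros) auto
        then have "set_integrable lborel {1..2} (\<lambda>x. \<bar>q \<alpha> (x * y)\<bar>)"
          by (rule borel_integrable_atLeastAtMost')
        then show ?thesis by (rule set_integrable_subset) (use En in auto)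
      qed
      have "ennreal (norm (c * (indicator {Y..} y * (y powr (- \<alpha> - 1 / 2) * norm (u y)))))
         = ennreal (c * y powr (- \<alpha> - 1 / 2) * norm (u y))"
        using True Y by (simp add: abs_mult mult_ac)
      also have "\<dots> \<le> ennreal ((LINT x:E n|lborel. \<bar>q \<alpha> (x * y)\<bar>) * norm (u y))"
        using av[OF E En _ True] n by (intro ennreal_leI mult_right_mono) auto
      also have "\<dots> = ennreal (LINT x|lborel. indicator (E n) x * \<bar>q \<alpha> (x * y)\<bar> * norm (u y))"
        by (simp add: set_lebesgue_integral_def)
      also have "\<dots> = (\<integral>\<^sup>+x. ennreal (indicator (E n) x * \<bar>q \<alpha> (x * y)\<bar> * norm (u y)) \<partial>lborel)"
        using si by (intro nn_integral_eq_integral[symmetric]) (auto simp: set_integrable_def)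
      also have "\<dots> = (\<integral>\<^sup>+x. indicator (E n) x * k x y \<partial>lborel)"
        by (intro nn_integral_cong) (auto simp: k_def indicator_def)
      finally show ?thesis .
    qed
  qed
  also note fin
  finally have "integrable (mu \<alpha>) (\<lambda>y. c * (indicator {Y..} y * (y powr (- \<alpha> - 1 / 2) * norm (u y))))"
    by (subst integrable_iff_bounded) auto
  then show ?thesis using Y by (intro exI[of _ Y]) auto
qed

lemma integrable_mu_indicator_atMost:
  assumes \<alpha>: "\<alpha> > -1" shows "integrable (mu \<alpha>) (indicator {..Y} :: real \<Rightarrow> real)"
proof -
  define C where "C = max 1 (Y powr (2 * \<alpha> + 3))"
  show ?thesis
  proof (rule integrable_mu_comparison[OF \<alpha>, of _ C])
    show "norm (indicator {..Y} y :: real) \<le> C * y powr (- 2 * \<alpha> - 3)" if y: "1 < y" for y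
    proof (cases "y \<le> Y")
      case True
      have "1 = y powr (2 * \<alpha> + 3) * y powr (- 2 * \<alpha> - 3)" using y by (simp add: powr_add[symmetric])
      also have "\<dots> \<le> C * y powr (- 2 * \<alpha> - 3)"
        using True y \<alpha> by (intro mult_right_mono) (auto simp: C_def intro!: max.coboundedI2 powr_mono2)
      finally show ?thesis using True by simp
    qed (auto simp: C_def intro!: mult_nonneg_nonneg)
  qed (auto simp: C_def indicator_def)
qed

lemma L2_integrable_bounded_set:
  assumes \<alpha>: "\<alpha> > -1" and u: "u \<in> L2 \<alpha>"
  shows "integrable (mu \<alpha>) (\<lambda>y. indicator {..Y} y * norm (u y))"
proof -
  have [measurable]: "u \<in> borel_measurable (mu \<alpha>)" and u2: "integrable (mu \<alpha>) (\<lambda>y. (norm (u y))\<^sup>2)"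
    using u by (auto simp: L2_def)
  have "integrable (mu \<alpha>) (\<lambda>y. indicator {..Y} y + (norm (u y))\<^sup>2)"
    using integrable_mu_indicator_atMost[OF \<alpha>] u2 by (rule Bochner_Integration.integrable_add)
  then show ?thesis
  proof (rule Bochner_Integration.integrable_bound)
    have "norm (u y) \<le> 1 + (norm (u y))\<^sup>2" for y
    proof (cases "norm (u y) \<le> 1")
      case False
      then have "norm (u y) * 1 \<le> norm (u y) * norm (u y)" by (intro mult_left_mono) auto
      then show ?thesis by (simp add: power2_eq_square)
    qed (auto intro: order.trans[of _ 1])
    then show "AE y in mu \<alpha>. norm (indicator {..Y} y * norm (u y)) \<le> norm (indicator {..Y} y + (norm (u y))\<^sup>2)"
      by (intro AE_I2) (auto simp: indicator_def)
  qed measurable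
qed

text \<open>The tail estimate supplies a majorant of \<open>q\<^sub>\<alpha> (x y) * u y\<close> for large \<open>y\<close> that is the same for all \<open>x\<close>
  in a compact interval; for bounded \<open>y\<close> square integrability of \<open>u\<close> does. This is the hypothesis
  of Fubini's theorem for the pairing with an indicator.\<close>

lemma hankel_core_integrable_pair:
  assumes \<alpha>: "\<alpha> > -1" and u: "u \<in> hankel_core \<alpha>" and ab: "0 < a" "a < b"
  shows "integrable (mu \<alpha> \<Otimes>\<^sub>M mu \<alpha>) (\<lambda>(x, y). of_real (indicator {a..b} x * q \<alpha> (x * y)) * u y)"
proof -
  have uL: "u \<in> L2 \<alpha>" and [measurable]: "u \<in> borel_measurable (mu \<alpha>)"
    using u by (auto simp: hankel_core_def L2_def)
  obtain Y where Y: "Y \<ge> 1" "integrable (mu \<alpha>) (\<lambda>y. indicator {Y..} y * (y powr (- \<alpha> - 1 / 2) * norm (u y)))"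
    using hankel_core_tail_integrable[OF \<alpha> u] by blast
  obtain B where B: "B > 0" "\<And>s. 0 < s \<Longrightarrow> s \<le> b * Y \<Longrightarrow> \<bar>q \<alpha> s\<bar> \<le> B"
    using bessel_quot_bounded_near_0 by metis
  obtain D where D: "D > 0" "\<And>s. s \<ge> a * Y \<Longrightarrow> \<bar>q \<alpha> s\<bar> \<le> D * s powr (- \<alpha> - 1 / 2)"
    using bessel_quot_decay[OF \<alpha>, of "a * Y"] ab Y by auto
  define M where "M = a powr (- \<alpha> - 1 / 2) + b powr (- \<alpha> - 1 / 2)"
  define g where "g = (\<lambda>y. B * (indicator {..Y} y * norm (u y)) + D * M * (indicator {Y..} y * (y powr (- \<alpha> - 1 / 2) * norm (u y))))"
  have g: "integrable (mu \<alpha>) g"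
    unfolding g_def using Y L2_integrable_bounded_set[OF \<alpha> uL] by (intro Bochner_Integration.integrable_add integrable_mult_right)
  have ind: "integrable (mu \<alpha>) (indicator {a..b} :: real \<Rightarrow> real)"
    by (rule integrable_mu_indicator[OF ab(1)])
  have "integrable (mu \<alpha> \<Otimes>\<^sub>M mu \<alpha>) (\<lambda>p. indicator {a..b} (fst p) * g (snd p))"
    by (rule integrable_pair_times[OF pair_sigma_finite_mu ind g])
  then show ?thesis
  proof (rule Bochner_Integration.integrable_bound)
    show "AE p in mu \<alpha> \<Otimes>\<^sub>M mu \<alpha>. norm (case p of (x, y) \<Rightarrow> of_real (indicator {a..b} x * q \<alpha> (x * y)) * u y)
       \<le> norm (indicator {a..b} (fst p) * g (snd p))"
    proof (rule AE_I2)
      fix p assume "p \<in> space (mu \<alpha> \<Otimes>\<^sub>M mu \<alpha>)"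
      then obtain x y where p: "p = (x, y)" "x > 0" "y > 0" by (auto simp: space_pair_measure)
      have "\<bar>q \<alpha> (x * y)\<bar> * norm (u y) \<le> g y" if x: "a \<le> x" "x \<le> b"
      proof (cases "y \<le> Y")
        case True
        have "x * y \<le> b * Y" using x p True ab by (intro mult_mono) auto
        then have "\<bar>q \<alpha> (x * y)\<bar> * norm (u y) \<le> B * norm (u y)"
          using p B by (intro mult_right_mono) auto
        also have "\<dots> \<le> g y" unfolding g_def using True D by (auto simp: M_def)
        finally show ?thesis .
      next
        case False
        have "a * Y \<le> x * y" using x p False ab Y by (intro mult_mono) auto
        then have "\<bar>q \<alpha> (x * y)\<bar> \<le> D * (x powr (- \<alpha> - 1 / 2) * y powr (- \<alpha> - 1 / 2))"
          using D(2)[of "x * y"] p by (simp add: powr_mult)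
        also have "\<dots> \<le> D * (M * y powr (- \<alpha> - 1 / 2))"
        proof -
          have "x powr (- \<alpha> - 1 / 2) \<le> M"
          proof (cases "- \<alpha> - 1 / 2 \<ge> 0")
            case True
            then have "x powr (- \<alpha> - 1 / 2) \<le> b powr (- \<alpha> - 1 / 2)" using x p by (intro powr_mono2) auto
            then show ?thesis by (auto simp: M_def add_increasing)
          next
            case False
            then have "x powr (- \<alpha> - 1 / 2) \<le> a powr (- \<alpha> - 1 / 2)" using x ab by (intro powr_mono2') auto
            then show ?thesis by (auto simp: M_def add_increasing2)
          qed
          then show ?thesis using D by (intro mult_left_mono mult_right_mono) auto
        qed
        finally have "\<bar>q \<alpha> (x * y)\<bar> * norm (u y) \<le> D * (M * y powr (- \<alpha> - 1 / 2)) * norm (u y)"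
          by (rule mult_right_mono) simp
        also have "\<dots> = g y" unfolding g_def using False by simp
        finally show ?thesis .
      qed
      then show "norm (case p of (x, y) \<Rightarrow> of_real (indicator {a..b} x * q \<alpha> (x * y)) * u y)
       \<le> norm (indicator {a..b} (fst p) * g (snd p))"
        by (auto simp: p indicator_def norm_mult intro: order.trans[OF _ abs_ge_self])
    qed
  qed measurable
qed

text \<open>The Hankel transform of the indicator of \<open>{a..b}\<close>.\<close>

definition interval_hankel :: "real \<Rightarrow> real \<Rightarrow> real \<Rightarrow> real \<Rightarrow> real" where
  "interval_hankel \<alpha> a b y = (LINT x|mu \<alpha>. indicator {a..b} x * q \<alpha> (x * y))"

lemma interval_hankel_eq:
  assumes "0 < a" "a < b" "y > 0"
  shows "interval_hankel \<alpha> a b y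
    = b powr (2 * \<alpha> + 2) * q (\<alpha> + 1) (b * y) - a powr (2 * \<alpha> + 2) * q (\<alpha> + 1) (a * y)"
proof -
  define p where "p = (\<lambda>x. x powr (2 * \<alpha> + 2) * q (\<alpha> + 1) (y * x))"
  define p' where "p' = (\<lambda>x. x powr (2 * \<alpha> + 1) * q \<alpha> (y * x))"
  have "has_bochner_integral lborel (\<lambda>x. p' x * indicator {a..b} x) (p b - p a)"
  proof (rule has_bochner_integral_FTC_Icc_real)
    fix x assume x: "a \<le> x" "x \<le> b"
    show "(p has_real_derivative p' x) (at x)"
      unfolding p_def p'_def using x assms by (intro has_real_derivative_powr_bessel_quot_scaled) auto
    have "continuous_on {0<..} p'" unfolding p'_def using assms by (intro continuous_intros) auto
    then show "isCont p' x" using x assms by (auto simp: continuous_on_eq_continuous_at)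
  qed (use assms in simp)
  then have "p b - p a = (LINT x|lborel. p' x * indicator {a..b} x)"
    by (simp add: has_bochner_integral_iff)
  also have "\<dots> = interval_hankel \<alpha> a b y"
    unfolding interval_hankel_def set_lebesgue_integral_def
    using assms(1) by (subst integral_mu) (auto simp: set_lebesgue_integral_def p'_def indicator_def mult.commute intro!: Bochner_Integration.integral_cong)
  finally show ?thesis by (simp add: p_def mult.commute)
qed

text \<open>Each boundary term is bounded and is \<open>O(y powr (- \<alpha> - 3/2))\<close>; the square of the latter against
  \<open>y powr (2 \<alpha> + 1)\<close> is \<open>y powr -2\<close>.\<close>

lemma interval_hankel_square_integrable:
  assumes \<alpha>: "\<alpha> > -1" and ab: "0 < a" "a < b"
  shows "interval_hankel \<alpha> a b \<in> borel_measurable (mu \<nu>)"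
    and "integrable (mu \<alpha>) (\<lambda>y. (interval_hankel \<alpha> a b y)\<^sup>2)"
proof -
  obtain C where C: "C > 0" "\<And>s. s > 0 \<Longrightarrow> \<bar>q (\<alpha> + 1) s\<bar> \<le> C"
    "\<And>s. s > 0 \<Longrightarrow> \<bar>q (\<alpha> + 1) s\<bar> \<le> C * s powr (- (\<alpha> + 1) - 1 / 2)"
    using bessel_quot_bound[of "\<alpha> + 1"] \<alpha> by auto
  show m [measurable]: "interval_hankel \<alpha> a b \<in> borel_measurable (mu \<nu>)" for \<nu>
  proof (rule borel_measurable_mu_continuous)
    have "continuous_on {0<..} (\<lambda>y. b powr (2 * \<alpha> + 2) * q (\<alpha> + 1) (b * y) - a powr (2 * \<alpha> + 2) * q (\<alpha> + 1) (a * y))"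
      using ab by (intro continuous_intros) auto
    then show "continuous_on {0<..} (interval_hankel \<alpha> a b)"
      by (rule continuous_on_cong[THEN iffD1, rotated -1]) (use interval_hankel_eq[OF ab] in auto)
  qed
  define D where "D = C * (b powr (2 * \<alpha> + 2) * (1 + b powr (- (\<alpha> + 1) - 1 / 2)) + a powr (2 * \<alpha> + 2) * (1 + a powr (- (\<alpha> + 1) - 1 / 2)))"
  have D0: "D \<ge> 0" using C by (auto simp: D_def intro!: mult_nonneg_nonneg add_nonneg_nonneg)
  have bound: "\<bar>interval_hankel \<alpha> a b y\<bar> \<le> D * w" if y: "y > 0" and w: "w = 1 \<or> w = y powr (- (\<alpha> + 1) - 1 / 2)" for y w
  proof -
    have *: "\<bar>c powr (2 * \<alpha> + 2) * q (\<alpha> + 1) (c * y)\<bar> \<le> C * (c powr (2 * \<alpha> + 2) * (1 + c powr (- (\<alpha> + 1) - 1 / 2))) * w"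
      if c: "c > 0" for c
    proof -
      have "C * 1 * w \<le> C * (1 + c powr (- (\<alpha> + 1) - 1 / 2)) * w"
        "C * c powr (- (\<alpha> + 1) - 1 / 2) * w \<le> C * (1 + c powr (- (\<alpha> + 1) - 1 / 2)) * w"
        using C w by (intro mult_right_mono mult_left_mono; auto)+
      then have "\<bar>q (\<alpha> + 1) (c * y)\<bar> \<le> C * (1 + c powr (- (\<alpha> + 1) - 1 / 2)) * w"
        using w C(2)[of "c * y"] C(3)[of "c * y"] c y by (auto simp: powr_mult mult.assoc)
      from mult_left_mono[OF this, of "c powr (2 * \<alpha> + 2)"] show ?thesis by (simp add: abs_mult mult_ac)
    qed
    have "\<bar>interval_hankel \<alpha> a b y\<bar> \<le> \<bar>b powr (2 * \<alpha> + 2) * q (\<alpha> + 1) (b * y)\<bar> + \<bar>a powr (2 * \<alpha> + 2) * q (\<alpha> + 1) (a * y)\<bar>"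
      unfolding interval_hankel_eq[OF ab y] by (rule abs_triangle_ineq4)
    also have "\<dots> \<le> D * w"
      using *[of b] *[of a] ab unfolding D_def by (simp add: distrib_left distrib_right)
    finally show ?thesis .
  qed
  have square: "norm ((interval_hankel \<alpha> a b y)\<^sup>2) \<le> D\<^sup>2 * (w * w)"
    if "y > 0" "w = 1 \<or> w = y powr (- (\<alpha> + 1) - 1 / 2)" for y w
    using power_mono[OF bound[OF that] abs_ge_zero, of 2] by (simp add: power2_eq_square mult_ac)
  have e: "- 2 * \<alpha> - 3 = (- (\<alpha> + 1) - 1 / 2) + (- (\<alpha> + 1) - 1 / 2)" by simp
  show "integrable (mu \<alpha>) (\<lambda>y. (interval_hankel \<alpha> a b y)\<^sup>2)"
    using square[of _ 1] square unfolding e powr_add by (intro integrable_mu_comparison[OF \<alpha>, of _ "D\<^sup>2", unfolded e powr_add]) auto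
qed

lemma integral_interval_hankel:
  assumes \<alpha>: "\<alpha> > -1" and u: "u \<in> hankel_core \<alpha>" and ab: "0 < a" "a < b"
  shows "(LINT x|mu \<alpha>. of_real (indicator {a..b} x) * hankel \<alpha> u x)
    = (LINT y|mu \<alpha>. of_real (interval_hankel \<alpha> a b y) * u y)"
proof -
  interpret pair_sigma_finite "mu \<alpha>" "mu \<alpha>" by (rule pair_sigma_finite_mu)
  have "(LINT y|mu \<alpha>. LINT x|mu \<alpha>. of_real (indicator {a..b} x * q \<alpha> (x * y)) * u y)
      = (LINT x|mu \<alpha>. LINT y|mu \<alpha>. of_real (indicator {a..b} x * q \<alpha> (x * y)) * u y)"
    by (rule Fubini_integral[OF hankel_core_integrable_pair[OF \<alpha> u ab]])
  also have "\<dots> = (LINT x|mu \<alpha>. of_real (indicator {a..b} x) * hankel \<alpha> u x)"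
    unfolding hankel_def by (simp add: mult.assoc)
  finally show ?thesis
    unfolding interval_hankel_def by (simp del: of_real_mult)
qed

text \<open>Weak convergence. The difference of the pairings is at most \<open>r * K + d n / r\<close> for every \<open>r > 0\<close>, where
  \<open>d n\<close> is the squared distance; a small \<open>r\<close> is chosen before \<open>n\<close>.\<close>

lemma L2_tendsto_integral:
  assumes u: "\<And>n. u n \<in> L2 \<alpha>" and f: "f \<in> L2 \<alpha>" and lim: "L2_tendsto \<alpha> u f"
    and k [measurable]: "k \<in> borel_measurable (mu \<alpha>)" and k2: "integrable (mu \<alpha>) (\<lambda>y. (k y)\<^sup>2)"
  shows "(\<lambda>n. LINT y|mu \<alpha>. of_real (k y) * u n y) \<longlonglongrightarrow> (LINT y|mu \<alpha>. of_real (k y) * f y)"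
    and "integrable (mu \<alpha>) (\<lambda>y. of_real (k y) * f y)"
proof -
  have um [measurable]: "u n \<in> borel_measurable (mu \<alpha>)" and fm [measurable]: "f \<in> borel_measurable (mu \<alpha>)" for n
    using u f by (auto simp: L2_def)
  have u2: "integrable (mu \<alpha>) (\<lambda>y. (norm (u n y))\<^sup>2)" and f2: "integrable (mu \<alpha>) (\<lambda>y. (norm (f y))\<^sup>2)" for n
    using u f by (auto simp: L2_def)
  have prod: "integrable (mu \<alpha>) (\<lambda>y. of_real (k y) * h y)" if "integrable (mu \<alpha>) (\<lambda>y. (norm (h y))\<^sup>2)"
    and [measurable]: "h \<in> borel_measurable (mu \<alpha>)" for h :: "real \<Rightarrow> complex"
  proof -
    have "integrable (mu \<alpha>) (\<lambda>y. (k y)\<^sup>2 + (norm (h y))\<^sup>2)" using that k2 by (intro Bochner_Integration.integrable_add)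
    then show ?thesis
    proof (rule Bochner_Integration.integrable_bound)
      have "\<bar>k y\<bar> * norm (h y) \<le> (k y)\<^sup>2 + (norm (h y))\<^sup>2" for y
        using sum_squares_bound[of "\<bar>k y\<bar>" "norm (h y)"] mult_nonneg_nonneg[OF abs_ge_zero norm_ge_zero, of "k y" "h y"]
        unfolding power2_abs by linarith
      then show "AE y in mu \<alpha>. norm (of_real (k y) * h y) \<le> norm ((k y)\<^sup>2 + (norm (h y))\<^sup>2)"
        by (intro AE_I2) (simp add: norm_mult)
    qed measurable
  qed
  show "integrable (mu \<alpha>) (\<lambda>y. of_real (k y) * f y)" by (rule prod[OF f2 fm])
  have d2: "integrable (mu \<alpha>) (\<lambda>y. (norm (u n y - f y))\<^sup>2)" for n
  proof -
    have "integrable (mu \<alpha>) (\<lambda>y. 2 * (norm (u n y))\<^sup>2 + 2 * (norm (f y))\<^sup>2)"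
      using u2 f2 by (intro Bochner_Integration.integrable_add integrable_mult_right)
    then show ?thesis
    proof (rule Bochner_Integration.integrable_bound)
      have "(norm (u n y - f y))\<^sup>2 \<le> 2 * (norm (u n y))\<^sup>2 + 2 * (norm (f y))\<^sup>2" for y
      proof -
        have "(norm (u n y - f y))\<^sup>2 \<le> (norm (u n y) + norm (f y))\<^sup>2"
          by (intro power_mono norm_triangle_ineq4) auto
        also have "\<dots> \<le> 2 * (norm (u n y))\<^sup>2 + 2 * (norm (f y))\<^sup>2"
          using sum_squares_bound[of "norm (u n y)" "norm (f y)"] by (simp add: power2_sum)
        finally show ?thesis .
      qed
      then show "AE y in mu \<alpha>. norm ((norm (u n y - f y))\<^sup>2) \<le> norm (2 * (norm (u n y))\<^sup>2 + 2 * (norm (f y))\<^sup>2)"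
        by (intro AE_I2) simp
    qed measurable
  qed
  define K where "K = (LINT y|mu \<alpha>. (k y)\<^sup>2)"
  define d where "d = (\<lambda>n. LINT y|mu \<alpha>. (norm (u n y - f y))\<^sup>2)"
  have K: "K \<ge> 0" unfolding K_def by simp
  have d: "d \<longlonglongrightarrow> 0" using lim by (simp add: L2_tendsto_def d_def)
  \<comment> \<open>The weighted inequality \<open>a b \<le> r a\<^sup>2 + b\<^sup>2 / r\<close>, integrated.\<close>
  have est: "norm ((LINT y|mu \<alpha>. of_real (k y) * u n y) - (LINT y|mu \<alpha>. of_real (k y) * f y)) \<le> r * K + d n / r"
    if r: "r > 0" for n r
  proof -
    have "(LINT y|mu \<alpha>. of_real (k y) * u n y) - (LINT y|mu \<alpha>. of_real (k y) * f y)
       = (LINT y|mu \<alpha>. of_real (k y) * (u n y - f y))"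
      using prod[OF u2 um] prod[OF f2 fm] by (simp add: right_diff_distrib)
    also have "norm \<dots> \<le> (LINT y|mu \<alpha>. r * (k y)\<^sup>2 + (norm (u n y - f y))\<^sup>2 / r)"
    proof (rule Bochner_Integration.integral_norm_bound_integral)
      show "integrable (mu \<alpha>) (\<lambda>y. of_real (k y) * (u n y - f y))"
        by (rule prod[OF d2]) measurable
      show "integrable (mu \<alpha>) (\<lambda>y. r * (k y)\<^sup>2 + (norm (u n y - f y))\<^sup>2 / r)"
        using k2 d2 by (intro Bochner_Integration.integrable_add integrable_mult_right integrable_divide)
      show "norm (of_real (k y) * (u n y - f y)) \<le> r * (k y)\<^sup>2 + (norm (u n y - f y))\<^sup>2 / r" for y
      proof -
        define e where "e = norm (u n y - f y)"
        have "\<bar>k y\<bar> * e * r \<le> (r * \<bar>k y\<bar>)\<^sup>2 + e\<^sup>2"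
        proof -
          have "0 \<le> \<bar>k y\<bar> * e * r" using r by (simp add: e_def)
          then show ?thesis using sum_squares_bound[of "r * \<bar>k y\<bar>" e] by (simp add: mult_ac)
        qed
        then have "\<bar>k y\<bar> * e * r / r \<le> ((r * \<bar>k y\<bar>)\<^sup>2 + e\<^sup>2) / r" using r by (intro divide_right_mono) auto
        also have "\<dots> = r * (k y)\<^sup>2 + e\<^sup>2 / r" using r by (simp add: power2_eq_square field_simps)
        finally show ?thesis using r by (simp add: norm_mult e_def)
      qed
    qed
    also have "\<dots> = r * K + d n / r"
      using k2 d2 by (subst Bochner_Integration.integral_add) (auto simp: K_def d_def)
    finally show ?thesis .
  qed
  show "(\<lambda>n. LINT y|mu \<alpha>. of_real (k y) * u n y) \<longlonglongrightarrow> (LINT y|mu \<alpha>. of_real (k y) * f y)"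
  proof (rule metric_LIMSEQ_I)
    fix e :: real assume e: "e > 0"
    define r where "r = e / (2 * (K + 1))"
    have r: "r > 0" using e K by (simp add: r_def)
    have "r * K \<le> e / 2"
      using e K by (simp add: r_def field_simps)
    have "eventually (\<lambda>n. d n < r * e / 2) sequentially"
      using r e by (intro order_tendstoD(2)[OF d]) auto
    then obtain N where N: "\<And>n. n \<ge> N \<Longrightarrow> d n < r * e / 2" by (auto simp: eventually_sequentially)
    have "dist (LINT y|mu \<alpha>. of_real (k y) * u n y) (LINT y|mu \<alpha>. of_real (k y) * f y) < e" if "n \<ge> N" for n
    proof -
      have "d n / r < e / 2" using N[OF that] r by (simp add: field_simps)
      then show ?thesis using est[OF r, of n] \<open>r * K \<le> e / 2\<close> unfolding dist_norm by linarith
    qed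
    then show "\<exists>no. \<forall>n\<ge>no. dist (LINT y|mu \<alpha>. of_real (k y) * u n y) (LINT y|mu \<alpha>. of_real (k y) * f y) < e" by blast
  qed
qed

text \<open>The integral of \<open>g\<close> over \<open>{a..b}\<close> is the integral of \<open>f\<close> against the Hankel transform of the
  indicator: the identity holds for core functions and passes to the limit on both sides. So
  \<open>f\<close> determines all these integrals, and with them \<open>g\<close> almost everywhere.\<close>

lemma hankel_L2_graph_unique:
  assumes \<alpha>: "\<alpha> > -1" and g1: "hankel_L2_graph \<alpha> f g1" and g2: "hankel_L2_graph \<alpha> f g2"
  shows "AE x in mu \<alpha>. g1 x = g2 x"
proof -
  have pairing: "integrable (mu \<alpha>) (\<lambda>x. of_real (indicator {a..b} x) * g x)
     \<and> (LINT x|mu \<alpha>. of_real (indicator {a..b} x) * g x) = (LINT y|mu \<alpha>. of_real (interval_hankel \<alpha> a b y) * f y)"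
    if g: "hankel_L2_graph \<alpha> f g" and ab: "0 < a" "a < b" for g a b
  proof -
    obtain u where u: "\<And>n. u n \<in> hankel_core \<alpha>" "L2_tendsto \<alpha> u f" "L2_tendsto \<alpha> (\<lambda>n. hankel \<alpha> (u n)) g"
      and fg: "f \<in> L2 \<alpha>" "g \<in> L2 \<alpha>"
      using g unfolding hankel_L2_graph_def by blast
    have uL: "u n \<in> L2 \<alpha>" "hankel \<alpha> (u n) \<in> L2 \<alpha>" for n using u(1)[of n] by (auto simp: hankel_core_def)
    note ih = interval_hankel_square_integrable[OF \<alpha> ab]
    have "(\<lambda>n. LINT y|mu \<alpha>. of_real (interval_hankel \<alpha> a b y) * u n y) \<longlonglongrightarrow> (LINT y|mu \<alpha>. of_real (interval_hankel \<alpha> a b y) * f y)"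
      by (rule L2_tendsto_integral(1)[OF uL(1) fg(1) u(2) ih])
    moreover have i2: "integrable (mu \<alpha>) (\<lambda>x. (indicator {a..b} x :: real)\<^sup>2)"
    proof -
      have "integrable (mu \<alpha>) (indicator {a..b} :: real \<Rightarrow> real)"
        by (rule integrable_mu_indicator[OF ab(1)])
      moreover have "(\<lambda>x. (indicator {a..b} x :: real)\<^sup>2) = indicator {a..b}" by (auto simp: indicator_def)
      ultimately show ?thesis by simp
    qed
    have "(\<lambda>n. LINT x|mu \<alpha>. of_real (indicator {a..b} x) * hankel \<alpha> (u n) x) \<longlonglongrightarrow> (LINT x|mu \<alpha>. of_real (indicator {a..b} x) * g x)"
      by (rule L2_tendsto_integral(1)[OF uL(2) fg(2) u(3) _ i2]) measurable
    ultimately have "(LINT x|mu \<alpha>. of_real (indicator {a..b} x) * g x) = (LINT y|mu \<alpha>. of_real (interval_hankel \<alpha> a b y) * f y)"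
      unfolding integral_interval_hankel[OF \<alpha> u(1) ab] using LIMSEQ_unique by blast
    moreover have "integrable (mu \<alpha>) (\<lambda>x. of_real (indicator {a..b} x) * g x)"
      by (rule L2_tendsto_integral(2)[OF uL(2) fg(2) u(3) _ i2]) measurable
    ultimately show ?thesis by blast
  qed
  have m [measurable]: "g1 \<in> borel_measurable (mu \<alpha>)" "g2 \<in> borel_measurable (mu \<alpha>)"
    using g1 g2 by (auto simp: hankel_L2_graph_def L2_def)
  have i: "integrable (mu \<alpha>) (\<lambda>x. of_real (indicator {a..b} x) * (g1 x - g2 x))"
    and z: "(LINT x|mu \<alpha>. of_real (indicator {a..b} x) * (g1 x - g2 x)) = 0" if ab: "0 < a" "a < b" for a b
    using pairing[OF g1 ab] pairing[OF g2 ab] by (auto simp: right_diff_distrib)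
  have "AE x in mu \<alpha>. Re (g1 x - g2 x) = 0"
  proof (rule AE_mu_eq_0_if_interval_integrals_eq_0)
    fix a b :: real assume ab: "0 < a" "a < b"
    have e: "indicator {a..b} x * Re (g1 x - g2 x) = Re (of_real (indicator {a..b} x) * (g1 x - g2 x))" for x by simp
    show "integrable (mu \<alpha>) (\<lambda>x. indicator {a..b} x * Re (g1 x - g2 x))"
      unfolding e using i[OF ab] by (rule integrable_Re)
    show "(LINT x|mu \<alpha>. indicator {a..b} x * Re (g1 x - g2 x)) = 0"
      unfolding e using z[OF ab] i[OF ab] by (subst integral_Re) auto
  qed measurable
  moreover have "AE x in mu \<alpha>. Im (g1 x - g2 x) = 0"
  proof (rule AE_mu_eq_0_if_interval_integrals_eq_0)
    fix a b :: real assume ab: "0 < a" "a < b"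
    have e: "indicator {a..b} x * Im (g1 x - g2 x) = Im (of_real (indicator {a..b} x) * (g1 x - g2 x))" for x by simp
    show "integrable (mu \<alpha>) (\<lambda>x. indicator {a..b} x * Im (g1 x - g2 x))"
      unfolding e using i[OF ab] by (rule integrable_Im)
    show "(LINT x|mu \<alpha>. indicator {a..b} x * Im (g1 x - g2 x)) = 0"
      unfolding e using z[OF ab] i[OF ab] by (subst integral_Im) auto
  qed measurable
  ultimately show ?thesis by eventually_elim (simp add: complex_eq_iff)
qed

section \<open>Hankel transforms of test functions\<close>

text \<open>Differentiability on \<open>{0<..}\<close> up to a given order, with the derivatives quantified
  existentially: a change outside \<open>{0<..}\<close> preserves the notion, and closure under sums and
  products is a plain induction.\<close>

primrec differentiable_times :: "nat \<Rightarrow> (real \<Rightarrow> complex) \<Rightarrow> bool" where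
  "differentiable_times 0 f \<longleftrightarrow> True"
| "differentiable_times (Suc n) f \<longleftrightarrow>
    (\<exists>f'. (\<forall>x>0. (f has_vector_derivative f' x) (at x)) \<and> differentiable_times n f')"

lemma differentiable_times_SucD: "differentiable_times (Suc n) f \<Longrightarrow> differentiable_times n f"
  by (induction n arbitrary: f) (simp, metis differentiable_times.simps(2))

lemma differentiable_times_cong:
  assumes "differentiable_times n f" "\<And>x. x > 0 \<Longrightarrow> f x = g x"
  shows "differentiable_times n g"
proof (cases n)
  case (Suc m)
  then obtain f' where f': "\<And>x. x > 0 \<Longrightarrow> (f has_vector_derivative f' x) (at x)" "differentiable_times m f'"
    using assms(1) by auto
  have "(g has_vector_derivative f' x) (at x)" if "x > 0" for x
    by (rule has_vector_derivative_transform_within_open[OF f'(1)[OF that], of "{0<..}"]) (use that assms(2) in auto)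
  then show ?thesis using f'(2) Suc by auto
qed simp

lemma differentiable_times_add:
  assumes "differentiable_times n f" "differentiable_times n g"
  shows "differentiable_times n (\<lambda>x. f x + g x)"
  using assms
proof (induction n arbitrary: f g)
  case (Suc n)
  then obtain f' g' where
    f': "\<And>x. x > 0 \<Longrightarrow> (f has_vector_derivative f' x) (at x)" "differentiable_times n f'" and
    g': "\<And>x. x > 0 \<Longrightarrow> (g has_vector_derivative g' x) (at x)" "differentiable_times n g'"
    by auto
  show ?case
    using Suc.IH[OF f'(2) g'(2)] f'(1) g'(1)
    by (auto intro!: exI[of _ "\<lambda>x. f' x + g' x"] has_vector_derivative_add)
qed simp

lemma differentiable_times_mult:
  assumes "differentiable_times n f" "differentiable_times n g"
  shows "differentiable_times n (\<lambda>x. f x * g x)"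
  using assms
proof (induction n arbitrary: f g)
  case (Suc n)
  then obtain f' g' where
    f': "\<And>x. x > 0 \<Longrightarrow> (f has_vector_derivative f' x) (at x)" "differentiable_times n f'" and
    g': "\<And>x. x > 0 \<Longrightarrow> (g has_vector_derivative g' x) (at x)" "differentiable_times n g'"
    by auto
  have fg: "differentiable_times n f" "differentiable_times n g"
    using Suc.prems by (auto dest: differentiable_times_SucD simp del: differentiable_times.simps)
  have "differentiable_times n (\<lambda>x. f x * g' x + f' x * g x)"
    by (intro differentiable_times_add Suc.IH f'(2) g'(2) fg)
  then show ?case
    using f'(1) g'(1) by (auto intro!: exI[of _ "\<lambda>x. f x * g' x + f' x * g x"] has_vector_derivative_mult)
qed simp

lemma differentiable_times_powr: "differentiable_times n (\<lambda>x. of_real (c * x powr p))"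
proof (induction n arbitrary: c p)
  case (Suc n)
  have "((\<lambda>x. complex_of_real (c * x powr p)) has_vector_derivative of_real (c * p * x powr (p - 1))) (at x)"
    if "x > 0" for x
  proof -
    have "((\<lambda>x. c * x powr p) has_real_derivative c * p * x powr (p - 1)) (at x)"
      using DERIV_cmult[OF has_real_derivative_powr[OF that]] by (simp add: mult.assoc)
    then show ?thesis
      by (intro has_vector_derivative_of_real) (simp add: has_real_derivative_iff_has_vector_derivative)
  qed
  then show ?case using Suc.IH[of "c * p" "p - 1"]
    by (auto intro!: exI[of _ "\<lambda>x. of_real (c * p * x powr (p - 1))"] simp del: of_real_mult)
qed simp

text \<open>Test functions, with an explicit interval around the support.\<close>

definition test_on :: "real \<Rightarrow> real \<Rightarrow> (real \<Rightarrow> complex) \<Rightarrow> bool" where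
  "test_on a b f \<longleftrightarrow> 0 < a \<and> a < b \<and> (\<forall>n. differentiable_times n f) \<and> (\<forall>x>0. x \<notin> {a..b} \<longrightarrow> f x = 0)"

lemma Cc_infinity_imp_test_on:
  assumes "f \<in> Cc_infinity" shows "\<exists>a b. test_on a b f"
proof -
  define D where "D = (\<lambda>g y. vector_derivative (g :: real \<Rightarrow> complex) (at y))"
  have diff: "(D ^^ k) f differentiable (at x)" if "x > 0" for k x
    using assms that unfolding Cc_infinity_def D_def by blast
  have "differentiable_times n ((D ^^ k) f)" for n k
  proof (induction n arbitrary: k)
    case (Suc n)
    have "((D ^^ k) f has_vector_derivative (D ^^ Suc k) f x) (at x)" if "x > 0" for x
      using diff[OF that, of k] by (simp add: D_def vector_derivative_works)
    then show ?case using Suc.IH[of "Suc k"] by auto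
  qed simp
  from this[of _ 0] have smooth: "differentiable_times n f" for n by simp
  obtain K where K: "compact K" "K \<subseteq> {0<..}" "\<And>x. x > 0 \<Longrightarrow> x \<notin> K \<Longrightarrow> f x = 0"
    using assms unfolding Cc_infinity_def by blast
  have "\<exists>a b. 0 < a \<and> a < b \<and> K \<subseteq> {a..b}"
  proof (cases "K = {}")
    case True
    then show ?thesis by (intro exI[of _ 1] exI[of _ 2]) auto
  next
    case False
    obtain m where m: "m \<in> K" "\<And>x. x \<in> K \<Longrightarrow> m \<le> x" using compact_attains_inf[OF K(1) False] by blast
    obtain M where M: "M \<in> K" "\<And>x. x \<in> K \<Longrightarrow> x \<le> M" using compact_attains_sup[OF K(1) False] by blast
    show ?thesis using m M K(2) by (intro exI[of _ m] exI[of _ "M + 1"]) (force intro: add_increasing2 less_le_trans)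
  qed
  then obtain a b where "0 < a" "a < b" "K \<subseteq> {a..b}" by blast
  then have "test_on a b f" using smooth K(3) unfolding test_on_def by blast
  then show ?thesis by blast
qed

lemma test_on_continuous:
  assumes "test_on a b f" shows "continuous_on {0<..} f"
proof -
  have "differentiable_times 1 f" using assms by (auto simp: test_on_def simp del: One_nat_def)
  then show ?thesis
    by (auto simp: continuous_on_eq_continuous_at intro: has_vector_derivative_continuous)
qed

lemma test_on_measurable:
  assumes "test_on a b f" shows "f \<in> borel_measurable (mu \<alpha>)"
  using assms by (intro borel_measurable_mu_continuous test_on_continuous)

lemma test_on_rapid:
  assumes "test_on a b f" shows "rapid_decay f"
  unfolding rapid_decay_def
proof
  fix N
  have ab: "0 < a" "a < b" using assms by (auto simp: test_on_def)
  have "continuous_on {a..b} f"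
    by (rule continuous_on_subset[OF test_on_continuous[OF assms]]) (use ab in auto)
  then have "bounded (f ` {a..b})" by (intro compact_imp_bounded compact_continuous_image) auto
  then obtain B where B: "B > 0" "\<And>x. x \<in> {a..b} \<Longrightarrow> norm (f x) \<le> B" unfolding bounded_pos by auto
  have "(1 + y) ^ N * norm (f y) \<le> (1 + b) ^ N * B" if "y > 0" for y
  proof (cases "y \<in> {a..b}")
    case True
    then show ?thesis using B that by (intro mult_mono power_mono) auto
  next
    case False
    then have "f y = 0" using assms that by (auto simp: test_on_def)
    then show ?thesis using B ab by simp
  qed
  then show "\<exists>C. \<forall>y>0. (1 + y) ^ N * norm (f y) \<le> C" by blast
qed

text \<open>Test functions are closed under \<open>(1 / x) d/dx\<close>, the operation which the integration by parts
  produces.\<close>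

lemma test_on_derivative:
  assumes f: "test_on a b f"
  shows "\<exists>f'. (\<forall>x>0. (f has_vector_derivative f' x) (at x)) \<and> continuous_on {0<..} f' \<and>
    test_on a b (\<lambda>x. f' x / of_real x)"
proof -
  define f' where "f' = (\<lambda>x. vector_derivative f (at x))"
  have "differentiable_times (Suc n) f" for n using f by (auto simp: test_on_def simp del: differentiable_times.simps)
  then have ex: "\<exists>g. (\<forall>x>0. (f has_vector_derivative g x) (at x)) \<and> differentiable_times n g" for n by simp
  have df: "(f has_vector_derivative f' x) (at x)" if "x > 0" for x
    using ex[of 0] that unfolding f'_def by (metis vector_derivative_at)
  have sm: "differentiable_times n f'" for n
  proof -
    obtain g where g: "\<And>x. x > 0 \<Longrightarrow> (f has_vector_derivative g x) (at x)" "differentiable_times n g"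
      using ex by blast
    have "g x = f' x" if "x > 0" for x
      using g(1)[OF that] by (simp add: f'_def vector_derivative_at)
    then show ?thesis using differentiable_times_cong[OF g(2)] by blast
  qed
  have "continuous_on {0<..} f'"
    using sm[of 1] by (auto simp: continuous_on_eq_continuous_at intro: has_vector_derivative_continuous)
  moreover have "test_on a b (\<lambda>x. f' x / of_real x)"
    unfolding test_on_def
  proof (intro conjI allI impI)
    fix n
    have "differentiable_times n (\<lambda>x. f' x * of_real (1 * x powr (-1)))"
      by (intro differentiable_times_mult sm differentiable_times_powr)
    then show "differentiable_times n (\<lambda>x. f' x / of_real x)"
      by (rule differentiable_times_cong) (simp add: powr_minus field_simps)
  next
    fix x :: real assume x: "x > 0" "x \<notin> {a..b}"
    have "(f has_vector_derivative 0) (at x)"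
    proof (rule has_vector_derivative_transform_within_open[of "\<lambda>x. 0" _ _ "{0<..} - {a..b}"])
      show "open ({0<..} - {a..b})" by (intro open_Diff) auto
      show "0 = f y" if "y \<in> {0<..} - {a..b}" for y using f that by (auto simp: test_on_def)
    qed (use x in auto)
    then show "f' x / of_real x = 0" by (simp add: f'_def vector_derivative_at)
  qed (use f in \<open>auto simp: test_on_def\<close>)
  ultimately show ?thesis using df by blast
qed

lemma test_on_hankel_shift:
  assumes "test_on a b f" "\<alpha> > -1"
  shows "\<exists>g. test_on a b g \<and> (\<forall>x>0. norm (hankel \<alpha> f x) = norm (hankel (\<alpha> + real k) g x))"
  using assms
proof (induction k arbitrary: f \<alpha>)
  case (Suc k)
  obtain f' where f': "\<And>x. x > 0 \<Longrightarrow> (f has_vector_derivative f' x) (at x)" "continuous_on {0<..} f'"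
    "test_on a b (\<lambda>x. f' x / of_real x)"
    using test_on_derivative[OF Suc.prems(1)] by blast
  obtain g where g: "test_on a b g"
    "\<And>x. x > 0 \<Longrightarrow> norm (hankel (\<alpha> + 1) (\<lambda>x. f' x / of_real x) x) = norm (hankel (\<alpha> + 1 + real k) g x)"
    using Suc.IH[OF f'(3), of "\<alpha> + 1"] Suc.prems(2) by auto
  have "hankel \<alpha> f x = - hankel (\<alpha> + 1) (\<lambda>x. f' x / of_real x) x" if "x > 0" for x
    using f' Suc.prems that by (intro hankel_by_parts test_on_rapid) auto
  then show ?case using g by (intro exI[of _ g]) (auto simp: add_ac)
qed auto

text \<open>Integration by parts \<open>N + 1\<close> times raises the order to \<open>\<alpha> + N + 1 \<ge> -1/2\<close>, where the transform
  is \<open>O(x powr (- \<alpha> - N - 3/2))\<close>, and \<open>\<alpha> > -1\<close> makes this smaller than \<open>x powr -N\<close>.\<close>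

lemma test_on_hankel_rapid:
  assumes f: "test_on a b f" and \<alpha>: "\<alpha> > -1"
  shows "rapid_decay (hankel \<alpha> f)"
  unfolding rapid_decay_def
proof
  fix N
  obtain g where g: "test_on a b g" "\<And>x. x > 0 \<Longrightarrow> norm (hankel \<alpha> f x) = norm (hankel (\<alpha> + real (N + 1)) g x)"
    using test_on_hankel_shift[OF assms, of "N + 1"] by blast
  have \<nu>: "\<alpha> + real (N + 1) \<ge> - 1 / 2" using \<alpha> by simp
  obtain C where C: "\<And>x. x > 0 \<Longrightarrow> norm (hankel (\<alpha> + real (N + 1)) g x) \<le> C * x powr (- (\<alpha> + real (N + 1)) - 1 / 2)"
    using rapid_hankel_decay[OF \<nu> test_on_rapid[OF g(1)] test_on_measurable[OF g(1)]] by blast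
  obtain B where B: "\<And>x. 0 < x \<Longrightarrow> x \<le> 1 \<Longrightarrow> norm (hankel \<alpha> f x) \<le> B"
    using rapid_hankel_bounded_near_0[OF \<alpha> test_on_rapid[OF f] test_on_measurable[OF f]] by blast
  have B0: "B \<ge> 0" using B[of 1] norm_ge_zero[of "hankel \<alpha> f 1"] by linarith
  have C0: "C \<ge> 0" using C[of 1] norm_ge_zero[of "hankel (\<alpha> + real (N + 1)) g 1"]
    by (simp add: order.trans[OF norm_ge_zero])
  have "(1 + y) ^ N * norm (hankel \<alpha> f y) \<le> 2 ^ N * (B + C)" if y: "y > 0" for y
  proof (cases "y \<le> 1")
    case True
    have "norm (hankel \<alpha> f y) \<le> B + C" using B[OF y True] C0 by simp
    then show ?thesis using True y by (intro mult_mono power_mono) auto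
  next
    case False
    have "norm (hankel \<alpha> f y) \<le> C * y powr (- (\<alpha> + real (N + 1)) - 1 / 2)" using g(2)[OF y] C[OF y] by simp
    also have "\<dots> \<le> (B + C) * y powr (- real N)"
      using False \<alpha> B0 C0 by (intro mult_mono powr_mono) auto
    finally have "(1 + y) ^ N * norm (hankel \<alpha> f y) \<le> (2 * y) ^ N * ((B + C) * y powr (- real N))"
      using False by (intro mult_mono power_mono) auto
    also have "\<dots> = 2 ^ N * (B + C)"
      using y by (simp add: powr_minus powr_realpow power_mult_distrib)
    finally show ?thesis .
  qed
  then show "\<exists>C. \<forall>y>0. (1 + y) ^ N * norm (hankel \<alpha> f y) \<le> C" by blast
qed

lemma test_on_hankel_eq_integral:
  assumes f: "test_on a b f" and y: "y > 0"
  shows "hankel \<alpha> f y = integral {a..b} (\<lambda>z. of_real (z powr (2 * \<alpha> + 1) * q \<alpha> (y * z)) * f z)"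
proof -
  have ab: "0 < a" "a < b" and 0: "\<And>x. x > 0 \<Longrightarrow> x \<notin> {a..b} \<Longrightarrow> f x = 0" using f by (auto simp: test_on_def)
  have [measurable]: "f \<in> borel_measurable (mu \<alpha>)" by (rule test_on_measurable[OF f])
  have mk: "(\<lambda>z. of_real (q \<alpha> (y * z)) * f z) \<in> borel_measurable (mu \<alpha>)" by measurable
  define F where "F = (\<lambda>z. of_real (z powr (2 * \<alpha> + 1) * q \<alpha> (y * z)) * f z)"
  have cf: "continuous_on {a..b} f"
    by (rule continuous_on_subset[OF test_on_continuous[OF f]]) (use ab in auto)
  have "continuous_on {a..b} F"
    unfolding F_def using ab y by (intro continuous_intros cf) auto
  then have si: "set_integrable lborel {a..b} F" by (rule borel_integrable_atLeastAtMost')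
  have e: "indicator {0<..} z *\<^sub>R (z powr (2 * \<alpha> + 1) *\<^sub>R (of_real (q \<alpha> (y * z)) * f z)) = indicator {a..b} z *\<^sub>R F z" for z
    using ab 0[of z] by (auto simp: F_def indicator_def scaleR_conv_of_real)
  have "hankel \<alpha> f y = integral {a..b} F"
    unfolding hankel_def integral_mu[OF mk] set_lebesgue_integral_def e
    using set_borel_integral_eq_integral(2)[OF si] by (simp add: set_lebesgue_integral_def)
  then show ?thesis by (simp add: F_def)
qed

text \<open>Differentiation under the integral sign over the compact support; the derivative of
  \<open>q\<^sub>\<alpha> (y z)\<close> in \<open>y\<close> is \<open>- y z\<^sup>2 q\<^bsub>\<alpha>+1\<^esub> (y z)\<close>, and \<open>z\<^sup>2\<close> turns the measure of order \<open>\<alpha>\<close> into that of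
  order \<open>\<alpha> + 1\<close>.\<close>

lemma test_on_hankel_derivative:
  assumes f: "test_on a b f" and y: "y > 0"
  shows "(hankel \<alpha> f has_vector_derivative - of_real y * hankel (\<alpha> + 1) f y) (at y)"
proof -
  have ab: "0 < a" "a < b" using f by (auto simp: test_on_def)
  define F where "F = (\<lambda>y z. of_real (z powr (2 * \<alpha> + 1) * q \<alpha> (y * z)) * f z)"
  define F' where "F' = (\<lambda>y z. of_real (z powr (2 * \<alpha> + 1) * (- (y * z) * q (\<alpha> + 1) (y * z) * z)) * f z)"
  have cf: "continuous_on {a..b} f"
    by (rule continuous_on_subset[OF test_on_continuous[OF f]]) (use ab in auto)
  have "((\<lambda>y. integral (cbox a b) (F y)) has_vector_derivative integral (cbox a b) (F' y)) (at y within {0<..})"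
  proof (rule leibniz_rule_vector_derivative)
    fix x z :: real assume xz: "x \<in> {0<..}" "z \<in> cbox a b"
    then have xz': "x * z > 0" using ab by auto
    have "((\<lambda>x. q \<alpha> (x * z)) has_real_derivative - (x * z) * q (\<alpha> + 1) (x * z) * z) (at x within {0<..})"
      by (rule DERIV_chain2[of "q \<alpha>" _ "\<lambda>x. x * z", OF has_real_derivative_bessel_quot[OF xz']])
        (auto intro!: derivative_eq_intros)
    from DERIV_cmult[OF this, of "z powr (2 * \<alpha> + 1)"]
    show "((\<lambda>x. F x z) has_vector_derivative F' x z) (at x within {0<..})"
      unfolding F_def F'_def
      by (intro has_vector_derivative_mult_left has_vector_derivative_of_real)
        (simp add: has_real_derivative_iff_has_vector_derivative)
  next
    fix x :: real assume x: "x \<in> {0<..}"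
    have "continuous_on {a..b} (F x)"
      unfolding F_def using x ab by (intro continuous_intros cf) auto
    then show "F x integrable_on cbox a b" by (simp add: integrable_continuous_real)
  next
    have "continuous_on ({0<..} \<times> {a..b}) (\<lambda>p. F' (fst p) (snd p))"
      unfolding F'_def using ab by (intro continuous_intros continuous_on_compose2[OF cf]) auto
    then show "continuous_on ({0<..} \<times> cbox a b) (\<lambda>(x, z). F' x z)" by (simp add: case_prod_beta')
  qed (use y in auto)
  then have "((\<lambda>y. integral {a..b} (F y)) has_vector_derivative integral {a..b} (F' y)) (at y)"
    using y by (simp add: at_within_open[of y "{0<..}"])
  moreover have "integral {a..b} (F' y) = - of_real y * hankel (\<alpha> + 1) f y"
  proof -
    have "integral {a..b} (F' y) = integral {a..b} (\<lambda>z. - of_real y * (of_real (z powr (2 * (\<alpha> + 1) + 1) * q (\<alpha> + 1) (y * z)) * f z))"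
    proof (rule integral_cong)
      fix z assume "z \<in> {a..b}"
      then have z: "z > 0" using ab by auto
      have e: "2 * (\<alpha> + 1) + 1 = (2 * \<alpha> + 1) + real 2" by simp
      have "z powr (2 * (\<alpha> + 1) + 1) = z powr (2 * \<alpha> + 1) * z\<^sup>2"
        unfolding e powr_add using z by (subst powr_realpow) auto
      then show "F' y z = - of_real y * (of_real (z powr (2 * (\<alpha> + 1) + 1) * q (\<alpha> + 1) (y * z)) * f z)"
        by (simp add: F'_def power2_eq_square)
    qed
    then show ?thesis using test_on_hankel_eq_integral[OF f y, of "\<alpha> + 1"] by (simp del: of_real_mult)
  qed
  ultimately have "((\<lambda>y. integral {a..b} (F y)) has_vector_derivative - of_real y * hankel (\<alpha> + 1) f y) (at y)" by simp
  then show ?thesis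
    by (rule has_vector_derivative_transform_within_open[of _ _ _ "{0<..}"])
      (use y test_on_hankel_eq_integral[OF f] in \<open>auto simp: F_def\<close>)
qed

lemma test_on_hankel_continuous: "test_on a b f \<Longrightarrow> continuous_on {0<..} (hankel \<alpha> f)"
  by (auto simp: continuous_on_eq_continuous_at
    intro!: has_vector_derivative_continuous[OF test_on_hankel_derivative])

lemma borel_measurable_hankel:
  assumes [measurable]: "f \<in> borel_measurable (mu \<alpha>)"
  shows "hankel \<alpha> f \<in> borel_measurable (mu \<nu>)"
proof -
  interpret sigma_finite_measure "mu \<alpha>" by (rule sigma_finite_mu)
  have "(\<lambda>(x, y). of_real (q \<alpha> (x * y)) * f y) \<in> borel_measurable (mu \<nu> \<Otimes>\<^sub>M mu \<alpha>)"
    by measurable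
  then show ?thesis
    unfolding hankel_def[abs_def] by (rule borel_measurable_lebesgue_integral)
qed

lemma test_on_in_hankel_core:
  assumes f: "test_on a b f" and \<alpha>: "\<alpha> > -1"
  shows "f \<in> hankel_core \<alpha>"
  unfolding hankel_core_def
  using rapid_L2[OF \<alpha> test_on_rapid[OF f] test_on_measurable[OF f]]
    rapid_hankel_integrable[OF \<alpha> test_on_rapid[OF f] test_on_measurable[OF f]]
    rapid_L2[OF \<alpha> test_on_hankel_rapid[OF f \<alpha>] borel_measurable_hankel[OF test_on_measurable[OF f]]]
  by auto

section \<open>The multiplier applied to a test function\<close>

definition filtered_hankel :: "real \<Rightarrow> real \<Rightarrow> real \<Rightarrow> (real \<Rightarrow> complex) \<Rightarrow> real \<Rightarrow> complex" where
  "filtered_hankel \<alpha> \<beta> t f y = of_real (multiplier \<alpha> \<beta> (t * y)) * hankel \<alpha> f y"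

lemma multiplier_bounded:
  assumes "\<alpha> + \<beta> > - 1 / 2"
  shows "\<exists>C. \<forall>s>0. \<bar>multiplier \<alpha> \<beta> s\<bar> \<le> C"
proof -
  obtain B where "\<And>s. s > 0 \<Longrightarrow> \<bar>q (\<alpha> + \<beta>) s\<bar> \<le> B"
    using bessel_quot_bound[of "\<alpha> + \<beta>"] assms by auto
  then show ?thesis
    unfolding multiplier_def abs_mult
    by (intro exI[of _ "\<bar>2 powr (\<alpha> + \<beta>)\<bar> * \<bar>Gamma (\<alpha> + \<beta> + 1)\<bar> * B"]) (auto intro!: mult_left_mono)
qed

lemma filtered_hankel_rapid:
  assumes "test_on a b f" "\<alpha> > -1" "\<alpha> + \<beta> > - 1 / 2" "t > 0"
  shows "rapid_decay (filtered_hankel \<alpha> \<beta> t f)"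
proof -
  obtain C where "\<And>s. s > 0 \<Longrightarrow> \<bar>multiplier \<alpha> \<beta> s\<bar> \<le> C" using multiplier_bounded assms(3) by blast
  then show ?thesis unfolding filtered_hankel_def[abs_def]
    using assms by (intro rapid_mult[of _ _ C 0] test_on_hankel_rapid) auto
qed

lemma filtered_hankel_continuous:
  assumes "test_on a b f" "t > 0"
  shows "continuous_on {0<..} (filtered_hankel \<alpha> \<beta> t f)"
  unfolding filtered_hankel_def[abs_def] multiplier_def
  using assms(2) by (intro continuous_intros test_on_hankel_continuous[OF assms(1)]) auto

text \<open>Only the square integrability of \<open>H\<^sub>\<alpha> h\<close> at infinity is delicate. Differentiating the multiplier
  and \<open>H\<^sub>\<alpha> f\<close> both gives a factor \<open>y\<close>, so \<open>h' / y\<close> is again rapidly decreasing, and one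
  integration by parts yields \<open>O(x powr (- \<alpha> - 3/2))\<close>, which is square integrable against
  \<open>x powr (2 \<alpha> + 1)\<close>.\<close>

lemma filtered_hankel_in_hankel_core:
  assumes f: "test_on a b f" and \<alpha>: "\<alpha> > -1" and \<beta>: "\<alpha> + \<beta> > - 1 / 2" and t: "t > 0"
  shows "filtered_hankel \<alpha> \<beta> t f \<in> hankel_core \<alpha>"
proof -
  define h where "h = filtered_hankel \<alpha> \<beta> t f"
  define c where "c = 2 powr (\<alpha> + \<beta>) * Gamma (\<alpha> + \<beta> + 1)"
  define m where "m = (\<lambda>y. multiplier \<alpha> \<beta> (t * y))"
  define m' where "m' = (\<lambda>y. - c * t\<^sup>2 * q (\<alpha> + \<beta> + 1) (t * y))"
  define h' where "h' = (\<lambda>y. of_real (m y) * (- of_real y * hankel (\<alpha> + 1) f y) + of_real (y * m' y) * hankel \<alpha> f y)"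
  have rh: "rapid_decay h" and ch: "continuous_on {0<..} h"
    unfolding h_def using filtered_hankel_rapid filtered_hankel_continuous assms by blast+
  have mh [measurable]: "h \<in> borel_measurable (mu \<alpha>)" by (rule borel_measurable_mu_continuous[OF ch])
  have dm: "(m has_real_derivative y * m' y) (at y)" if y: "y > 0" for y
  proof -
    have "((\<lambda>y. q (\<alpha> + \<beta>) (t * y)) has_real_derivative (- (t * y) * q (\<alpha> + \<beta> + 1) (t * y)) * t) (at y)"
      using y t by (intro DERIV_chain2[OF has_real_derivative_bessel_quot]) (auto intro!: derivative_eq_intros)
    from DERIV_cmult[OF this, of c] show ?thesis
      unfolding m_def multiplier_def c_def[symmetric] m'_def by (simp add: power2_eq_square mult_ac)
  qed
  have dh: "(h has_vector_derivative h' y) (at y)" if y: "y > 0" for y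
    unfolding h_def filtered_hankel_def[abs_def] h'_def m_def[symmetric]
    using test_on_hankel_derivative[OF f y, of \<alpha>] dm[OF y] unfolding m_def
    by (intro has_vector_derivative_mult has_vector_derivative_of_real)
      (simp_all add: has_real_derivative_iff_has_vector_derivative)
  have ch': "continuous_on {0<..} h'"
    unfolding h'_def m_def multiplier_def m'_def
    using t by (intro continuous_intros test_on_hankel_continuous[OF f]) auto
  have rh': "rapid_decay (\<lambda>y. h' y / of_real y)"
  proof -
    obtain B where B: "\<And>s. s > 0 \<Longrightarrow> \<bar>multiplier \<alpha> \<beta> s\<bar> \<le> B" using multiplier_bounded[OF \<beta>] by blast
    obtain Q where Q: "\<And>s. s > 0 \<Longrightarrow> \<bar>q (\<alpha> + \<beta> + 1) s\<bar> \<le> Q"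
      using bessel_quot_bound[of "\<alpha> + \<beta> + 1"] \<beta> by auto
    have "rapid_decay (\<lambda>y. - of_real (m y) * hankel (\<alpha> + 1) f y + of_real (m' y) * hankel \<alpha> f y)"
    proof (rule rapid_add)
      show "rapid_decay (\<lambda>y. - of_real (m y) * hankel (\<alpha> + 1) f y)"
        using \<alpha> B t by (intro rapid_mult[of _ _ B 0] test_on_hankel_rapid[OF f]) (auto simp: m_def)
      show "rapid_decay (\<lambda>y. of_real (m' y) * hankel \<alpha> f y)"
      proof (rule rapid_mult[of _ _ "\<bar>c\<bar> * t\<^sup>2 * Q" 0])
        show "norm (of_real (m' y) :: complex) \<le> \<bar>c\<bar> * t\<^sup>2 * Q * (1 + y) ^ 0" if "y > 0" for y
          using Q[of "t * y"] t that unfolding norm_of_real m'_def abs_mult by (auto intro!: mult_left_mono)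
      qed (rule test_on_hankel_rapid[OF f \<alpha>])
    qed
    moreover have "- of_real (m y) * hankel (\<alpha> + 1) f y + of_real (m' y) * hankel \<alpha> f y = h' y / of_real y" if "y > 0" for y
      using that by (simp add: h'_def field_simps)
    ultimately show ?thesis by (simp add: rapid_decay_def)
  qed
  have mh' [measurable]: "(\<lambda>y. h' y / of_real y) \<in> borel_measurable (mu \<nu>)" for \<nu>
    using ch' by (intro borel_measurable_mu_continuous continuous_intros) auto
  have parts: "hankel \<alpha> h x = - hankel (\<alpha> + 1) (\<lambda>y. h' y / of_real y) x" if "x > 0" for x
    by (rule hankel_by_parts[OF \<alpha> that dh ch' rh rh'])
  have \<alpha>1: "\<alpha> + 1 \<ge> - 1 / 2" using \<alpha> by simp
  obtain C where C: "\<And>x. x > 0 \<Longrightarrow> norm (hankel (\<alpha> + 1) (\<lambda>y. h' y / of_real y) x) \<le> C * x powr (- (\<alpha> + 1) - 1 / 2)"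
    using rapid_hankel_decay[OF \<alpha>1 rh' mh'] by blast
  obtain B where B: "\<And>x. 0 < x \<Longrightarrow> x \<le> 1 \<Longrightarrow> norm (hankel \<alpha> h x) \<le> B"
    using rapid_hankel_bounded_near_0[OF \<alpha> rh mh] by blast
  have mH [measurable]: "hankel \<alpha> h \<in> borel_measurable (mu \<alpha>)" by (rule borel_measurable_hankel[OF mh])
  have "integrable (mu \<alpha>) (\<lambda>x. (norm (hankel \<alpha> h x))\<^sup>2)"
  proof (rule integrable_mu_comparison[OF \<alpha>, of _ "B\<^sup>2 + C\<^sup>2"])
    show "norm ((norm (hankel \<alpha> h x))\<^sup>2) \<le> B\<^sup>2 + C\<^sup>2" if "0 < x" "x \<le> 1" for x
      using power_mono[OF B[OF that] norm_ge_zero, of 2] by (simp add: add_increasing2)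
    show "norm ((norm (hankel \<alpha> h x))\<^sup>2) \<le> (B\<^sup>2 + C\<^sup>2) * x powr (- 2 * \<alpha> - 3)" if x: "1 < x" for x
    proof -
      have e: "- 2 * \<alpha> - 3 = (- (\<alpha> + 1) - 1 / 2) + (- (\<alpha> + 1) - 1 / 2)" by simp
      have "(norm (hankel \<alpha> h x))\<^sup>2 \<le> (C * x powr (- (\<alpha> + 1) - 1 / 2))\<^sup>2"
        using C[of x] parts[of x] x by (intro power_mono) auto
      also have "\<dots> = C\<^sup>2 * x powr (- 2 * \<alpha> - 3)"
        unfolding e powr_add by (simp add: power2_eq_square mult_ac)
      also have "\<dots> \<le> (B\<^sup>2 + C\<^sup>2) * x powr (- 2 * \<alpha> - 3)" by (intro mult_right_mono) auto
      finally show ?thesis by simp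
    qed
  qed measurable
  then have "h \<in> hankel_core \<alpha>"
    unfolding hankel_core_def
    using rapid_L2[OF \<alpha> rh mh] rapid_hankel_integrable[OF \<alpha> rh mh] mH by (auto simp: L2_def)
  then show ?thesis by (simp add: h_def)
qed

lemma hankel_L2_graph_core:
  assumes u: "u \<in> hankel_core \<alpha>" and f: "f \<in> borel_measurable (mu \<alpha>)" and eq: "AE x in mu \<alpha>. u x = f x"
  shows "hankel_L2_graph \<alpha> f (hankel \<alpha> u)"
proof -
  have uL: "u \<in> L2 \<alpha>" "hankel \<alpha> u \<in> L2 \<alpha>" using u by (auto simp: hankel_core_def)
  have [measurable]: "u \<in> borel_measurable (mu \<alpha>)" "f \<in> borel_measurable (mu \<alpha>)" using uL f by (auto simp: L2_def)
  have "integrable (mu \<alpha>) (\<lambda>x. (norm (f x))\<^sup>2)"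
    by (rule integrable_cong_AE_imp[of _ "\<lambda>x. (norm (u x))\<^sup>2"]) (use uL eq in \<open>auto simp: L2_def elim: eventually_mono\<close>)
  then have "f \<in> L2 \<alpha>" by (simp add: L2_def f)
  moreover have "(LINT x|mu \<alpha>. (norm (u x - f x))\<^sup>2) = 0"
    using eq by (intro integral_eq_zero_AE) (auto elim: eventually_mono)
  ultimately show ?thesis
    unfolding hankel_L2_graph_def L2_tendsto_def using uL u by (intro conjI exI[of _ "\<lambda>_. u"]) auto
qed

lemma hankel_L2_eq:
  assumes "\<alpha> > -1" "u \<in> hankel_core \<alpha>" "f \<in> borel_measurable (mu \<alpha>)" "AE x in mu \<alpha>. u x = f x"
  shows "AE x in mu \<alpha>. hankel_L2 \<alpha> f x = hankel \<alpha> u x" and "hankel_L2 \<alpha> f \<in> borel_measurable (mu \<alpha>)"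
proof -
  have g: "hankel_L2_graph \<alpha> f (hankel \<alpha> u)" using hankel_L2_graph_core assms by blast
  then have g': "hankel_L2_graph \<alpha> f (hankel_L2 \<alpha> f)" unfolding hankel_L2_def by (rule someI[where P = "hankel_L2_graph \<alpha> f"])
  show "AE x in mu \<alpha>. hankel_L2 \<alpha> f x = hankel \<alpha> u x"
    by (rule hankel_L2_graph_unique[OF assms(1) g' g])
  show "hankel_L2 \<alpha> f \<in> borel_measurable (mu \<alpha>)" using g' by (auto simp: hankel_L2_graph_def L2_def)
qed

lemma multiplier_op_eq:
  assumes f: "test_on a b f" and \<alpha>: "\<alpha> > -1" and \<beta>: "\<alpha> + \<beta> > - 1 / 2" and t: "t > 0"
  shows "AE x in mu \<alpha>. multiplier_op \<alpha> \<beta> t f x = hankel \<alpha> (filtered_hankel \<alpha> \<beta> t f) x"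
proof -
  note 1 = hankel_L2_eq[OF \<alpha> test_on_in_hankel_core[OF f \<alpha>] test_on_measurable[OF f] AE_I2[OF refl]]
  have [measurable]: "hankel_L2 \<alpha> f \<in> borel_measurable (mu \<alpha>)" by (rule 1)
  have [measurable]: "multiplier \<alpha> \<beta> \<in> borel_measurable borel" unfolding multiplier_def[abs_def] by measurable
  show ?thesis
    unfolding multiplier_op_def
  proof (rule hankel_L2_eq(1)[OF \<alpha> filtered_hankel_in_hankel_core[OF f \<alpha> \<beta> t]])
    show "(\<lambda>y. of_real (multiplier \<alpha> \<beta> (t * y)) * hankel_L2 \<alpha> f y) \<in> borel_measurable (mu \<alpha>)" by measurable
    show "AE x in mu \<alpha>. filtered_hankel \<alpha> \<beta> t f x = of_real (multiplier \<alpha> \<beta> (t * x)) * hankel_L2 \<alpha> f x"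
      using 1(1) by eventually_elim (simp add: filtered_hankel_def)
  qed
qed

section \<open>Oscillatory integrals\<close>

text \<open>Cauchy's criterion for improper integrals.\<close>

lemma tendsto_at_top_if_tails_small:
  fixes I e :: "real \<Rightarrow> real"
  assumes tail: "\<And>R R'. c \<le> R \<Longrightarrow> R \<le> R' \<Longrightarrow> \<bar>I R' - I R\<bar> \<le> e R" and e: "(e \<longlongrightarrow> 0) at_top"
  shows "\<exists>L. (I \<longlongrightarrow> L) at_top"
proof -
  have ev: "\<exists>N\<ge>c. \<forall>R\<ge>N. e R < r" if "r > 0" for r
  proof -
    have "eventually (\<lambda>R. e R < r) at_top" using e that by (rule order_tendstoD(2))
    then obtain N where "\<And>R. R \<ge> N \<Longrightarrow> e R < r" by (auto simp: eventually_at_top_linorder)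
    then show ?thesis by (intro exI[of _ "max N c"]) auto
  qed
  have "Cauchy (\<lambda>n. I (real n))"
  proof (rule metric_CauchyI)
    fix r :: real assume "r > 0"
    then obtain N where N: "N \<ge> c" "\<And>R. R \<ge> N \<Longrightarrow> e R < r" using ev by blast
    have "dist (I (real m)) (I (real n)) < r" if "m \<ge> nat \<lceil>N\<rceil>" "n \<ge> nat \<lceil>N\<rceil>" for m n
    proof -
      have mn: "real m \<ge> N" "real n \<ge> N" using that by linarith+
      show ?thesis
      proof (cases "m \<le> n")
        case True
        then show ?thesis using tail[of "real m" "real n"] N mn by (fastforce simp: dist_real_def)
      next
        case False
        then show ?thesis using tail[of "real n" "real m"] N(1) N(2)[OF mn(2)] mn by (simp add: dist_real_def)
      qed
    qed
    then show "\<exists>M. \<forall>m\<ge>M. \<forall>n\<ge>M. dist (I (real m)) (I (real n)) < r" by blast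
  qed
  then obtain L where L: "(\<lambda>n. I (real n)) \<longlonglongrightarrow> L" using real_Cauchy_convergent convergentD by blast
  have "\<bar>I R - L\<bar> \<le> e R" if R: "R \<ge> c" for R
  proof -
    have "\<bar>L - I R\<bar> \<le> e R"
    proof (rule LIMSEQ_le_const2)
      show "(\<lambda>n. \<bar>I (real n) - I R\<bar>) \<longlonglongrightarrow> \<bar>L - I R\<bar>" by (intro tendsto_intros L)
      show "\<exists>N. \<forall>n\<ge>N. \<bar>I (real n) - I R\<bar> \<le> e R"
      proof (intro exI[of _ "nat \<lceil>R\<rceil>"] allI impI)
        fix n assume "n \<ge> nat \<lceil>R\<rceil>"
        then have "real n \<ge> R" by linarith
        then show "\<bar>I (real n) - I R\<bar> \<le> e R" using tail R by blast
      qed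
    qed
    then show ?thesis by (simp add: abs_minus_commute)
  qed
  then have "eventually (\<lambda>R. norm (I R - L) \<le> e R) at_top"
    by (auto simp: eventually_at_top_linorder intro!: exI[of _ c])
  then have "((\<lambda>R. I R - L) \<longlongrightarrow> 0) at_top" using e by (rule Lim_null_comparison)
  then show ?thesis using LIM_zero_cancel by blast
qed

text \<open>Instead of integrating by parts, the integrand is squeezed between the derivatives of
  \<open>G \<plusminus> y powr -\<delta> / \<bar>\<omega>\<bar>\<close> with \<open>G = y powr -\<delta> * sin (\<omega> y - \<theta>) / \<omega>\<close>.\<close>

lemma oscillatory_integral_tail:
  fixes \<delta> \<omega> \<theta> Y R :: real
  assumes \<delta>: "\<delta> > 0" and \<omega>: "\<omega> \<noteq> 0" and Y: "0 < Y" "Y \<le> R"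
  shows "\<bar>integral {Y..R} (\<lambda>y. y powr - \<delta> * cos (\<omega> * y - \<theta>))\<bar> \<le> 2 / \<bar>\<omega>\<bar> * Y powr - \<delta>"
proof -
  define f where "f = (\<lambda>y. y powr - \<delta> * cos (\<omega> * y - \<theta>))"
  define s where "s = (\<lambda>y. sin (\<omega> * y - \<theta>) / \<omega>)"
  define G where "G = (\<lambda>y. y powr - \<delta> * s y)"
  define G' where "G' = (\<lambda>y. f y - \<delta> * y powr (- \<delta> - 1) * s y)"
  have dG: "(G has_real_derivative G' y) (at y)" and dp: "((\<lambda>y. y powr - \<delta> / \<bar>\<omega>\<bar>) has_real_derivative - \<delta> * y powr (- \<delta> - 1) / \<bar>\<omega>\<bar>) (at y)"
    if "y > 0" for y
  proof -
    have "(s has_real_derivative cos (\<omega> * y - \<theta>)) (at y)"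
      unfolding s_def using \<omega> by (auto intro!: derivative_eq_intros)
    from DERIV_mult'[OF has_real_derivative_powr[OF that, of "- \<delta>"] this]
    show "(G has_real_derivative G' y) (at y)"
      unfolding G_def G'_def f_def by (simp add: mult_ac)
    show "((\<lambda>y. y powr - \<delta> / \<bar>\<omega>\<bar>) has_real_derivative - \<delta> * y powr (- \<delta> - 1) / \<bar>\<omega>\<bar>) (at y)"
      by (intro DERIV_cdivide has_real_derivative_powr that)
  qed
  have sb: "\<bar>s y\<bar> \<le> 1 / \<bar>\<omega>\<bar>" for y
    unfolding s_def abs_divide by (intro divide_right_mono) auto
  have Gb: "\<bar>G y\<bar> \<le> y powr - \<delta> / \<bar>\<omega>\<bar>" for y
    using mult_left_mono[OF sb, of "y powr - \<delta>" y] by (simp add: G_def abs_mult)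
  have fi: "f integrable_on {Y..R}"
    unfolding f_def using Y by (intro integrable_continuous_real continuous_intros) auto
  have i1: "((\<lambda>y. G' y + \<delta> * y powr (- \<delta> - 1) / \<bar>\<omega>\<bar>) has_integral ((G R - R powr - \<delta> / \<bar>\<omega>\<bar>) - (G Y - Y powr - \<delta> / \<bar>\<omega>\<bar>))) {Y..R}"
  proof (rule fundamental_theorem_of_calculus[OF Y(2)])
    fix y assume "y \<in> {Y..R}"
    then have "y > 0" using Y by auto
    from DERIV_diff[OF dG[OF this] dp[OF this]]
    have "((\<lambda>y. G y - y powr - \<delta> / \<bar>\<omega>\<bar>) has_real_derivative G' y + \<delta> * y powr (- \<delta> - 1) / \<bar>\<omega>\<bar>) (at y)"
      by simp
    then show "((\<lambda>y. G y - y powr - \<delta> / \<bar>\<omega>\<bar>) has_vector_derivative G' y + \<delta> * y powr (- \<delta> - 1) / \<bar>\<omega>\<bar>) (at y within {Y..R})"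
      by (rule has_vector_derivative_at_within[OF has_real_derivative_iff_has_vector_derivative[THEN iffD1]])
  qed
  have i2: "((\<lambda>y. G' y - \<delta> * y powr (- \<delta> - 1) / \<bar>\<omega>\<bar>) has_integral ((G R + R powr - \<delta> / \<bar>\<omega>\<bar>) - (G Y + Y powr - \<delta> / \<bar>\<omega>\<bar>))) {Y..R}"
  proof (rule fundamental_theorem_of_calculus[OF Y(2)])
    fix y assume "y \<in> {Y..R}"
    then have "y > 0" using Y by auto
    from DERIV_add[OF dG[OF this] dp[OF this]]
    have "((\<lambda>y. G y + y powr - \<delta> / \<bar>\<omega>\<bar>) has_real_derivative G' y - \<delta> * y powr (- \<delta> - 1) / \<bar>\<omega>\<bar>) (at y)"
      by simp
    then show "((\<lambda>y. G y + y powr - \<delta> / \<bar>\<omega>\<bar>) has_vector_derivative G' y - \<delta> * y powr (- \<delta> - 1) / \<bar>\<omega>\<bar>) (at y within {Y..R})"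
      by (rule has_vector_derivative_at_within[OF has_real_derivative_iff_has_vector_derivative[THEN iffD1]])
  qed
  have cmp: "\<bar>\<delta> * y powr (- \<delta> - 1) * s y\<bar> \<le> \<delta> * y powr (- \<delta> - 1) / \<bar>\<omega>\<bar>" for y
    using mult_left_mono[OF sb, of "\<delta> * y powr (- \<delta> - 1)" y] \<delta> by (simp add: abs_mult)
  have "integral {Y..R} f \<le> (G R - R powr - \<delta> / \<bar>\<omega>\<bar>) - (G Y - Y powr - \<delta> / \<bar>\<omega>\<bar>)"
  proof (rule has_integral_le[OF integrable_integral[OF fi] i1])
    show "f y \<le> G' y + \<delta> * y powr (- \<delta> - 1) / \<bar>\<omega>\<bar>" for y using cmp[of y] unfolding G'_def by linarith
  qed
  moreover have "(G R + R powr - \<delta> / \<bar>\<omega>\<bar>) - (G Y + Y powr - \<delta> / \<bar>\<omega>\<bar>) \<le> integral {Y..R} f"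
  proof (rule has_integral_le[OF i2 integrable_integral[OF fi]])
    show "G' y - \<delta> * y powr (- \<delta> - 1) / \<bar>\<omega>\<bar> \<le> f y" for y using cmp[of y] unfolding G'_def by linarith
  qed
  ultimately have "\<bar>integral {Y..R} f\<bar> \<le> 2 * (Y powr - \<delta> / \<bar>\<omega>\<bar>)"
    using Gb[of R] Gb[of Y] by linarith
  then show ?thesis by (simp add: f_def)
qed

lemma integral_power_bound:
  fixes p R R' C :: real and g :: "real \<Rightarrow> real"
  assumes p: "p \<noteq> 0" and R: "0 < R" "R \<le> R'" and g: "continuous_on {R..R'} g"
    and b: "\<And>y. y \<in> {R..R'} \<Longrightarrow> \<bar>g y\<bar> \<le> C * y powr (p - 1)"
  shows "\<bar>integral {R..R'} g\<bar> \<le> C * (R' powr p - R powr p) / p"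
proof -
  have "((\<lambda>y. C * y powr (p - 1)) has_integral (C * R' powr p / p - C * R powr p / p)) {R..R'}"
  proof (rule fundamental_theorem_of_calculus[OF R(2)])
    fix y assume y: "y \<in> {R..R'}"
    have "((\<lambda>y. C * y powr p / p) has_real_derivative C * (p * y powr (p - 1)) / p) (at y)"
      using y R by (intro DERIV_cdivide DERIV_cmult has_real_derivative_powr) auto
    then have "((\<lambda>y. C * y powr p / p) has_real_derivative C * y powr (p - 1)) (at y)"
      using p by simp
    then show "((\<lambda>y. C * y powr p / p) has_vector_derivative C * y powr (p - 1)) (at y within {R..R'})"
      by (rule has_vector_derivative_at_within[OF has_real_derivative_iff_has_vector_derivative[THEN iffD1]])
  qed
  then have "norm (integral {R..R'} g) \<le> C * R' powr p / p - C * R powr p / p"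
    using integral_norm_bound_integral[of g "{R..R'}" "\<lambda>y. C * y powr (p - 1)"] b integrable_continuous_real[OF g]
    by (auto simp: has_integral_iff)
  then show ?thesis by (simp add: diff_divide_distrib right_diff_distrib)
qed

text \<open>The integral is split at \<open>Y = max c (1 / \<bar>\<omega>\<bar>)\<close>. Below \<open>Y\<close> the absolute value of the integrand is
  integrated, which gives \<open>Y powr p / p\<close>; above \<open>Y\<close> the oscillation gives at most
  \<open>2 Y powr (1 - \<delta>)\<close>. The minimum with \<open>1/2\<close> keeps \<open>p\<close> positive, where \<open>\<delta> = 1\<close> would produce
  a logarithm.\<close>

lemma oscillatory_integral_bound:
  fixes \<delta> \<omega> \<theta> c R p :: real
  assumes \<delta>: "\<delta> > 0" and \<omega>: "\<omega> \<noteq> 0" and c: "1 \<le> c" "c \<le> R" and p: "p = 1 - min \<delta> (1 / 2)"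
  shows "\<bar>integral {c..R} (\<lambda>y. y powr - \<delta> * cos (\<omega> * y - \<theta>))\<bar> \<le> (1 / p + 2) * c powr p * (1 + \<bar>\<omega>\<bar> powr - p)"
proof -
  define f where "f = (\<lambda>y. y powr - \<delta> * cos (\<omega> * y - \<theta>))"
  have p0: "p > 0" "p < 1" "- \<delta> \<le> p - 1" "1 - \<delta> \<le> p" using \<delta> p by auto
  define Y where "Y = max c (1 / \<bar>\<omega>\<bar>)"
  have Y: "Y \<ge> c" "1 / \<bar>\<omega>\<bar> \<le> Y" "Y \<ge> 1" using c by (auto simp: Y_def)
  have cf: "continuous_on {u..v} f" if "u > 0" for u v
    unfolding f_def using that by (intro continuous_intros) auto
  have start: "\<bar>integral {c..S} f\<bar> \<le> Y powr p / p" if S: "c \<le> S" "S \<le> Y" for S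
  proof -
    have "\<bar>integral {c..S} f\<bar> \<le> 1 * (S powr p - c powr p) / p"
    proof (rule integral_power_bound)
      fix y assume y: "y \<in> {c..S}"
      have "\<bar>f y\<bar> \<le> y powr - \<delta> * 1" unfolding f_def abs_mult by (intro mult_mono) auto
      also have "\<dots> \<le> 1 * y powr (p - 1)" using y c p0 by (simp add: powr_mono)
      finally show "\<bar>f y\<bar> \<le> 1 * y powr (p - 1)" .
    qed (use p0 c S cf in auto)
    also have "\<dots> \<le> Y powr p / p"
    proof -
      have "S powr p \<le> Y powr p" using S c p0 by (intro powr_mono2) auto
      then show ?thesis using p0 by (intro divide_right_mono) (auto intro: order.trans[of _ "S powr p"])
    qed
    finally show ?thesis .
  qed
  have main: "\<bar>integral {c..R} f\<bar> \<le> (1 / p + 2) * Y powr p"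
  proof (cases "R \<le> Y")
    case True
    have "\<bar>integral {c..R} f\<bar> \<le> 1 / p * Y powr p + 0" using start[OF c(2) True] by simp
    also have "\<dots> \<le> (1 / p + 2) * Y powr p" by (simp add: distrib_right)
    finally show ?thesis .
  next
    case False
    have "integral {c..R} f = integral {c..Y} f + integral {Y..R} f"
      using False Y c cf by (intro Henstock_Kurzweil_Integration.integral_combine[symmetric] integrable_continuous_real) auto
    moreover have "\<bar>integral {Y..R} f\<bar> \<le> 2 * Y powr p"
    proof -
      have "\<bar>integral {Y..R} f\<bar> \<le> 2 / \<bar>\<omega>\<bar> * Y powr - \<delta>"
        unfolding f_def using False Y by (intro oscillatory_integral_tail \<delta> \<omega>) auto
      also have "\<dots> \<le> 2 * Y * Y powr - \<delta>" using Y by (intro mult_right_mono) auto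
      also have "\<dots> = 2 * Y powr (1 + - \<delta>)" unfolding powr_add using Y by simp
      also have "\<dots> \<le> 2 * Y powr p" using Y p0 by (intro mult_left_mono powr_mono) auto
      finally show ?thesis .
    qed
    moreover have "\<bar>integral {c..Y} f\<bar> \<le> 1 / p * Y powr p" using start[of Y] Y by simp
    ultimately show ?thesis by (simp add: distrib_right)
  qed
  have "Y powr p \<le> c powr p * (1 + \<bar>\<omega>\<bar> powr - p)"
  proof (cases "c \<ge> 1 / \<bar>\<omega>\<bar>")
    case True
    then show ?thesis by (simp add: Y_def distrib_left)
  next
    case False
    then have "Y powr p = \<bar>\<omega>\<bar> powr - p" using \<omega> by (simp add: Y_def powr_minus powr_divide inverse_eq_divide)
    also have "\<dots> \<le> c powr p * (1 + \<bar>\<omega>\<bar> powr - p)"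
      using ge_one_powr_ge_zero[OF c(1), of p] p0 mult_right_mono[of 1 "c powr p" "\<bar>\<omega>\<bar> powr - p"]
      by (simp add: distrib_left add_increasing)
    finally show ?thesis .
  qed
  then have "(1 / p + 2) * Y powr p \<le> (1 / p + 2) * (c powr p * (1 + \<bar>\<omega>\<bar> powr - p))"
    using p0 by (intro mult_left_mono) auto
  then show ?thesis using main by (simp add: f_def mult.assoc)
qed

section \<open>Convergence and size of the truncated kernels\<close>

text \<open>The frequencies \<open>t \<plusminus> x \<plusminus> z\<close>, the four choices of signs being numbered by \<open>i < 4\<close>. One of
  them vanishes exactly when \<open>t = \<bar>x - z\<bar>\<close> or \<open>t = x + z\<close>, provided that \<open>t\<close>, \<open>x\<close> and \<open>z\<close> are positive.\<close>

definition frequency :: "real \<Rightarrow> real \<Rightarrow> real \<Rightarrow> nat \<Rightarrow> real" where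
  "frequency t x z i = t + (if i < 2 then x else - x) + (if even i then z else - z)"

text \<open>The majorant of the truncated kernels, locally integrable in \<open>z\<close> for \<open>p < 1\<close>.\<close>

definition frequency_weight :: "real \<Rightarrow> real \<Rightarrow> real \<Rightarrow> real \<Rightarrow> real" where
  "frequency_weight p t x z = 1 + (\<Sum>i<4. \<bar>frequency t x z i\<bar> powr - p)"

lemma frequency_weight_ge_1: "1 \<le> frequency_weight p t x z"
  by (simp add: frequency_weight_def sum_nonneg)

lemma cos_product3: "cos A * cos B * cos C = (\<Sum>i<4. cos (frequency A B C i)) / 4"
proof -
  have 4: "{..<4::nat} = {0, 1, 2, 3}" by auto
  show ?thesis
    unfolding 4 by (simp add: frequency_def cos_add cos_diff sin_add sin_diff algebra_simps)
qed

lemma frequency_affine: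
  "frequency (t * y - a) (x * y - b) (z * y - c) i = frequency t x z i * y - frequency a b c i"
  by (simp add: frequency_def algebra_simps)

lemma finite_zero_frequency: "finite {z. \<exists>i<4. frequency t x z i = 0}"
proof (rule finite_subset)
  show "{z. \<exists>i<4. frequency t x z i = 0} \<subseteq> {- (t + x), t + x, x - t, t - x}"
    by (auto simp: frequency_def split: if_splits)
qed simp

definition bessel_triple :: "real \<Rightarrow> real \<Rightarrow> real \<Rightarrow> real \<Rightarrow> real \<Rightarrow> real \<Rightarrow> real" where
  "bessel_triple \<alpha> \<gamma> t x z y = q \<gamma> (t * y) * q \<alpha> (x * y) * q \<alpha> (z * y)"

lemma borel_measurable_bessel_triple [measurable]:
  assumes [measurable]: "f \<in> borel_measurable M" "g \<in> borel_measurable M"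
  shows "(\<lambda>w. bessel_triple \<alpha> \<gamma> t x (f w) (g w)) \<in> borel_measurable M"
  unfolding bessel_triple_def by measurable

lemma bessel_triple_bounded:
  assumes "t > 0" "x > 0" "b > 0"
  shows "\<exists>B>0. \<forall>z y. 0 < z \<and> z \<le> b \<and> 0 < y \<and> y \<le> R \<longrightarrow> \<bar>bessel_triple \<alpha> \<gamma> t x z y\<bar> \<le> B"
proof -
  obtain B1 where B1: "B1 > 0" "\<And>s. 0 < s \<Longrightarrow> s \<le> t * R \<Longrightarrow> \<bar>q \<gamma> s\<bar> \<le> B1" using bessel_quot_bounded_near_0 by metis
  obtain B2 where B2: "B2 > 0" "\<And>s. 0 < s \<Longrightarrow> s \<le> x * R \<Longrightarrow> \<bar>q \<alpha> s\<bar> \<le> B2" using bessel_quot_bounded_near_0 by metis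
  obtain B3 where B3: "B3 > 0" "\<And>s. 0 < s \<Longrightarrow> s \<le> b * R \<Longrightarrow> \<bar>q \<alpha> s\<bar> \<le> B3" using bessel_quot_bounded_near_0 by metis
  have "\<bar>bessel_triple \<alpha> \<gamma> t x z y\<bar> \<le> B1 * B2 * B3" if "0 < z" "z \<le> b" "0 < y" "y \<le> R" for z y
  proof -
    have "z * y \<le> b * R" using that by (intro mult_mono) auto
    then show ?thesis
      unfolding bessel_triple_def abs_mult using that assms B1 B2 B3 by (intro mult_mono) auto
  qed
  then show ?thesis using B1 B2 B3 by (intro exI[of _ "B1 * B2 * B3"]) auto
qed

lemma continuous_on_bessel_triple:
  assumes "t > 0" "x > 0" "z > 0" "A \<subseteq> {0<..}"
  shows "continuous_on A (bessel_triple \<alpha> \<gamma> t x z)"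
  unfolding bessel_triple_def[abs_def] using assms by (intro continuous_intros) auto

lemma triple_product_error:
  fixes F1 :: real
  assumes "\<bar>F1 - a1\<bar> \<le> e" "\<bar>F2 - a2\<bar> \<le> e" "\<bar>F3 - a3\<bar> \<le> e" "\<bar>F2\<bar> \<le> B" "\<bar>F3\<bar> \<le> B" "\<bar>a1\<bar> \<le> B" "\<bar>a2\<bar> \<le> B"
  shows "\<bar>F1 * F2 * F3 - a1 * a2 * a3\<bar> \<le> 3 * B\<^sup>2 * e"
proof -
  have e: "e \<ge> 0" and B: "B \<ge> 0" using assms abs_ge_zero order.trans by blast+
  have "F1 * F2 * F3 - a1 * a2 * a3 = (F1 - a1) * F2 * F3 + a1 * (F2 - a2) * F3 + a1 * a2 * (F3 - a3)"
    by (simp add: algebra_simps)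
  also have "\<bar>\<dots>\<bar> \<le> \<bar>F1 - a1\<bar> * \<bar>F2\<bar> * \<bar>F3\<bar> + \<bar>a1\<bar> * \<bar>F2 - a2\<bar> * \<bar>F3\<bar> + \<bar>a1\<bar> * \<bar>a2\<bar> * \<bar>F3 - a3\<bar>"
    unfolding abs_mult[symmetric] by linarith
  also have "\<dots> \<le> e * B * B + B * e * B + B * B * e"
    by (intro add_mono mult_mono mult_nonneg_nonneg abs_ge_zero assms e B)
  finally show ?thesis by (simp add: power2_eq_square algebra_simps)
qed

text \<open>The factor \<open>y powr (2 \<alpha> + 1)\<close> cancels against the two factors of order \<open>\<alpha>\<close>, so the rate
  \<open>\<gamma> + 1/2\<close> comes from the multiplier alone. The constants do not depend on \<open>z \<ge> a\<close>, because
  all three arguments \<open>t y\<close>, \<open>x y\<close> and \<open>z y\<close> are at least a fixed multiple of \<open>y\<close>.\<close>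

lemma bessel_triple_asymptotics:
  assumes \<alpha>: "\<alpha> > -1" and \<gamma>: "\<gamma> > -1" and t: "t > 0" and x: "x > 0" and a: "a > 0" and \<delta>: "\<delta> = \<gamma> + 1 / 2"
  shows "\<exists>c A C \<theta>. c \<ge> 1 \<and> C \<ge> 0 \<and> (\<forall>z\<ge>a. \<forall>y\<ge>c.
     \<bar>t powr \<delta> * x powr (\<alpha> + 1 / 2) * z powr (\<alpha> + 1 / 2) * (y powr (2 * \<alpha> + 1) * bessel_triple \<alpha> \<gamma> t x z y)
      - A * (\<Sum>i<4. y powr - \<delta> * cos (frequency t x z i * y - \<theta> i))\<bar> \<le> C * y powr (- \<delta> - 1))"
proof -
  obtain A1 \<phi>1 C1 where 1: "A1 > 0" "C1 > 0"
    "\<And>s. s \<ge> 1 \<Longrightarrow> \<bar>s powr \<delta> * q \<gamma> s - A1 * cos (s - \<phi>1)\<bar> \<le> C1 / s"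
    using bessel_quot_asymptotics[OF \<gamma>] unfolding \<delta> by blast
  obtain A2 \<phi>2 C2 where 2: "A2 > 0" "C2 > 0"
    "\<And>s. s \<ge> 1 \<Longrightarrow> \<bar>s powr (\<alpha> + 1 / 2) * q \<alpha> s - A2 * cos (s - \<phi>2)\<bar> \<le> C2 / s"
    using bessel_quot_asymptotics[OF \<alpha>] by blast
  \<comment> \<open>For \<open>y \<ge> 1 / m\<close> all three arguments are in the range \<open>s \<ge> 1\<close> of the asymptotics.\<close>
  define m where "m = min t (min x a)"
  have m: "m > 0" "m \<le> t" "m \<le> x" "m \<le> a" using t x a by (auto simp: m_def)
  define c where "c = max 1 (1 / m)"
  define D where "D = (C1 + C2) / m"
  define B where "B = A1 + A2 + C1 + C2"
  define \<theta> where "\<theta> = frequency \<phi>1 \<phi>2 \<phi>2"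
  define A where "A = A1 * A2 * A2 / 4"
  have D: "D \<ge> 0" using 1 2 m by (simp add: D_def)
  have cm: "c \<ge> 1" "c \<ge> 1 / m" by (auto simp: c_def)
  have big: "s * y \<ge> 1" "(C1 + C2) / (s * y) \<le> D / y" if "s \<ge> m" "y \<ge> c" for s y
  proof -
    have y: "y \<ge> 1" "1 / m \<le> y" using that cm by auto
    have "1 \<le> m * y" using y m by (simp add: field_simps)
    also have my: "m * y \<le> s * y" using that y by (intro mult_right_mono) auto
    finally show "s * y \<ge> 1" .
    have "(C1 + C2) / (s * y) \<le> (C1 + C2) / (m * y)"
      using my 1 2 m y that by (intro divide_left_mono) auto
    then show "(C1 + C2) / (s * y) \<le> D / y" by (simp add: D_def)
  qed
  have "\<bar>t powr \<delta> * x powr (\<alpha> + 1 / 2) * z powr (\<alpha> + 1 / 2) * (y powr (2 * \<alpha> + 1) * bessel_triple \<alpha> \<gamma> t x z y)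
      - A * (\<Sum>i<4. y powr - \<delta> * cos (frequency t x z i * y - \<theta> i))\<bar> \<le> 3 * B\<^sup>2 * D * y powr (- \<delta> - 1)"
    (is "\<bar>?lhs - ?osc\<bar> \<le> _") if z: "z \<ge> a" and y: "y \<ge> c" for z y
  proof -
    have y1: "y \<ge> 1" using y cm by simp
    define F1 where "F1 = (t * y) powr \<delta> * q \<gamma> (t * y)"
    define F2 where "F2 = (\<lambda>s. (s * y) powr (\<alpha> + 1 / 2) * q \<alpha> (s * y))"
    define a1 where "a1 = A1 * cos (t * y - \<phi>1)"
    define a2 where "a2 = (\<lambda>s. A2 * cos (s * y - \<phi>2))"
    have zm: "z \<ge> m" using z m by simp
    have e1: "\<bar>F1 - a1\<bar> \<le> D / y"
    proof -
      have "C1 / (t * y) \<le> (C1 + C2) / (t * y)" using big(1)[OF m(2) y] 2 by (intro divide_right_mono) auto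
      then show ?thesis unfolding F1_def a1_def using 1(3)[OF big(1)[OF m(2) y]] big(2)[OF m(2) y] by linarith
    qed
    have e: "\<bar>F2 s - a2 s\<bar> \<le> D / y" "\<bar>F2 s\<bar> \<le> B" if s: "s \<ge> m" for s
    proof -
      have s1: "s * y \<ge> 1" by (rule big(1)[OF s y])
      have "C2 / (s * y) \<le> (C1 + C2) / (s * y)" using s1 1 by (intro divide_right_mono) auto
      then show "\<bar>F2 s - a2 s\<bar> \<le> D / y"
        unfolding F2_def a2_def using 2(3)[OF s1] big(2)[OF s y] by linarith
      have "C2 / (s * y) \<le> C2" using s1 2 by (simp add: divide_le_eq mult_le_cancel_left1)
      moreover have "\<bar>A2 * cos (s * y - \<phi>2)\<bar> \<le> A2 * 1" unfolding abs_mult using 2 by (intro mult_mono) auto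
      ultimately show "\<bar>F2 s\<bar> \<le> B"
        using 2(3)[OF s1] 1 unfolding F2_def B_def by linarith
    qed
    have ab: "\<bar>a1\<bar> \<le> B" "\<bar>a2 s\<bar> \<le> B" for s
    proof -
      have "\<bar>a1\<bar> \<le> A1 * 1" "\<bar>a2 s\<bar> \<le> A2 * 1"
        unfolding a1_def a2_def abs_mult using 1 2 by (intro mult_mono; simp)+
      then show "\<bar>a1\<bar> \<le> B" "\<bar>a2 s\<bar> \<le> B" unfolding B_def using 1 2 by linarith+
    qed
    have err: "\<bar>F1 * F2 x * F2 z - a1 * a2 x * a2 z\<bar> \<le> 3 * B\<^sup>2 * (D / y)"
      by (rule triple_product_error[OF e1 e(1)[OF m(3)] e(1)[OF zm] e(2)[OF m(3)] e(2)[OF zm] ab])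
    have "a1 * a2 x * a2 z = A1 * A2 * A2 * (cos (t * y - \<phi>1) * cos (x * y - \<phi>2) * cos (z * y - \<phi>2))"
      by (simp add: a1_def a2_def)
    also have "\<dots> = A * (\<Sum>i<4. cos (frequency t x z i * y - \<theta> i))"
      unfolding cos_product3 frequency_affine A_def \<theta>_def by simp
    finally have prod: "y powr - \<delta> * (a1 * a2 x * a2 z) = ?osc"
      by (simp add: sum_distrib_left mult.left_commute)
    have pw: "?lhs = y powr - \<delta> * (F1 * F2 x * F2 z)"
    proof -
      have e: "2 * \<alpha> + 1 = - \<delta> + (\<delta> + (\<alpha> + 1 / 2) + (\<alpha> + 1 / 2))" by simp
      have "y powr (2 * \<alpha> + 1) = y powr - \<delta> * (y powr \<delta> * y powr (\<alpha> + 1 / 2) * y powr (\<alpha> + 1 / 2))"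
        by (simp only: e powr_add mult.assoc)
      then show ?thesis
        unfolding F1_def F2_def bessel_triple_def using t x z a y1 by (simp add: powr_mult)
    qed
    have "\<bar>?lhs - ?osc\<bar> = y powr - \<delta> * \<bar>F1 * F2 x * F2 z - a1 * a2 x * a2 z\<bar>"
      unfolding pw prod[symmetric] by (simp add: abs_mult flip: right_diff_distrib)
    also have "\<dots> \<le> y powr - \<delta> * (3 * B\<^sup>2 * (D / y))"
      using err by (rule mult_left_mono) simp
    also have "\<dots> = 3 * B\<^sup>2 * D * y powr (- \<delta> - 1)"
      using y1 by (simp add: powr_diff)
    finally show ?thesis .
  qed
  then show ?thesis using cm(1) D
    by (intro exI[of _ c] exI[of _ A] exI[of _ "3 * B\<^sup>2 * D"] exI[of _ \<theta>]) auto
qed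

text \<open>The four oscillating terms are controlled by the preceding section, and the error term is
  absolutely integrable as \<open>\<gamma> + 1/2 > 0\<close>.\<close>

lemma bessel_triple_tail_integral:
  assumes \<alpha>: "\<alpha> > -1" and \<gamma>: "\<gamma> > - 1 / 2" and t: "t > 0" and x: "x > 0" and ab: "0 < a" "a < b"
  defines "J \<equiv> \<lambda>c z R. integral {c..R} (\<lambda>y. y powr (2 * \<alpha> + 1) * bessel_triple \<alpha> \<gamma> t x z y)"
  shows "\<exists>c\<ge>1. \<exists>p C. 0 \<le> p \<and> p < 1 \<and> (\<forall>z\<in>{a..b}. (\<forall>i<4. frequency t x z i \<noteq> 0) \<longrightarrow>
    (\<forall>R\<ge>c. \<bar>J c z R\<bar> \<le> C * frequency_weight p t x z) \<and> (\<exists>L. (J c z \<longlongrightarrow> L) at_top))"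
proof -
  define \<delta> where "\<delta> = \<gamma> + 1 / 2"
  define n where "n = (\<lambda>z. t powr \<delta> * x powr (\<alpha> + 1 / 2) * z powr (\<alpha> + 1 / 2))"
  define P where "P = (\<lambda>z y. y powr (2 * \<alpha> + 1) * bessel_triple \<alpha> \<gamma> t x z y)"
  define osc where "osc = (\<lambda>\<omega> \<theta> y. y powr - \<delta> * cos (\<omega> * y - \<theta>))"
  have \<delta>: "\<delta> > 0" using \<gamma> by (simp add: \<delta>_def)
  have "\<gamma> > -1" using \<gamma> by simp
  from bessel_triple_asymptotics[OF \<alpha> this t x ab(1) \<delta>_def] obtain c A C \<theta> where c: "c \<ge> 1" and C: "C \<ge> 0"
    and dec: "\<And>z y. z \<ge> a \<Longrightarrow> y \<ge> c \<Longrightarrow>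
      \<bar>n z * P z y - A * (\<Sum>i<4. osc (frequency t x z i) (\<theta> i) y)\<bar> \<le> C * y powr (- \<delta> - 1)"
    unfolding n_def P_def osc_def by blast
  define p where "p = 1 - min \<delta> (1 / 2)"
  have p: "0 < p" "p < 1" using \<delta> by (auto simp: p_def)
  define E where "E = (\<lambda>z y. n z * P z y - A * (\<Sum>i<4. osc (frequency t x z i) (\<theta> i) y))"
  have n0: "n z > 0" if "z \<ge> a" for z using that t x ab by (simp add: n_def)
  have co: "continuous_on {u..v} (osc \<omega> \<theta>)" if "u \<ge> c" for u v \<omega> \<theta>
    unfolding osc_def using that c by (intro continuous_intros) auto
  have cP: "continuous_on {u..v} (P z)" if "u \<ge> c" "z \<ge> a" for u v z
    unfolding P_def using that c t x ab by (intro continuous_intros continuous_on_bessel_triple) auto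
  have cE: "continuous_on {u..v} (E z)" if "u \<ge> c" "z \<ge> a" for u v z
    unfolding E_def using that by (intro continuous_intros co cP)
  have Ei: "\<bar>integral {u..v} (E z)\<bar> \<le> C / \<delta> * u powr - \<delta>" if "u \<ge> c" "u \<le> v" "z \<ge> a" for u v z
  proof -
    have "\<bar>integral {u..v} (E z)\<bar> \<le> C * (v powr - \<delta> - u powr - \<delta>) / - \<delta>"
      using that c \<delta> dec by (intro integral_power_bound cE) (auto simp: E_def)
    also have "\<dots> = C / \<delta> * (u powr - \<delta> - v powr - \<delta>)" using \<delta> by (simp add: field_simps)
    also have "\<dots> \<le> C / \<delta> * u powr - \<delta>" using C \<delta> by (intro mult_left_mono) auto
    finally show ?thesis .
  qed
  have split: "n z * integral {u..v} (P z)
      = A * (\<Sum>i<4. integral {u..v} (osc (frequency t x z i) (\<theta> i))) + integral {u..v} (E z)"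
    if "u \<ge> c" "z \<ge> a" for u v z
  proof -
    have "(E z has_integral (n z * integral {u..v} (P z)
        - A * (\<Sum>i<4. integral {u..v} (osc (frequency t x z i) (\<theta> i))))) {u..v}"
      unfolding E_def using co[OF that(1)] cP[OF that]
      by (intro has_integral_diff has_integral_mult_right has_integral_sum integrable_integral
        integrable_continuous_real) auto
    from integral_unique[OF this] show ?thesis by simp
  qed
  have est: "\<bar>integral {u..v} (P z)\<bar> \<le> 1 / n z * (\<bar>A\<bar> * (\<Sum>i<4. b i) + C / \<delta> * u powr - \<delta>)"
    if "u \<ge> c" "u \<le> v" "z \<ge> a" and b: "\<And>i. i < 4 \<Longrightarrow> \<bar>integral {u..v} (osc (frequency t x z i) (\<theta> i))\<bar> \<le> b i"
    for u v z and b :: "nat \<Rightarrow> real"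
  proof -
    have "\<bar>\<Sum>i<4. integral {u..v} (osc (frequency t x z i) (\<theta> i))\<bar> \<le> (\<Sum>i<4. b i)"
      using b by (intro order.trans[OF sum_abs] sum_mono) auto
    then have "\<bar>A * (\<Sum>i<4. integral {u..v} (osc (frequency t x z i) (\<theta> i)))\<bar> \<le> \<bar>A\<bar> * (\<Sum>i<4. b i)"
      unfolding abs_mult by (rule mult_left_mono) simp
    then have "\<bar>n z * integral {u..v} (P z)\<bar> \<le> \<bar>A\<bar> * (\<Sum>i<4. b i) + C / \<delta> * u powr - \<delta>"
      using Ei[OF that(1-3)] unfolding split[OF that(1,3)] by linarith
    then show ?thesis using n0[OF that(3)] by (simp add: abs_mult pos_le_divide_eq mult.commute)
  qed
  have "continuous_on {a..b} (\<lambda>z. 1 / n z)"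
    unfolding n_def using ab t x by (intro continuous_intros) auto
  then have "bounded ((\<lambda>z. 1 / n z) ` {a..b})" by (intro compact_imp_bounded compact_continuous_image) auto
  then obtain M where M: "M > 0" "\<And>z. z \<in> {a..b} \<Longrightarrow> 1 / n z \<le> M"
    unfolding bounded_pos by (auto simp: abs_le_iff)
  define K where "K = (1 / p + 2) * c powr p"
  have K: "K \<ge> 0" using p by (simp add: K_def)
  define D where "D = M * (\<bar>A\<bar> * (K * 4) + C / \<delta>)"
  have bound: "\<bar>integral {c..R} (P z)\<bar> \<le> D * frequency_weight p t x z"
    if z: "z \<in> {a..b}" "\<forall>i<4. frequency t x z i \<noteq> 0" and R: "R \<ge> c" for z R
  proof -
    define w where "w = frequency_weight p t x z"
    have w: "1 \<le> w" unfolding w_def by (rule frequency_weight_ge_1)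
    have "\<bar>integral {c..R} (P z)\<bar> \<le> 1 / n z *
        (\<bar>A\<bar> * (\<Sum>i<4. K * (1 + \<bar>frequency t x z i\<bar> powr - p)) + C / \<delta> * c powr - \<delta>)"
      using z R unfolding K_def osc_def
      by (intro est[unfolded osc_def] oscillatory_integral_bound[OF \<delta> _ c R p_def]) auto
    also have "(\<Sum>i<4. K * (1 + \<bar>frequency t x z i\<bar> powr - p)) = K * (3 + w)"
      by (simp add: w_def frequency_weight_def sum.distrib flip: sum_distrib_left)
    also have "1 / n z * (\<bar>A\<bar> * (K * (3 + w)) + C / \<delta> * c powr - \<delta>) \<le> M * (\<bar>A\<bar> * (K * (4 * w)) + C / \<delta> * w)"
    proof (intro mult_mono add_mono mult_left_mono)
      have "c powr - \<delta> \<le> c powr 0" using c \<delta> by (intro powr_mono) auto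
      then show "c powr - \<delta> \<le> w" using w c by simp
      show "1 / n z \<le> M" by (rule M(2)[OF z(1)])
    qed (use M C \<delta> K w in auto)
    also have "\<dots> = D * w" by (simp add: D_def algebra_simps)
    finally show ?thesis by (simp add: w_def)
  qed
  have conv: "\<exists>L. ((\<lambda>R. integral {c..R} (P z)) \<longlongrightarrow> L) at_top"
    if z: "z \<in> {a..b}" "\<forall>i<4. frequency t x z i \<noteq> 0" for z
  proof -
    define e where "e = 1 / n z * (\<bar>A\<bar> * (\<Sum>i<4. 2 / \<bar>frequency t x z i\<bar>) + C / \<delta>)"
    show ?thesis
    proof (rule tendsto_at_top_if_tails_small)
      fix R R' assume R: "c \<le> R" "R \<le> R'"
      have "integral {c..R'} (P z) = integral {c..R} (P z) + integral {R..R'} (P z)"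
        using R z cP by (intro Henstock_Kurzweil_Integration.integral_combine[symmetric] integrable_continuous_real) auto
      then have "\<bar>integral {c..R'} (P z) - integral {c..R} (P z)\<bar> = \<bar>integral {R..R'} (P z)\<bar>" by simp
      also have "\<dots> \<le> 1 / n z * (\<bar>A\<bar> * (\<Sum>i<4. 2 / \<bar>frequency t x z i\<bar> * R powr - \<delta>) + C / \<delta> * R powr - \<delta>)"
        using z R c by (intro est[unfolded osc_def] oscillatory_integral_tail \<delta>) auto
      also have "\<dots> = e * R powr - \<delta>"
        unfolding e_def sum_distrib_right[symmetric] by (simp add: algebra_simps)
      finally show "\<bar>integral {c..R'} (P z) - integral {c..R} (P z)\<bar> \<le> e * R powr - \<delta>" .
    next
      have "((\<lambda>R. R powr - \<delta>) \<longlongrightarrow> 0) at_top" using \<delta> by (intro tendsto_neg_powr filterlim_ident) auto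
      then show "((\<lambda>R. e * R powr - \<delta>) \<longlongrightarrow> 0) at_top" by (rule tendsto_mult_right_zero)
    qed
  qed
  have J: "J c z = (\<lambda>R. integral {c..R} (P z))" for z by (simp add: J_def P_def)
  show ?thesis
  proof (rule exI[of _ c], rule conjI[OF c], rule exI[of _ p], rule exI[of _ D], intro conjI ballI impI allI)
    show "\<bar>J c z R\<bar> \<le> D * frequency_weight p t x z"
      if "z \<in> {a..b}" "\<forall>i<4. frequency t x z i \<noteq> 0" "c \<le> R" for z R
      unfolding J by (rule bound[OF that])
    show "\<exists>L. (J c z \<longlongrightarrow> L) at_top" if "z \<in> {a..b}" "\<forall>i<4. frequency t x z i \<noteq> 0" for z
      unfolding J by (rule conv[OF that])
  qed (use p in auto)
qed

definition truncated_kernel :: "real \<Rightarrow> real \<Rightarrow> real \<Rightarrow> real \<Rightarrow> real \<Rightarrow> real \<Rightarrow> real" where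
  "truncated_kernel \<alpha> \<gamma> t x z R = (LINT y:{0<..R}|mu \<alpha>. bessel_triple \<alpha> \<gamma> t x z y)"

lemma bessel_triple_truncated:
  assumes \<alpha>: "\<alpha> > -1" and pos: "t > 0" "x > 0" "b > 0"
  shows "\<exists>D\<ge>0. \<forall>z. 0 < z \<and> z \<le> b \<longrightarrow> set_integrable (mu \<alpha>) {0<..R} (bessel_triple \<alpha> \<gamma> t x z)
    \<and> \<bar>truncated_kernel \<alpha> \<gamma> t x z R\<bar> \<le> D"
proof -
  obtain B where B: "B > 0" "\<And>z y. 0 < z \<Longrightarrow> z \<le> b \<Longrightarrow> 0 < y \<Longrightarrow> y \<le> R \<Longrightarrow> \<bar>bessel_triple \<alpha> \<gamma> t x z y\<bar> \<le> B"
    using bessel_triple_bounded[OF pos] by blast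
  define D where "D = (LINT y|mu \<alpha>. B * indicator {..R} y)"
  have i: "integrable (mu \<alpha>) (\<lambda>y. B * indicator {..R} y)"
    using integrable_mu_indicator_atMost[OF \<alpha>] by (intro integrable_mult_right)
  have le: "norm (indicator {0<..R} y *\<^sub>R bessel_triple \<alpha> \<gamma> t x z y) \<le> B * indicator {..R} y"
    if "0 < z" "z \<le> b" "y \<in> space (mu \<alpha>)" for z y
    using B(2)[OF that(1,2), of y] that(3) by (auto simp: indicator_def)
  have "set_integrable (mu \<alpha>) {0<..R} (bessel_triple \<alpha> \<gamma> t x z) \<and> \<bar>truncated_kernel \<alpha> \<gamma> t x z R\<bar> \<le> D"
    if z: "0 < z" "z \<le> b" for z
  proof -
    have j: "integrable (mu \<alpha>) (\<lambda>y. indicator {0<..R} y *\<^sub>R bessel_triple \<alpha> \<gamma> t x z y)"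
    proof (rule Bochner_Integration.integrable_bound[OF i])
      show "AE y in mu \<alpha>. norm (indicator {0<..R} y *\<^sub>R bessel_triple \<alpha> \<gamma> t x z y) \<le> norm (B * indicator {..R} y)"
        using le[OF z] by (intro AE_I2) (auto intro: order.trans[OF _ abs_ge_self])
    qed measurable
    moreover from Bochner_Integration.integral_norm_bound_integral[OF j i le[OF z]]
    have "\<bar>truncated_kernel \<alpha> \<gamma> t x z R\<bar> \<le> D"
      by (simp add: truncated_kernel_def D_def set_lebesgue_integral_def)
    ultimately show ?thesis by (simp add: set_integrable_def)
  qed
  moreover have "D \<ge> 0" unfolding D_def using B by (intro Bochner_Integration.integral_nonneg) auto
  ultimately show ?thesis by blast
qed

text \<open>Below \<open>c\<close> the integrand is bounded, uniformly for \<open>z\<close> in \<open>{a..b}\<close>; above \<open>c\<close> the asymptotic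
  regime has been reached.\<close>

lemma kernel_truncation:
  assumes \<alpha>: "\<alpha> > -1" and \<gamma>: "\<gamma> > - 1 / 2" and t: "t > 0" and x: "x > 0" and ab: "0 < a" "a < b"
  shows "\<exists>c p C. 0 \<le> p \<and> p < 1 \<and> (\<forall>z\<in>{a..b}. (\<forall>i<4. frequency t x z i \<noteq> 0) \<longrightarrow>
    (\<forall>R\<ge>c. \<bar>truncated_kernel \<alpha> \<gamma> t x z R\<bar> \<le> C * frequency_weight p t x z) \<and>
    (truncated_kernel \<alpha> \<gamma> t x z \<longlongrightarrow> Lim at_top (truncated_kernel \<alpha> \<gamma> t x z)) at_top)"
proof -
  define P where "P = bessel_triple \<alpha> \<gamma> t x"
  define J where "J = (\<lambda>c z R. integral {c..R} (\<lambda>y. y powr (2 * \<alpha> + 1) * P z y))"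
  obtain c p C where c: "c \<ge> 1" and p: "0 \<le> p" "p < 1"
    and bnd: "\<And>z R. z \<in> {a..b} \<Longrightarrow> \<forall>i<4. frequency t x z i \<noteq> 0 \<Longrightarrow> R \<ge> c \<Longrightarrow> \<bar>J c z R\<bar> \<le> C * frequency_weight p t x z"
    and conv: "\<And>z. z \<in> {a..b} \<Longrightarrow> \<forall>i<4. frequency t x z i \<noteq> 0 \<Longrightarrow> \<exists>L. (J c z \<longlongrightarrow> L) at_top"
    using bessel_triple_tail_integral[OF \<alpha> \<gamma> t x ab] unfolding J_def P_def by blast
  define I where "I = (\<lambda>z. truncated_kernel \<alpha> \<gamma> t x z c)"
  have b: "b > 0" using ab by simp
  have Pi: "set_integrable (mu \<alpha>) {0<..R} (P z)" if "z \<in> {a..b}" for z R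
    unfolding P_def using bessel_triple_truncated[OF \<alpha> t x b, of R \<gamma>] that ab by fastforce
  have mP [measurable]: "P z \<in> borel_measurable (mu \<alpha>)" for z unfolding P_def by measurable
  have split: "truncated_kernel \<alpha> \<gamma> t x z R = I z + J c z R" if z: "z \<in> {a..b}" and R: "R \<ge> c" for z R
  proof -
    have "{0<..R} = {0<..c} \<union> {c<..R}" using c R by auto
    moreover have "set_lebesgue_integral (mu \<alpha>) ({0<..c} \<union> {c<..R}) (P z)
        = set_lebesgue_integral (mu \<alpha>) {0<..c} (P z) + set_lebesgue_integral (mu \<alpha>) {c<..R} (P z)"
    proof (rule set_integral_Un)
      show "set_integrable (mu \<alpha>) {c<..R} (P z)"
        by (rule set_integrable_subset[OF Pi[OF z, of R]]) (use c in \<open>auto simp: sets_mu sets_restrict_space_iff\<close>)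
    qed (use Pi[OF z] in auto)
    ultimately have "truncated_kernel \<alpha> \<gamma> t x z R = I z + (LINT y:{c<..R}|mu \<alpha>. P z y)"
      by (simp add: I_def truncated_kernel_def P_def)
    also have "(LINT y:{c<..R}|mu \<alpha>. P z y) = (LINT y:{0<..}|lborel. y powr (2 * \<alpha> + 1) *\<^sub>R (indicator {c<..R} y *\<^sub>R P z y))"
      unfolding set_lebesgue_integral_def[of "mu \<alpha>"] by (rule integral_mu) measurable
    also have "\<dots> = (LINT y:{c<..R}|lborel. y powr (2 * \<alpha> + 1) * P z y)"
      unfolding set_lebesgue_integral_def using c by (intro Bochner_Integration.integral_cong) (auto simp: indicator_def)
    also have "\<dots> = (LINT y:{c..R}|lborel. y powr (2 * \<alpha> + 1) * P z y)"
    proof (rule set_integral_cong_set)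
      have "AE y in lborel. y \<noteq> c" by (rule AE_lborel_singleton)
      then show "AE y in lborel. (y \<in> {c..R}) = (y \<in> {c<..R})" by (rule AE_mp) (auto intro!: AE_I2)
    qed (auto simp: set_borel_measurable_def P_def)
    also have "\<dots> = J c z R"
    proof -
      have "continuous_on {c..R} (\<lambda>y. y powr (2 * \<alpha> + 1) * P z y)"
        unfolding P_def using c t x z ab by (intro continuous_intros continuous_on_bessel_triple) auto
      then have "set_integrable lborel {c..R} (\<lambda>y. y powr (2 * \<alpha> + 1) * P z y)"
        by (rule borel_integrable_atLeastAtMost')
      from set_borel_integral_eq_integral(2)[OF this] show ?thesis by (simp add: J_def)
    qed
    finally show ?thesis .
  qed
  obtain D where D: "D \<ge> 0" "\<And>z. 0 < z \<Longrightarrow> z \<le> b \<Longrightarrow> \<bar>I z\<bar> \<le> D"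
    using bessel_triple_truncated[OF \<alpha> t x b, of c \<gamma>] unfolding I_def by blast
  show ?thesis
  proof (rule exI[of _ c], rule exI[of _ p], rule exI[of _ "D + C"], intro conjI ballI impI allI p)
    fix z assume z: "z \<in> {a..b}" "\<forall>i<4. frequency t x z i \<noteq> 0"
    show "\<bar>truncated_kernel \<alpha> \<gamma> t x z R\<bar> \<le> (D + C) * frequency_weight p t x z" if R: "R \<ge> c" for R
    proof -
      have "\<bar>truncated_kernel \<alpha> \<gamma> t x z R\<bar> \<le> D + C * frequency_weight p t x z"
        using D(2)[of z] z ab bnd[OF z R] unfolding split[OF z(1) R] by auto
      also have "D \<le> D * frequency_weight p t x z" using D(1) frequency_weight_ge_1 by (simp add: mult_le_cancel_left1)
      finally show ?thesis by (simp add: distrib_right)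
    qed
    obtain L where L: "(J c z \<longlongrightarrow> L) at_top" using conv[OF z] by blast
    have "((\<lambda>R. I z + J c z R) \<longlongrightarrow> I z + L) at_top" by (intro tendsto_intros L)
    then have "(truncated_kernel \<alpha> \<gamma> t x z \<longlongrightarrow> I z + L) at_top"
      by (rule Lim_transform_eventually) (auto simp: eventually_at_top_linorder split[OF z(1)] intro!: exI[of _ c])
    moreover from tendsto_Lim[OF _ this] have "Lim at_top (truncated_kernel \<alpha> \<gamma> t x z) = I z + L" by simp
    ultimately show "(truncated_kernel \<alpha> \<gamma> t x z \<longlongrightarrow> Lim at_top (truncated_kernel \<alpha> \<gamma> t x z)) at_top" by simp
  qed
qed

section \<open>Interchange of the integrations\<close>

text \<open>The integral of \<open>u powr -p\<close> over \<open>{0..L}\<close>, moved to either side of the singularity \<open>w\<close>.\<close>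

lemma set_integrable_abs_powr:
  fixes a b w p :: real
  assumes p: "0 \<le> p" "p < 1"
  shows "set_integrable lborel {a..b} (\<lambda>z. \<bar>z - w\<bar> powr - p)"
proof -
  define L where "L = \<bar>a\<bar> + \<bar>b\<bar> + \<bar>w\<bar>"
  define h :: "real \<Rightarrow> real" where "h = (\<lambda>u. indicator {0..L} u * u powr - p)"
  have L: "L \<ge> 0" by (simp add: L_def)
  have "set_integrable lborel {0..L} (\<lambda>u. u powr - p)"
    using has_integral_powr_from_0[of "- p" L] p L
    by (subst set_integrable_lborel_iff_lebesgue) (auto intro!: nonnegative_absolutely_integrable_1)
  then have h: "integrable lborel h" by (simp add: h_def set_integrable_def)
  have "integrable lborel (\<lambda>z. h (- w + 1 * z) + h (w + (-1) * z))"
    by (intro Bochner_Integration.integrable_add lborel_integrable_real_affine h) auto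
  then show ?thesis
    unfolding set_integrable_def
  proof (rule Bochner_Integration.integrable_bound)
    show "AE z in lborel. norm (indicator {a..b} z *\<^sub>R \<bar>z - w\<bar> powr - p) \<le> norm (h (- w + 1 * z) + h (w + (-1) * z))"
    proof (rule AE_I2)
      fix z :: real
      have h0: "h u \<ge> 0" for u by (simp add: h_def)
      have "\<bar>z - w\<bar> powr - p \<le> h (z - w) + h (w - z)" if z: "z \<in> {a..b}"
      proof (cases "z \<ge> w")
        case True
        then have "\<bar>z - w\<bar> powr - p = h (z - w)" using z by (auto simp: h_def L_def indicator_def)
        then show ?thesis using h0 by simp
      next
        case False
        then have "\<bar>z - w\<bar> powr - p = h (w - z)" using z by (auto simp: h_def L_def indicator_def)
        then show ?thesis using h0 by simp
      qed
      then show "norm (indicator {a..b} z *\<^sub>R \<bar>z - w\<bar> powr - p) \<le> norm (h (- w + 1 * z) + h (w + (-1) * z))"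
        using h0[of "z - w"] h0[of "w - z"] by (auto simp: indicator_def)
    qed
  qed auto
qed

lemma frequency_weight_integrable:
  assumes f: "test_on a b f" and p: "0 \<le> p" "p < 1"
  shows "integrable (mu \<alpha>) (\<lambda>z. frequency_weight p t x z * norm (f z))"
proof -
  have ab: "0 < a" "a < b" and f0: "\<And>z. z > 0 \<Longrightarrow> z \<notin> {a..b} \<Longrightarrow> f z = 0" using f by (auto simp: test_on_def)
  note [measurable] = test_on_measurable[OF f]
  have "set_integrable lborel {a..b} (\<lambda>z. \<bar>frequency t x z i\<bar> powr - p)" for i
  proof -
    define s where "s = t + (if i < 2 then x else - x)"
    have "\<bar>frequency t x z i\<bar> = \<bar>z - (if even i then - s else s)\<bar>" for z
      by (auto simp: frequency_def s_def)
    then show ?thesis using set_integrable_abs_powr[OF p] by simp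
  qed
  moreover have "set_integrable lborel {a..b} (\<lambda>z. 1 :: real)"
    by (rule borel_integrable_atLeastAtMost') (rule continuous_on_const)
  ultimately have "set_integrable lborel {a..b} (frequency_weight p t x)"
    unfolding frequency_weight_def[abs_def] set_integrable_def scaleR_add_right scaleR_sum_right
    by (intro Bochner_Integration.integrable_add Bochner_Integration.integrable_sum)
  then have i: "integrable lborel (\<lambda>z. indicator {a..b} z * frequency_weight p t x z)" by (simp add: set_integrable_def)
  have w [measurable]: "frequency_weight p t x \<in> borel_measurable borel"
    unfolding frequency_weight_def[abs_def] frequency_def by measurable
  have "continuous_on {a..b} (\<lambda>z. of_real (z powr (2 * \<alpha> + 1)) * f z)"
    using ab by (intro continuous_intros continuous_on_subset[OF test_on_continuous[OF f]]) auto
  then have "bounded ((\<lambda>z. of_real (z powr (2 * \<alpha> + 1)) * f z) ` {a..b})"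
    by (intro compact_imp_bounded compact_continuous_image) auto
  then obtain B where B: "B > 0" "\<And>z. z \<in> {a..b} \<Longrightarrow> norm (of_real (z powr (2 * \<alpha> + 1)) * f z) \<le> B"
    unfolding bounded_pos by auto
  have m: "(\<lambda>z. frequency_weight p t x z * norm (f z)) \<in> borel_measurable (mu \<alpha>)"
    using borel_measurable_muI[OF w] by measurable
  have "(\<lambda>z. z powr (2 * \<alpha> + 1) *\<^sub>R (indicator {0<..} z *\<^sub>R (frequency_weight p t x z * norm (f z)))) \<in> borel_measurable lborel"
  proof (rule borel_measurable_scaleR)
    show "(\<lambda>z. indicator {0<..} z *\<^sub>R (frequency_weight p t x z * norm (f z))) \<in> borel_measurable lborel"
      using m unfolding borel_measurable_mu by (subst (asm) borel_measurable_restrict_space_iff) auto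
  qed simp
  then have m1: "(\<lambda>z. indicator {0<..} z *\<^sub>R (z powr (2 * \<alpha> + 1) *\<^sub>R (frequency_weight p t x z * norm (f z)))) \<in> borel_measurable lborel"
    by (simp add: mult_ac)
  have "integrable lborel (\<lambda>z. indicator {0<..} z *\<^sub>R (z powr (2 * \<alpha> + 1) *\<^sub>R (frequency_weight p t x z * norm (f z))))"
  proof (rule Bochner_Integration.integrable_bound[OF integrable_mult_right[OF i] m1])
    show "AE z in lborel. norm (indicator {0<..} z *\<^sub>R (z powr (2 * \<alpha> + 1) *\<^sub>R (frequency_weight p t x z * norm (f z))))
      \<le> norm (B * (indicator {a..b} z * frequency_weight p t x z))"
    proof (rule AE_I2)
      fix z :: real
      have w: "frequency_weight p t x z \<ge> 0" using frequency_weight_ge_1 by (rule order.trans[rotated]) simp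
      show "norm (indicator {0<..} z *\<^sub>R (z powr (2 * \<alpha> + 1) *\<^sub>R (frequency_weight p t x z * norm (f z))))
        \<le> norm (B * (indicator {a..b} z * frequency_weight p t x z))"
      proof (cases "z \<in> {a..b}")
        case True
        then have "z powr (2 * \<alpha> + 1) * norm (f z) * frequency_weight p t x z \<le> B * frequency_weight p t x z"
          using B(2)[OF True] w by (intro mult_right_mono) (auto simp: norm_mult)
        then show ?thesis using True ab w B by (simp add: abs_mult mult_ac)
      next
        case False
        then show ?thesis using f0[of z] by (auto simp: indicator_def)
      qed
    qed
  qed
  then show ?thesis by (subst integrable_mu_iff[OF m]) (simp add: set_integrable_def)
qed

lemma borel_measurable_truncated_kernel:
  "(\<lambda>z. truncated_kernel \<alpha> \<gamma> t x z R) \<in> borel_measurable (mu \<alpha>)"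
proof -
  interpret sigma_finite_measure "mu \<alpha>" by (rule sigma_finite_mu)
  note [measurable] = borel_measurable_mu_indicator[of "{0<..R}" \<alpha>]
  have "(\<lambda>(z, y). indicator {0<..R} y *\<^sub>R bessel_triple \<alpha> \<gamma> t x z y) \<in> borel_measurable (mu \<alpha> \<Otimes>\<^sub>M mu \<alpha>)"
    by measurable
  then show ?thesis
    unfolding truncated_kernel_def[abs_def] set_lebesgue_integral_def by (rule borel_measurable_lebesgue_integral)
qed

text \<open>Fubini's theorem: with \<open>y \<le> R\<close> and \<open>z\<close> in the support of \<open>f\<close> the three quotients are bounded.\<close>

lemma truncated_hankel_eq:
  assumes f: "test_on a b f" and \<alpha>: "\<alpha> > -1" and t: "t > 0" and x: "x > 0"
  shows "(LINT y|mu \<alpha>. of_real (indicator {0<..R} y) * (of_real (q \<alpha> (x * y)) * filtered_hankel \<alpha> \<beta> t f y))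
    = (LINT z|mu \<alpha>. of_real (2 powr (\<alpha> + \<beta>) * Gamma (\<alpha> + \<beta> + 1) * truncated_kernel \<alpha> (\<alpha> + \<beta>) t x z R) * f z)"
proof -
  interpret pair_sigma_finite "mu \<alpha>" "mu \<alpha>" by (rule pair_sigma_finite_mu)
  have b: "b > 0" and f0: "\<And>z. z > 0 \<Longrightarrow> z \<notin> {a..b} \<Longrightarrow> f z = 0" using f by (auto simp: test_on_def)
  define k where "k = 2 powr (\<alpha> + \<beta>) * Gamma (\<alpha> + \<beta> + 1)"
  note fm [measurable] = test_on_measurable[OF f]
  note [measurable] = borel_measurable_mu_indicator[of "{0<..R}" \<alpha>]
  define \<Phi> where "\<Phi> = (\<lambda>z y. of_real (indicator {0<..R} y * (k * bessel_triple \<alpha> (\<alpha> + \<beta>) t x z y)) * f z)"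
  obtain B where B: "B > 0" "\<And>z y. 0 < z \<Longrightarrow> z \<le> b \<Longrightarrow> 0 < y \<Longrightarrow> y \<le> R \<Longrightarrow> \<bar>bessel_triple \<alpha> (\<alpha> + \<beta>) t x z y\<bar> \<le> B"
    using bessel_triple_bounded[OF t x b] by blast
  have i1: "integrable (mu \<alpha>) (\<lambda>z. \<bar>k\<bar> * B * norm (f z))"
    by (intro integrable_mult_right integrable_norm rapid_integrable[OF \<alpha> test_on_rapid[OF f] fm])
  have "integrable (mu \<alpha> \<Otimes>\<^sub>M mu \<alpha>) (\<lambda>p. \<bar>k\<bar> * B * norm (f (fst p)) * indicator {..R} (snd p))"
    by (rule integrable_pair_times[OF pair_sigma_finite_mu i1 integrable_mu_indicator_atMost[OF \<alpha>]])
  then have "integrable (mu \<alpha> \<Otimes>\<^sub>M mu \<alpha>) (\<lambda>(z, y). \<Phi> z y)"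
  proof (rule Bochner_Integration.integrable_bound)
    show "AE p in mu \<alpha> \<Otimes>\<^sub>M mu \<alpha>. norm (case p of (z, y) \<Rightarrow> \<Phi> z y) \<le> norm (\<bar>k\<bar> * B * norm (f (fst p)) * indicator {..R} (snd p))"
    proof (rule AE_I2)
      fix p assume "p \<in> space (mu \<alpha> \<Otimes>\<^sub>M mu \<alpha>)"
      then obtain z y where p: "p = (z, y)" "z > 0" "y > 0" by (auto simp: space_pair_measure)
      have "\<bar>k\<bar> * \<bar>bessel_triple \<alpha> (\<alpha> + \<beta>) t x z y\<bar> * norm (f z) \<le> \<bar>k\<bar> * B * norm (f z)" if "y \<le> R"
      proof (cases "z \<in> {a..b}")
        case True
        then show ?thesis using B p that by (intro mult_right_mono mult_left_mono) auto
      qed (simp add: f0 p)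
      then show "norm (case p of (z, y) \<Rightarrow> \<Phi> z y) \<le> norm (\<bar>k\<bar> * B * norm (f (fst p)) * indicator {..R} (snd p))"
        using p B by (auto simp: \<Phi>_def norm_mult abs_mult indicator_def)
    qed
  qed (unfold \<Phi>_def, measurable)
  from Fubini_integral[OF this]
  have "(LINT y|mu \<alpha>. LINT z|mu \<alpha>. \<Phi> z y) = (LINT z|mu \<alpha>. LINT y|mu \<alpha>. \<Phi> z y)" .
  moreover have "(LINT z|mu \<alpha>. \<Phi> z y) = of_real (indicator {0<..R} y) * (of_real (q \<alpha> (x * y)) * filtered_hankel \<alpha> \<beta> t f y)" for y
  proof -
    define r where "r = indicator {0<..R} y * (q \<alpha> (x * y) * (k * q (\<alpha> + \<beta>) (t * y)))"
    have "(LINT z|mu \<alpha>. \<Phi> z y) = (LINT z|mu \<alpha>. of_real r * (of_real (q \<alpha> (y * z)) * f z))"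
      unfolding \<Phi>_def r_def bessel_triple_def by (intro Bochner_Integration.integral_cong) (simp_all add: mult_ac)
    also have "\<dots> = of_real r * hankel \<alpha> f y"
      unfolding hankel_def by (rule integral_mult_right_zero)
    finally show ?thesis by (simp add: r_def filtered_hankel_def multiplier_def k_def mult_ac)
  qed
  moreover have "(LINT y|mu \<alpha>. \<Phi> z y) = of_real (k * truncated_kernel \<alpha> (\<alpha> + \<beta>) t x z R) * f z" for z
  proof -
    have "(LINT y|mu \<alpha>. \<Phi> z y) = of_real (LINT y|mu \<alpha>. k * (indicator {0<..R} y * bessel_triple \<alpha> (\<alpha> + \<beta>) t x z y)) * f z"
      unfolding \<Phi>_def integral_mult_left_zero integral_complex_of_real by (simp only: mult.left_commute)
    then show ?thesis by (simp add: truncated_kernel_def set_lebesgue_integral_def)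
  qed
  ultimately show ?thesis by (simp add: k_def)
qed

text \<open>Dominated convergence on both sides of the truncated identity. The exceptional \<open>z\<close>, where a
  frequency vanishes, form a finite set; the sequence is set to \<open>0\<close> there, which makes it
  converge everywhere and gives measurability of its limit.\<close>

lemma kernel_op_eq_hankel:
  assumes f: "test_on a b f" and \<alpha>: "\<alpha> > -1" and \<beta>: "\<alpha> + \<beta> > - 1 / 2" and t: "t > 0" and x: "x > 0"
  shows "integrable (mu \<alpha>) (\<lambda>z. of_real (kernel \<alpha> \<beta> t x z) * f z)"
    and "hankel \<alpha> (filtered_hankel \<alpha> \<beta> t f) x = kernel_op \<alpha> \<beta> t f x"
proof -
  have ab: "0 < a" "a < b" and f0: "\<And>z. z > 0 \<Longrightarrow> z \<notin> {a..b} \<Longrightarrow> f z = 0" using f by (auto simp: test_on_def)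
  define k where "k = 2 powr (\<alpha> + \<beta>) * Gamma (\<alpha> + \<beta> + 1)"
  define h where "h = filtered_hankel \<alpha> \<beta> t f"
  define T where "T = truncated_kernel \<alpha> (\<alpha> + \<beta>) t x"
  define X where "X = {z. \<exists>i<4. frequency t x z i = 0}"
  have X: "finite X" unfolding X_def by (rule finite_zero_frequency)
  then have X_borel: "X \<in> sets borel" by (simp add: finite_imp_closed borel_closed)
  have AE_X: "AE z in mu \<alpha>. z \<notin> X"
    using AE_not_in[OF finite_imp_null_set_lborel[OF X]] unfolding AE_mu by (rule AE_mp) (auto intro!: AE_I2)
  note fm [measurable] = test_on_measurable[OF f]
  have hm [measurable]: "h \<in> borel_measurable (mu \<alpha>)"
    unfolding h_def by (rule borel_measurable_mu_continuous[OF filtered_hankel_continuous[OF f t]])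
  have Tm [measurable]: "(\<lambda>z. T z R) \<in> borel_measurable (mu \<alpha>)" for R
    unfolding T_def by (rule borel_measurable_truncated_kernel)
  have Keq: "kernel \<alpha> \<beta> t x z = k * Lim at_top (T z)" for z
    unfolding kernel_def k_def T_def truncated_kernel_def[abs_def] bessel_triple_def ..
  obtain c p C where p: "0 \<le> p" "p < 1"
    and bnd: "\<And>z R. z \<in> {a..b} \<Longrightarrow> z \<notin> X \<Longrightarrow> R \<ge> c \<Longrightarrow> \<bar>T z R\<bar> \<le> C * frequency_weight p t x z"
    and lim: "\<And>z. z \<in> {a..b} \<Longrightarrow> z \<notin> X \<Longrightarrow> (T z \<longlongrightarrow> Lim at_top (T z)) at_top"
    using kernel_truncation[OF \<alpha> \<beta> t x ab] unfolding X_def T_def by blast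
  \<comment> \<open>Starting at \<open>c\<close>, so that the bound holds from the first term on.\<close>
  define r where "r = (\<lambda>n::nat. c + real n)"
  have r: "filterlim r at_top sequentially"
    unfolding r_def by (intro filterlim_tendsto_add_at_top[OF tendsto_const] filterlim_real_sequentially)
  have rc: "r n \<ge> c" for n by (simp add: r_def)
  define s where "s = (\<lambda>n z. of_real (indicator (- X) z * (k * T z (r n))) * f z)"
  define F where "F = (\<lambda>z. of_real (indicator (- X) z * kernel \<alpha> \<beta> t x z) * f z)"
  note [measurable] = borel_measurable_mu_indicator[of "- X" \<alpha>, OF borel_comp[OF X_borel]]
  have sm [measurable]: "s n \<in> borel_measurable (mu \<alpha>)" for n
    unfolding s_def by measurable
  have sF: "(\<lambda>n. s n z) \<longlonglongrightarrow> F z" if z: "z > 0" for z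
  proof (cases "z \<notin> X \<and> z \<in> {a..b}")
    case True
    have "(\<lambda>n. T z (r n)) \<longlonglongrightarrow> Lim at_top (T z)"
      by (rule filterlim_compose[OF lim r]) (use True in auto)
    then show ?thesis unfolding s_def F_def Keq by (intro tendsto_intros)
  next
    case False
    then show ?thesis using f0[OF z] by (auto simp: s_def F_def)
  qed
  have Fm [measurable]: "F \<in> borel_measurable (mu \<alpha>)"
    by (rule borel_measurable_LIMSEQ_metric[OF sm]) (use sF in auto)
  define w where "w = (\<lambda>z. \<bar>k\<bar> * \<bar>C\<bar> * (frequency_weight p t x z * norm (f z)))"
  have wi: "integrable (mu \<alpha>) w"
    unfolding w_def by (intro integrable_mult_right frequency_weight_integrable[OF f p])
  have sw: "norm (s n z) \<le> w z" if z: "z > 0" for n z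
  proof (cases "z \<notin> X \<and> z \<in> {a..b}")
    case True
    have 1: "frequency_weight p t x z \<ge> 0" using frequency_weight_ge_1 by (rule order.trans[rotated]) simp
    then have "\<bar>T z (r n)\<bar> \<le> \<bar>C\<bar> * frequency_weight p t x z"
      using bnd[of z "r n"] True rc mult_right_mono[OF abs_ge_self 1, of C] by fastforce
    then have "\<bar>k\<bar> * \<bar>T z (r n)\<bar> * norm (f z) \<le> \<bar>k\<bar> * (\<bar>C\<bar> * frequency_weight p t x z) * norm (f z)"
      by (intro mult_right_mono mult_left_mono) auto
    then show ?thesis using True by (simp add: s_def w_def norm_mult abs_mult mult_ac)
  next
    case False
    have "w z \<ge> 0" unfolding w_def using frequency_weight_ge_1[of p t x z] by (intro mult_nonneg_nonneg) auto
    then show ?thesis using False f0[OF z] by (auto simp: s_def)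
  qed
  have F: "integrable (mu \<alpha>) F" "(\<lambda>n. LINT z|mu \<alpha>. s n z) \<longlonglongrightarrow> (LINT z|mu \<alpha>. F z)"
    using sF sw by (auto intro!: AE_I2 integrable_dominated_convergence[OF Fm sm wi] integral_dominated_convergence[OF Fm sm wi])
  have G: "(\<lambda>z. of_real (kernel \<alpha> \<beta> t x z) * f z) \<in> borel_measurable (mu \<alpha>)"
  proof (rule measurable_discrete_difference[OF Fm, of "X \<inter> {0<..}"])
    show "countable (X \<inter> {0<..})" using X by (intro countable_finite finite_Int) simp
    show "{z} \<in> sets (mu \<alpha>)" if "z \<in> X \<inter> {0<..}" for z
      using that by (auto simp: sets_mu sets_restrict_space_iff)
  qed (auto simp: F_def)
  have ae: "AE z in mu \<alpha>. F z = of_real (kernel \<alpha> \<beta> t x z) * f z"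
    using AE_X by eventually_elim (simp add: F_def)
  show "integrable (mu \<alpha>) (\<lambda>z. of_real (kernel \<alpha> \<beta> t x z) * f z)"
    by (rule integrable_cong_AE_imp[OF F(1) G]) (use ae in \<open>auto elim: eventually_mono\<close>)
  have kop: "kernel_op \<alpha> \<beta> t f x = (LINT z|mu \<alpha>. F z)"
    unfolding kernel_op_def by (rule integral_cong_AE[OF G Fm]) (use ae in \<open>auto elim: eventually_mono\<close>)
  define g where "g = (\<lambda>y. of_real (q \<alpha> (x * y)) * h y)"
  have se: "(LINT z|mu \<alpha>. s n z) = (LINT y|mu \<alpha>. of_real (indicator {0<..r n} y) * g y)" for n
  proof -
    have "(LINT z|mu \<alpha>. s n z) = (LINT z|mu \<alpha>. of_real (k * T z (r n)) * f z)"
      by (rule integral_cong_AE) (use AE_X in \<open>auto simp: s_def elim: eventually_mono\<close>)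
    then show ?thesis unfolding g_def h_def k_def T_def truncated_hankel_eq[OF f \<alpha> t x] .
  qed
  have gi: "integrable (mu \<alpha>) g"
    unfolding g_def h_def by (rule rapid_hankel_integrable[OF \<alpha> filtered_hankel_rapid[OF f \<alpha> \<beta> t] hm[unfolded h_def] x])
  then have [measurable]: "g \<in> borel_measurable (mu \<alpha>)" by simp
  have "(\<lambda>n. LINT y|mu \<alpha>. of_real (indicator {0<..r n} y) * g y) \<longlonglongrightarrow> (LINT y|mu \<alpha>. g y)"
  proof (rule integral_dominated_convergence)
    show "integrable (mu \<alpha>) (\<lambda>y. norm (g y))" using gi by (rule integrable_norm)
    show "AE y in mu \<alpha>. (\<lambda>n. of_real (indicator {0<..r n} y) * g y) \<longlonglongrightarrow> g y"
    proof (rule AE_I2)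
      fix y assume "y \<in> space (mu \<alpha>)"
      then have y: "y > 0" by simp
      have "eventually (\<lambda>n. r n \<ge> y) sequentially" using r by (simp add: filterlim_at_top)
      then have "eventually (\<lambda>n. g y = of_real (indicator {0<..r n} y) * g y) sequentially"
        by eventually_elim (simp add: y)
      then show "(\<lambda>n. of_real (indicator {0<..r n} y) * g y) \<longlonglongrightarrow> g y"
        by (rule Lim_transform_eventually[OF tendsto_const])
    qed
    show "AE y in mu \<alpha>. norm (of_real (indicator {0<..r n} y) * g y) \<le> norm (g y)" for n
      by (intro AE_I2) (auto simp: indicator_def)
    show "(\<lambda>y. of_real (indicator {0<..r n} y) * g y) \<in> borel_measurable (mu \<alpha>)" for n
      using borel_measurable_mu_indicator[of "{0<..r n}" \<alpha>] by measurable
  qed measurable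
  then have "(\<lambda>n. LINT z|mu \<alpha>. s n z) \<longlonglongrightarrow> hankel \<alpha> h x" unfolding se hankel_def g_def .
  then show "hankel \<alpha> (filtered_hankel \<alpha> \<beta> t f) x = kernel_op \<alpha> \<beta> t f x"
    using F(2) LIMSEQ_unique unfolding kop h_def by blast
qed

theorem proposition1p1:
  fixes \<alpha> \<beta> t :: real
  assumes "\<alpha> > - 1" and "\<alpha> + \<beta> > - 1 / 2" and "t > 0"
  shows "Cc_infinity \<subseteq> kernel_dom \<alpha> \<beta> t \<and>
    (\<forall>f \<in> Cc_infinity. AE x in mu \<alpha>. multiplier_op \<alpha> \<beta> t f x = kernel_op \<alpha> \<beta> t f x)"
proof (intro conjI subsetI ballI)
  fix f assume "f \<in> Cc_infinity"
  then obtain a b where f: "test_on a b f" using Cc_infinity_imp_test_on by blast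
  show "f \<in> kernel_dom \<alpha> \<beta> t"
    unfolding kernel_dom_def using kernel_op_eq_hankel(1)[OF f assms] by (auto intro!: AE_I2)
next
  fix f assume "f \<in> Cc_infinity"
  then obtain a b where f: "test_on a b f" using Cc_infinity_imp_test_on by blast
  have "AE x in mu \<alpha>. hankel \<alpha> (filtered_hankel \<alpha> \<beta> t f) x = kernel_op \<alpha> \<beta> t f x"
    using kernel_op_eq_hankel(2)[OF f assms] by (auto intro!: AE_I2)
  with multiplier_op_eq[OF f assms]
  show "AE x in mu \<alpha>. multiplier_op \<alpha> \<beta> t f x = kernel_op \<alpha> \<beta> t f x"
    by eventually_elim simp
qed

end
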